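(* Let $(\mathcal{H},\mathcal{W}_{\sigma,T},\omega_{\sigma,T})$ be an $\omega_{\sigma,T}$-representation of $W$, where $T:W\to W$ is linear with $T+T^{\sigma}$ an isomorphism. Let $\mathrm{Op}_{\sigma,T}$ be the $T$-Weyl calculus corresponding to this representation, and let $\mathrm{Op}^{\widetilde{w}}$ be the standard Weyl calculus corresponding to the associated Weyl system $(\mathcal{H},\widetilde{\mathcal{W}}_{\sigma,T},\widetilde{\omega}_{\sigma,T})$ for the symplectic space $(W,\sigma_{T+T^{\sigma}})$. Then for every $a\in\mathcal{S}'(W)$ $$\mathrm{Op}_{\sigma,T}(a)=\mathrm{Op}^{\widetilde{w}}(a^{w}_{\sigma,T}),$$ where $a^{w}_{\sigma,T}\in\mathcal{S}'(W)$ is given by any of the following (equal) expressions: $$a^{w}_{\sigma,T}=(T+T^{\sigma})^{*}\big(\lambda_{\sigma,T}(D_{\sigma})(a)\big)=\big(\lambda_{\sigma,T}\circ(T+T^{\sigma})^{-1}\big)(D_{\sigma})\big((T+T^{\sigma})^{*}(a)\big)=\lambda_{\sigma,T}(D_{\sigma_{T+T^{\sigma}}})\big((T+T^{\sigma})^{*}(a)\big),$$ with $\lambda_{\sigma,T}(\xi)=\mathrm{e}^{-\frac{\mathrm{i}}{2}\theta_{\sigma,T}(\xi)}$ and $\theta_{\sigma,T}(\xi)=\sigma(\xi,T\xi)$. In other notation, $a^{w}_{\sigma,T}=(T+T^{\sigma})^{*}\big(\mathrm{e}^{-\frac{\mathrm{i}}{2}\theta_{\sigma,T}(D_{\sigm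a})}(a)\big)=\mathrm{e}^{-\frac{\mathrm{i}}{2}\theta_{\sigma,T}(D_{\sigma_{T+T^{\sigma}}})}\big(a\circ(T+T^{\sigma})\big)$.
   Context: $(W,\sigma)$ is a symplectic vector space: a real vector space of finite dimension $2n$ with a non-degenerate antisymmetric bilinear form $\sigma$. For a linear $T:W\to W$, the symplectic adjoint $T^{\sigma}$ is defined by $\sigma(T^{\sigma}\xi,\eta)=\sigma(\xi,T\eta)$ for all $\xi,\eta\in W$. Standing assumption: $T+T^{\sigma}$ is an isomorphism. Put $\omega_{\sigma,T}(\xi,\eta)=\mathrm{e}^{\mathrm{i}\sigma(\xi,T\eta)}$ and $\sigma_{T+T^{\sigma}}(\xi,\eta)=\sigma(\xi,(T+T^{\sigma})\eta)$, which is again a symplectic form on $W$. An $\omega_{\sigma,T}$-representation $(\mathcal{H},\mathcal{W}_{\sigma,T},\omega_{\sigma,T})$ of $W$ is a complex Hilbert space $\mathcal{H}$ with a strongly continuous map $\mathcal{W}_{\sigma,T}:W\to\mathcal{U}(\mathcal{H})$ (unitary operators) such that $\mathcal{W}_{\sigma,T}(\xi)\mathcal{W}_{\sigma,T}(\eta)=\omega_{\sigma,T}(\xi,\eta)\mathcal{W}_{\sigma,T}(\xi+\eta)$. Put $\widetilde{\mathcal{W}}_{\sigma,T}(\xi)=\mathrm{e}^{\frac{\mathrm{i}}{2}\sigma(\xi,T\xi)}\mathcal{W}_{\sigma,T}(\xi)$ and $\widetilde\omega_{\sigma,T}(\xi,\eta)=\mathrm{e}^{\frac{\mathrm{i}}{2}\sigma(\xi,(T+T^{\sigma})\eta)}$;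 then $\widetilde{\mathcal{W}}_{\sigma,T}(\xi)\widetilde{\mathcal{W}}_{\sigma,T}(\eta)=\widetilde\omega_{\sigma,T}(\xi,\eta)\widetilde{\mathcal{W}}_{\sigma,T}(\xi+\eta)$, i.e. it is a Weyl system for $(W,\sigma_{T+T^\sigma})$. For any symplectic form $\rho$ on $W$, $\mathrm{d}^{\rho}\xi$ is the unique Haar measure on $W$ such that the symplectic Fourier transform $(\mathcal{F}_{\rho}a)(\xi)=\int_W \mathrm{e}^{-\mathrm{i}\rho(\xi,\eta)}a(\eta)\,\mathrm{d}^{\rho}\eta$ is involutive and unitary on $L^2(W)$; $\mathcal{F}_\rho$ is extended to tempered distributions. For $\lambda\in\mathcal{C}^{\infty}_{\mathrm{pol}}(W)$ (smooth functions all of whose derivatives have at most polynomial growth), $\lambda(D_{\rho})=\mathcal{F}_{\rho}\circ \mathrm{M}_{\lambda}\circ\mathcal{F}_{\rho}$, where $\mathrm{M}_\lambda$ is multiplication by $\lambda$. For an invertible linear map $S$, $S^{*}(a)=a\circ S$. $\mathcal{S}\subset\mathcal{H}$ is the space of $\mathcal{C}^\infty$ vectors, i.e. those $\varphi\in\mathcal{H}$ for which $\xi\mapsto\mathcal{W}_{\sigma,T}(\xi)\varphi$ is $\mathcal{C}^\infty$; it is a Fréchet space with seminorms $\|\phi_T(\xi_1)\cdots\phi_T(\xi_k)\varphi\|_{\mathcal{H}}$ ($k\in\mathbb{N}$, $\xi_j\in W$), where $\phi_T(\xi)$ is the self-adjoint operator with $\widetilde{\mathcal{W}}_{\sigma,T}(t\xi)=\mathrm{e}^{\mathrm{i}t\phi_T(\xi)}$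 for all real $t$. $\mathcal{S}^{*}$ is the space of continuous antilinear functionals on $\mathcal{S}$ with the weak topology; $\mathcal{S}\subset\mathcal{H}\subset\mathcal{S}^{*}$, and $\langle\cdot,\cdot\rangle$ (antilinear in the first argument) denotes the antiduality extending the scalar product. $\mathcal{S}^{*}(W)$ is the space of continuous antilinear functionals on the Schwartz space $\mathcal{S}(W)$, identified with tempered distributions $\mathcal{S}'(W)$; a function $a$ acts by $\varphi\mapsto\int\overline{\varphi}\,a\,\mathrm{d}^{\sigma}\xi$ (with $\mathrm d^{\sigma_{T+T^\sigma}}\xi$ instead when working with the symplectic form $\sigma_{T+T^\sigma}$). For $\varphi,\psi\in\mathcal{S}$ the function $\xi\mapsto\langle\varphi,\mathcal{W}_{\sigma,T}(\xi)\psi\rangle$ is in $\mathcal{S}(W)$. $T$-Weyl calculus: for $a\in\mathcal{S}^{*}(W)$, $\mathrm{Op}_{\sigma,T}(a)=\int_W\mathcal{W}_{\sigma,T}(\xi)\mathcal{F}_{\sigma}(a)(\xi)\,\mathrm{d}^{\sigma}\xi:\mathcal{S}\to\mathcal{S}^{*}$, in the weak sense $\langle\varphi,\mathrm{Op}_{\sigma,T}(a)\psi\rangle=\big\langle\overline{\langle\varphi,\mathcal{W}_{\sigma,T}(\cdot)\psi\rangle},\mathcal{F}_{\sigma}(a)\big\rangle_{\mathcal{S}(W),\mathcal{S}^{*}(W)}$ for $\varphi,\psi\in\mathcal{S}$. Standard Weyl calculus of the associated Weyl system: $\mathrm{Op}^{\widetilde{w}}(b)=\int_W\mathcal{F}_{\sigma_{T+T^{\sigma}}}(b)(\xi)\,\widetilde{\mathcal{W}}_{\sigma,T}(\xi)\,\mathrm{d}^{\sigma_{T+T^{\sigma}}}\xi:\mathcal{S}\to\mathcal{S}^{*}$,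 in the same weak sense. *)

theory Defs
  imports "HOL-Analysis.Analysis"
begin

section \<open>Symplectic forms\<close>

text \<open>The symplectic vector space \<open>W\<close> is a type of class \<^class>\<open>euclidean_space\<close>: its inner product
  only provides the topology, a norm and a reference Lebesgue measure. Non-degeneracy and
  antisymmetry force the dimension to be even.\<close>

definition symplectic_form :: "('w::euclidean_space \<Rightarrow> 'w \<Rightarrow> real) \<Rightarrow> bool" where
  "symplectic_form \<sigma> \<longleftrightarrow>
     bilinear \<sigma> \<and> (\<forall>\<xi> \<eta>. \<sigma> \<xi> \<eta> = - \<sigma> \<eta> \<xi>) \<and> (\<forall>\<xi>. (\<forall>\<eta>. \<sigma> \<xi> \<eta> = 0) \<longrightarrow> \<xi> = 0)"

definition symplectic_adjoint ::
  "('w::euclidean_space \<Rightarrow> 'w \<Rightarrow> real) \<Rightarrow> ('w \<Rightarrow> 'w) \<Rightarrow> 'w \<Rightarrow> 'w" where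
  "symplectic_adjoint \<sigma> T = (THE T'. \<forall>\<xi> \<eta>. \<sigma> (T' \<xi>) \<eta> = \<sigma> \<xi> (T \<eta>))"

definition plus_adjoint ::
  "('w::euclidean_space \<Rightarrow> 'w \<Rightarrow> real) \<Rightarrow> ('w \<Rightarrow> 'w) \<Rightarrow> 'w \<Rightarrow> 'w" where
  "plus_adjoint \<sigma> T \<xi> = T \<xi> + symplectic_adjoint \<sigma> T \<xi>"

definition twisted_form ::
  "('w::euclidean_space \<Rightarrow> 'w \<Rightarrow> real) \<Rightarrow> ('w \<Rightarrow> 'w) \<Rightarrow> 'w \<Rightarrow> 'w \<Rightarrow> real" where
  "twisted_form \<sigma> T \<xi> \<eta> = \<sigma> \<xi> (plus_adjoint \<sigma> T \<eta>)"

definition quad_phase ::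
  "('w::euclidean_space \<Rightarrow> 'w \<Rightarrow> real) \<Rightarrow> ('w \<Rightarrow> 'w) \<Rightarrow> 'w \<Rightarrow> real" where
  "quad_phase \<sigma> T \<xi> = \<sigma> \<xi> (T \<xi>)"

definition lambda_symbol ::
  "('w::euclidean_space \<Rightarrow> 'w \<Rightarrow> real) \<Rightarrow> ('w \<Rightarrow> 'w) \<Rightarrow> 'w \<Rightarrow> complex" where
  "lambda_symbol \<sigma> T \<xi> = exp (- (\<i> / 2) * complex_of_real (quad_phase \<sigma> T \<xi>))"

section \<open>Smooth functions and Schwartz functions\<close>

primrec iter_deriv ::
  "'w::euclidean_space list \<Rightarrow> ('w \<Rightarrow> 'b::real_normed_vector) \<Rightarrow> 'w \<Rightarrow> 'b" where
  "iter_deriv [] f = f"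
| "iter_deriv (v # vs) f = (\<lambda>x. frechet_derivative (iter_deriv vs f) (at x) v)"

text \<open>Frechet differentiability of all iterated directional derivatives includes their continuity,
  so this is the class of infinitely differentiable functions.\<close>

definition smooth :: "('w::euclidean_space \<Rightarrow> 'b::real_normed_vector) \<Rightarrow> bool" where
  "smooth f \<longleftrightarrow> (\<forall>vs x. iter_deriv vs f differentiable (at x))"

definition schwartz :: "('w::euclidean_space \<Rightarrow> complex) set" where
  "schwartz = {f. smooth f \<and> (\<forall>k vs. \<exists>C. \<forall>x. norm x ^ k * norm (iter_deriv vs f x) \<le> C)}"

definition schwartz_seminorm ::
  "nat \<Rightarrow> 'w::euclidean_space list \<Rightarrow> ('w \<Rightarrow> complex) \<Rightarrow> real" where
  "schwartz_seminorm k vs f = (SUP x. norm x ^ k * norm (iter_deriv vs f x))"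

definition schwartz_topology :: "('w::euclidean_space \<Rightarrow> complex) topology" where
  "schwartz_topology = topology_generated_by
     {{g \<in> schwartz. schwartz_seminorm k vs (\<lambda>x. g x - f x) < e} | k vs f e.
        f \<in> schwartz \<and> 0 < e}"

section \<open>The symplectic Fourier transform\<close>

definition haar_measure :: "'w::euclidean_space measure \<Rightarrow> bool" where
  "haar_measure M \<longleftrightarrow>
     sets M = sets borel \<and> (\<forall>v. distr M borel (\<lambda>x. v + x) = M) \<and>
     (\<forall>K. compact K \<longrightarrow> emeasure M K < \<infinity>) \<and> (\<forall>U. open U \<longrightarrow> U \<noteq> {} \<longrightarrow> 0 < emeasure M U)"

definition fourier_wrt ::
  "'w measure \<Rightarrow> ('w \<Rightarrow> 'w \<Rightarrow> real) \<Rightarrow> ('w::euclidean_space \<Rightarrow> complex) \<Rightarrow> 'w \<Rightarrow> complex" where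
  "fourier_wrt M \<rho> f \<xi> = (LINT \<eta>|M. exp (- \<i> * complex_of_real (\<rho> \<xi> \<eta>)) * f \<eta>)"

text \<open>The normalised Haar measure of a symplectic form. On square-integrable functions the Fourier
  transform is the continuous extension of the one on the (dense) Schwartz space, so being
  involutive and unitary there is expressed on Schwartz functions.\<close>

definition form_measure :: "('w::euclidean_space \<Rightarrow> 'w \<Rightarrow> real) \<Rightarrow> 'w measure" where
  "form_measure \<rho> = (THE M. haar_measure M \<and>
     (\<forall>f\<in>schwartz. fourier_wrt M \<rho> (fourier_wrt M \<rho> f) = f) \<and>
     (\<forall>f\<in>schwartz. \<forall>g\<in>schwartz.
        (LINT \<xi>|M. cnj (fourier_wrt M \<rho> f \<xi>) * fourier_wrt M \<rho> g \<xi>) =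
        (LINT \<xi>|M. cnj (f \<xi>) * g \<xi>)))"

definition fourier ::
  "('w \<Rightarrow> 'w \<Rightarrow> real) \<Rightarrow> ('w::euclidean_space \<Rightarrow> complex) \<Rightarrow> 'w \<Rightarrow> complex" where
  "fourier \<rho> = fourier_wrt (form_measure \<rho>) \<rho>"

section \<open>Tempered distributions\<close>

text \<open>A tempered distribution is a continuous antilinear functional on the Schwartz space,
  \<^const>\<open>undefined\<close> off that space so that equality of distributions is equality of functions.
  The embedding of functions into distributions needs a Haar measure; here it is
  \<^const>\<open>lborel\<close>, independently of any symplectic form: a function \<open>a\<close> is the functional sending
  \<open>\<phi>\<close> to \<open>LINT \<xi>|lborel. cnj (\<phi> \<xi>) * a \<xi>\<close>.\<close>

definition tempered_distributions :: "(('w::euclidean_space \<Rightarrow> complex) \<Rightarrow> complex) set" where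
  "tempered_distributions = {u \<in> extensional schwartz.
     (\<forall>f\<in>schwartz. \<forall>g\<in>schwartz. u (\<lambda>x. f x + g x) = u f + u g) \<and>
     (\<forall>c. \<forall>f\<in>schwartz. u (\<lambda>x. c * f x) = cnj c * u f) \<and>
     continuous_map schwartz_topology euclidean u}"

text \<open>The antiduality used with the symplectic form \<open>\<rho>\<close>, in which a function \<open>a\<close> acts by
  integrating \<open>cnj \<phi> * a\<close> against \<^term>\<open>form_measure \<rho>\<close>. That measure is a multiple of
  \<^const>\<open>lborel\<close>, the factor being its value on the unit cube.\<close>

definition form_pairing ::
  "('w \<Rightarrow> 'w \<Rightarrow> real) \<Rightarrow> ('w::euclidean_space \<Rightarrow> complex) \<Rightarrow>
   (('w \<Rightarrow> complex) \<Rightarrow> complex) \<Rightarrow> complex" where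
  "form_pairing \<rho> \<phi> u = complex_of_real (measure (form_measure \<rho>) (cbox 0 One)) * u \<phi>"

text \<open>The next three operations extend the operations on functions \<open>a\<close>, under the embedding above,
  by duality; they are the same for every choice of Haar measure in that embedding.
  The symplectic Fourier transform is its own adjoint by antisymmetry of \<open>\<rho>\<close>.\<close>

definition fourier_dist ::
  "('w \<Rightarrow> 'w \<Rightarrow> real) \<Rightarrow> (('w::euclidean_space \<Rightarrow> complex) \<Rightarrow> complex) \<Rightarrow>
   ('w \<Rightarrow> complex) \<Rightarrow> complex" where
  "fourier_dist \<rho> u = (\<lambda>\<phi>\<in>schwartz. u (fourier \<rho> \<phi>))"

definition mult_dist ::
  "('w \<Rightarrow> complex) \<Rightarrow> (('w::euclidean_space \<Rightarrow> complex) \<Rightarrow> complex) \<Rightarrow>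
   ('w \<Rightarrow> complex) \<Rightarrow> complex" where
  "mult_dist l u = (\<lambda>\<phi>\<in>schwartz. u (\<lambda>\<xi>. cnj (l \<xi>) * \<phi> \<xi>))"

text \<open>The pullback \<open>a \<circ> S\<close>; the factor is the inverse absolute determinant of \<open>S\<close>, written as the
  volume of the preimage of the unit cube (determinants in the library are about matrices).\<close>

definition pullback_dist ::
  "('w \<Rightarrow> 'w) \<Rightarrow> (('w::euclidean_space \<Rightarrow> complex) \<Rightarrow> complex) \<Rightarrow>
   ('w \<Rightarrow> complex) \<Rightarrow> complex" where
  "pullback_dist S u =
     (\<lambda>\<phi>\<in>schwartz. complex_of_real (measure lborel (S -` cbox 0 One)) * u (\<phi> \<circ> inv S))"

definition fourier_multiplier ::
  "('w \<Rightarrow> 'w \<Rightarrow> real) \<Rightarrow> ('w \<Rightarrow> complex) \<Rightarrow> (('w::euclidean_space \<Rightarrow> complex) \<Rightarrow> complex) \<Rightarrow>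
   ('w \<Rightarrow> complex) \<Rightarrow> complex" where
  "fourier_multiplier \<rho> l u = fourier_dist \<rho> (mult_dist l (fourier_dist \<rho> u))"

section \<open>Complex Hilbert spaces and representations\<close>

text \<open>The scalar product is antilinear in the first argument. The remaining laws (unit scalar,
  positive definiteness) follow from those of \<^class>\<open>banach\<close>.\<close>

class complex_hilbert = banach +
  fixes scaleC :: "complex \<Rightarrow> 'a \<Rightarrow> 'a"
    and cinner :: "'a \<Rightarrow> 'a \<Rightarrow> complex"
  assumes scaleR_scaleC: "scaleR r x = scaleC (complex_of_real r) x"
    and scaleC_add_right: "scaleC c (x + y) = scaleC c x + scaleC c y"
    and scaleC_add_left: "scaleC (c + d) x = scaleC c x + scaleC d x"
    and scaleC_scaleC: "scaleC c (scaleC d x) = scaleC (c * d) x"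
    and cinner_commute: "cinner x y = cnj (cinner y x)"
    and cinner_add_right: "cinner x (y + z) = cinner x y + cinner x z"
    and cinner_scaleC_right: "cinner x (scaleC c y) = c * cinner x y"
    and norm_eq_sqrt_cinner: "norm x = sqrt (Re (cinner x x))"

definition unitary_operator :: "('h::complex_hilbert \<Rightarrow> 'h) \<Rightarrow> bool" where
  "unitary_operator U \<longleftrightarrow>
     (\<forall>x y. U (x + y) = U x + U y) \<and> (\<forall>c x. U (scaleC c x) = scaleC c (U x)) \<and>
     (\<forall>x y. cinner (U x) (U y) = cinner x y) \<and> surj U"

definition omega_representation ::
  "('w::euclidean_space \<Rightarrow> 'w \<Rightarrow> real) \<Rightarrow> ('w \<Rightarrow> 'w) \<Rightarrow>
   ('w \<Rightarrow> 'h::complex_hilbert \<Rightarrow> 'h) \<Rightarrow> bool" where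
  "omega_representation \<sigma> T W \<longleftrightarrow>
     (\<forall>\<xi>. unitary_operator (W \<xi>)) \<and>
     (\<forall>\<phi>. continuous_on UNIV (\<lambda>\<xi>. W \<xi> \<phi>)) \<and>
     (\<forall>\<xi> \<eta> \<phi>. W \<xi> (W \<eta> \<phi>) =
        scaleC (exp (\<i> * complex_of_real (\<sigma> \<xi> (T \<eta>)))) (W (\<xi> + \<eta>) \<phi>))"

definition associated_weyl_system ::
  "('w::euclidean_space \<Rightarrow> 'w \<Rightarrow> real) \<Rightarrow> ('w \<Rightarrow> 'w) \<Rightarrow>
   ('w \<Rightarrow> 'h::complex_hilbert \<Rightarrow> 'h) \<Rightarrow> 'w \<Rightarrow> 'h \<Rightarrow> 'h" where
  "associated_weyl_system \<sigma> T W \<xi> \<phi> =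
     scaleC (exp ((\<i> / 2) * complex_of_real (\<sigma> \<xi> (T \<xi>)))) (W \<xi> \<phi>)"

definition smooth_vectors ::
  "('w::euclidean_space \<Rightarrow> 'h::complex_hilbert \<Rightarrow> 'h) \<Rightarrow> 'h set" where
  "smooth_vectors W = {\<phi>. smooth (\<lambda>\<xi>. W \<xi> \<phi>)}"

text \<open>The operator that integrates \<open>W\<close> against the \<open>\<rho>\<close>-Fourier transform of \<open>a\<close>, in the weak sense.
  Its value at a smooth vector \<open>\<psi>\<close> is the antilinear functional on smooth vectors sending \<open>\<phi>\<close> to
  the antiduality of \<open>\<phi>\<close> with the operator applied to \<open>\<psi>\<close>; both levels are
  \<^const>\<open>undefined\<close> outside the smooth vectors, so that operators agree iff these values do.
  With \<open>\<rho> = \<sigma>\<close> and a representation for \<open>\<sigma>\<close>, \<open>T\<close> this is the \<open>T\<close>-Weyl calculus (\<open>T\<close> enters through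
  \<open>W\<close> only); with a Weyl system for the symplectic form \<open>\<rho>\<close> it is the standard Weyl calculus.\<close>

definition weyl_op ::
  "('w::euclidean_space \<Rightarrow> 'w \<Rightarrow> real) \<Rightarrow> ('w \<Rightarrow> 'h::complex_hilbert \<Rightarrow> 'h) \<Rightarrow>
   (('w \<Rightarrow> complex) \<Rightarrow> complex) \<Rightarrow> 'h \<Rightarrow> 'h \<Rightarrow> complex" where
  "weyl_op \<rho> W a = (\<lambda>\<psi>\<in>smooth_vectors W. \<lambda>\<phi>\<in>smooth_vectors W.
     form_pairing \<rho> (\<lambda>\<xi>. cnj (cinner \<phi> (W \<xi> \<psi>))) (fourier_dist \<rho> a))"

end

theory Submission
  imports Defs "HOL-Probability.Sinc_Integral" "HOL-Probability.Characteristic_Functions"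
begin

text \<open>The Schwartz space is the largest space of bounded differentiable functions that is stable under
  directional derivatives and multiplication by linear functionals. This characterises membership
  and, applied to operators with bounds by Schwartz seminorms, continuity of the Fourier transform,
  of chirp multipliers and of linear substitutions; it also applies to the matrix coefficients
  \<open>\<langle>\<phi>, W(\<xi>) \<psi>\<rangle>\<close>, since the commutation relations turn \<open>\<partial>\<^sub>v\<close> and multiplication by
  \<open>\<sigma>\<^sub>T\<^sub>+\<^sub>T\<^sub>\<sigma>(v, \<cdot>)\<close> into the generators of \<open>W\<close> acting on \<open>\<phi>\<close> and \<open>\<psi>\<close>.

  Fourier inversion holds up to a positive constant \<open>K\<close>, so the normalised Haar measure of a
  symplectic form is \<open>K\<^sup>-\<^sup>1\<^sup>/\<^sup>2\<close> times Lebesgue measure and the value of \<open>K\<close> is never needed. With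
  \<open>R = T + T\<^sup>\<sigma>\<close>, self-adjointness of \<open>R\<close> gives \<open>\<F>\<^sub>\<tau> f = const \<cdot> (\<F>\<^sub>\<sigma> f) \<circ> R\<close> for
  \<open>\<tau> = \<sigma>(\<cdot>, R \<cdot>)\<close>, and \<open>K\<^sub>\<tau> = K\<^sub>\<sigma> / \<bar>det R\<bar>\<close>. The equalities of the symbols and of the two
  calculi follow by evaluating both sides on Schwartz functions, the phase
  \<open>\<lambda> = e\<^sup>-\<^sup>i\<^sup>\<theta>\<^sup>/\<^sup>2\<close> being the conjugate of the one relating the two Weyl systems.\<close>

text \<open>Iterated derivatives of a chirp, of a Fourier transform or of an orbit of
  \<open>W\<close> have no manageable closed form. They are therefore not estimated directly: a
  family around the function is named and its closure is checked, each check being one product rule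
  or one commutation relation. Decay then costs nothing beyond boundedness, since powers of the norm
  are themselves made of multiplications that stay in the family.

  For matrix coefficients this is where invertibility of R enters. It makes
  \<open>twisted_form\<close> non-degenerate, so every linear functional has the form \<xi>
  \<mapsto> \<tau>(\<xi>, u), and hence every coordinate can be traded for generators; otherwise
  only some directions would be controlled.

  Distributions are embedded through Lebesgue measure whatever the form, so a form enters the
  constants only through the single number \<open>form_density\<close>. Its positivity is settled
  without evaluating any Gaussian integral: Plancherel for the Gaussian shows K as a quotient of two
  positive squared L2 norms.\<close>

section \<open>Directional derivatives\<close>

definition dirder :: "'w \<Rightarrow> ('w::euclidean_space \<Rightarrow> 'b::real_normed_vector) \<Rightarrow> 'w \<Rightarrow> 'b" where
  "dirder v f = (\<lambda>x. frechet_derivative f (at x) v)"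

lemma iter_deriv_Cons: "iter_deriv (v # vs) f = dirder v (iter_deriv vs f)"
  by (simp add: dirder_def)

text \<open>The head of the list is the outermost derivative, so appending acts on the function
  first. This is how stability of \<open>smooth\<close> and \<open>schwartz\<close> under one
  derivative is seen.\<close>

lemma iter_deriv_snoc: "iter_deriv (vs @ [v]) f = iter_deriv vs (dirder v f)"
  by (induction vs) (simp_all add: dirder_def)

lemma dirder_eqI: "(f has_derivative D) (at x) \<Longrightarrow> dirder v f x = D v"
  unfolding dirder_def using frechet_derivative_at by metis

lemma has_derivative_dirder:
  "f differentiable (at x) \<Longrightarrow> (f has_derivative (\<lambda>v. dirder v f x)) (at x)"
  unfolding dirder_def using frechet_derivative_works by blast

text \<open>Reduces directional derivatives to curves in one real variable. The set \<open>A\<close>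
  is left free so that the mean value estimate on \<open>{0..1}\<close> and the derivatives at
  \<open>0\<close> are both covered.\<close>

lemma has_vector_derivative_line:
  assumes "f differentiable (at (x + t *\<^sub>R v))"
  shows "((\<lambda>t. f (x + t *\<^sub>R v)) has_vector_derivative dirder v f (x + t *\<^sub>R v)) (at t within A)"
proof -
  have 1: "((\<lambda>t. x + t *\<^sub>R v) has_derivative (\<lambda>h. h *\<^sub>R v)) (at t within A)"
    by (auto intro!: derivative_eq_intros)
  have 2: "(f has_derivative (\<lambda>u. dirder u f (x + t *\<^sub>R v))) (at (x + t *\<^sub>R v))"
    by (rule has_derivative_dirder[OF assms])
  have "((\<lambda>t. f (x + t *\<^sub>R v)) has_derivative (\<lambda>h. dirder (h *\<^sub>R v) f (x + t *\<^sub>R v))) (at t within A)"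
    using has_derivative_compose[OF 1 2] by simp
  moreover have "dirder (h *\<^sub>R v) f (x + t *\<^sub>R v) = h *\<^sub>R dirder v f (x + t *\<^sub>R v)" for h
    using linear_cmul[OF has_derivative_linear[OF 2]] .
  ultimately show ?thesis by (simp add: has_vector_derivative_def)
qed

text \<open>Brings every linear factor into the shape \<open>x \<bullet> w\<close>, the only one
  that the closure rules below treat.\<close>

lemma linear_functional_inner:
  assumes "linear (l :: 'w::euclidean_space \<Rightarrow> real)"
  obtains w where "\<And>x. l x = x \<bullet> w"
proof
  fix x
  have "l x = l (\<Sum>b\<in>Basis. (x \<bullet> b) *\<^sub>R b)" by (simp add: euclidean_representation)
  also have "\<dots> = (\<Sum>b\<in>Basis. (x \<bullet> b) * l b)"
    using assms by (simp add: linear_sum linear_cmul)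
  finally show "l x = x \<bullet> (\<Sum>b\<in>Basis. l b *\<^sub>R b)"
    by (simp add: inner_sum_right mult.commute)
qed

lemma differentiable_inner_const: "(\<lambda>x::'w::euclidean_space. x \<bullet> w) differentiable F"
  using bounded_linear_imp_has_derivative[OF bounded_linear_inner_left] unfolding differentiable_def by blast

section \<open>Smooth functions\<close>

text \<open>By induction on the list no iterated derivative leaves \<open>V\<close>, and every
  member of \<open>V\<close> is differentiable.\<close>

lemma smooth_coinduct [consumes 1, case_names diff dirder]:
  assumes "f \<in> V" and "\<And>g x. g \<in> V \<Longrightarrow> g differentiable (at x)"
    and "\<And>g v. g \<in> V \<Longrightarrow> dirder v g \<in> V"
  shows "smooth f"
proof -
  have "iter_deriv vs f \<in> V" for vs
    by (induction vs) (auto simp: iter_deriv_Cons assms simp del: iter_deriv.simps(2))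
  then show ?thesis using assms(2) by (auto simp: smooth_def)
qed

lemma smooth_differentiable: "smooth f \<Longrightarrow> f differentiable (at x)"
  unfolding smooth_def by (metis iter_deriv.simps(1))

lemma smooth_iter_deriv_differentiable: "smooth f \<Longrightarrow> iter_deriv vs f differentiable (at x)"
  by (simp add: smooth_def)

lemma smooth_dirder: "smooth f \<Longrightarrow> smooth (dirder v f)"
  unfolding smooth_def by (metis iter_deriv_snoc)

lemma smooth_iter_deriv: "smooth f \<Longrightarrow> smooth (iter_deriv vs f)"
  by (induction vs) (auto simp: iter_deriv_Cons smooth_dirder simp del: iter_deriv.simps(2))

lemma dirder_add:
  assumes "\<And>x. f differentiable (at x)" "\<And>x. g differentiable (at x)"
  shows "dirder v (\<lambda>x. f x + g x) = (\<lambda>x. dirder v f x + dirder v g x)"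
  by (intro ext dirder_eqI has_derivative_add has_derivative_dirder assms)

lemma dirder_bounded_linear:
  assumes "bounded_linear h" "\<And>x. f differentiable (at x)"
  shows "dirder v (\<lambda>x. h (f x)) = (\<lambda>x. h (dirder v f x))"
  by (intro ext dirder_eqI bounded_linear.has_derivative[OF assms(1)] has_derivative_dirder assms)

lemma dirder_scaleR_inner:
  assumes "\<And>x. f differentiable (at x)"
  shows "dirder v (\<lambda>x. (x \<bullet> w) *\<^sub>R f x) = (\<lambda>x. (v \<bullet> w) *\<^sub>R f x + (x \<bullet> w) *\<^sub>R dirder v f x)"
proof
  fix x
  have "((\<lambda>x. (x \<bullet> w) *\<^sub>R f x) has_derivative
      (\<lambda>v. (x \<bullet> w) *\<^sub>R dirder v f x + (v \<bullet> w) *\<^sub>R f x)) (at x)"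
    by (rule has_derivative_scaleR[OF _ has_derivative_dirder[OF assms]])
       (auto intro!: derivative_eq_intros)
  from dirder_eqI[OF this] show "dirder v (\<lambda>x. (x \<bullet> w) *\<^sub>R f x) x = (v \<bullet> w) *\<^sub>R f x + (x \<bullet> w) *\<^sub>R dirder v f x"
    by simp
qed

lemma smooth_add:
  assumes "smooth f" "smooth g"
  shows "smooth (\<lambda>x. f x + g x)"
proof (rule smooth_coinduct)
  show "(\<lambda>x. f x + g x) \<in> {\<lambda>x. f x + g x | f g. smooth f \<and> smooth g}" using assms by blast
  fix h assume "h \<in> {\<lambda>x. f x + g x | f g. smooth f \<and> smooth g}"
  then obtain f g where h: "h = (\<lambda>x. f x + g x)" "smooth f" "smooth g" by blast
  show "h differentiable (at x)" for x
    unfolding h by (intro differentiable_add smooth_differentiable h)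
  show "dirder v h \<in> {\<lambda>x. f x + g x | f g. smooth f \<and> smooth g}" for v
    using h smooth_dirder by (auto simp: dirder_add smooth_differentiable)
qed

lemma smooth_bounded_linear:
  assumes "bounded_linear h" "smooth f"
  shows "smooth (\<lambda>x. h (f x))"
proof (rule smooth_coinduct)
  show "(\<lambda>x. h (f x)) \<in> {\<lambda>x. h (f x) | f. smooth f}" using assms by blast
  fix g assume "g \<in> {\<lambda>x. h (f x) | f. smooth f}"
  then obtain f where f: "g = (\<lambda>x. h (f x))" "smooth f" by blast
  show "g differentiable (at x)" for x
    using f bounded_linear.has_derivative[OF assms(1) has_derivative_dirder[OF smooth_differentiable[OF f(2)]]]
    by (auto simp: differentiable_def)
  show "dirder v g \<in> {\<lambda>x. h (f x) | f. smooth f}" for v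
    using f dirder_bounded_linear[OF assms(1) smooth_differentiable[OF f(2)]] smooth_dirder[OF f(2)]
    by (intro CollectI exI[of _ "dirder v f"] conjI) auto
qed

lemma smooth_scaleR_inner:
  fixes f :: "'w::euclidean_space \<Rightarrow> 'b::real_normed_vector"
  assumes "smooth f"
  shows "smooth (\<lambda>x. (x \<bullet> w) *\<^sub>R f x)"
proof (rule smooth_coinduct)
  \<comment> \<open>The summand \<open>g\<close> makes the family closed: the product rule leaves a
    term without the linear factor.\<close>
  let ?V = "{\<lambda>x. (x \<bullet> w) *\<^sub>R f x + g x | f g :: 'w \<Rightarrow> 'b. smooth f \<and> smooth g}"
  have "smooth (\<lambda>x::'w. 0 :: 'b)"
    using smooth_bounded_linear[OF bounded_linear_zero assms] .
  then show "(\<lambda>x. (x \<bullet> w) *\<^sub>R f x) \<in> ?V" using assms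
    by (intro CollectI exI[of _ f] exI[of _ "\<lambda>x. 0"]) auto
  fix h assume "h \<in> ?V"
  then obtain f g where h: "h = (\<lambda>x. (x \<bullet> w) *\<^sub>R f x + g x)" "smooth f" "smooth g" by blast
  have d: "(\<lambda>x. (x \<bullet> w) *\<^sub>R f x) differentiable (at x)" for x
    by (intro differentiable_scaleR smooth_differentiable h differentiable_inner_const)
  show "h differentiable (at x)" for x
    unfolding h by (intro differentiable_add d smooth_differentiable h)
  have "dirder v h = (\<lambda>x. (x \<bullet> w) *\<^sub>R dirder v f x + ((v \<bullet> w) *\<^sub>R f x + dirder v g x))" for v
    unfolding h using d h by (simp add: dirder_add dirder_scaleR_inner smooth_differentiable add_ac)
  moreover have "smooth (\<lambda>x. (v \<bullet> w) *\<^sub>R f x + dirder v g x)" for v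
    by (rule smooth_add[OF smooth_bounded_linear[OF bounded_linear_scaleR_right h(2)] smooth_dirder[OF h(3)]])
  ultimately show "dirder v h \<in> ?V" for v
    using smooth_dirder[OF h(2)] by (intro CollectI exI conjI)
qed

section \<open>Quadratic phases\<close>

lemma has_derivative_quadratic:
  assumes "bilinear (B :: 'w::euclidean_space \<Rightarrow> 'w \<Rightarrow> real)"
  shows "((\<lambda>x. B x x) has_derivative (\<lambda>v. B x v + B v x)) (at x)"
  using bounded_bilinear.FDERIV[of B, OF _ has_derivative_ident has_derivative_ident] assms
  by (simp add: bilinear_conv_bounded_bilinear)

lemma has_derivative_cis_quadratic:
  assumes "bilinear (B :: 'w::euclidean_space \<Rightarrow> 'w \<Rightarrow> real)"
  shows "((\<lambda>x. cis (B x x)) has_derivative (\<lambda>v. (B x v + B v x) *\<^sub>R (\<i> * cis (B x x)))) (at x)"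
  by (rule has_derivative_cis[OF has_derivative_quadratic[OF assms]])

lemma bilinear_gradient:
  assumes "bilinear (B :: 'w::euclidean_space \<Rightarrow> 'w \<Rightarrow> real)"
  obtains w where "\<And>x. B x v + B v x = x \<bullet> w"
proof -
  have "linear (\<lambda>x. B x v + B v x)"
    using assms unfolding bilinear_def by (intro linear_compose_add) auto
  then show thesis by (rule linear_functional_inner) (rule that)
qed

text \<open>\<open>prod\<close> stands both for multiplication of complex numbers and for
  \<open>scaleC\<close>, so that one computation serves Schwartz functions and the vector-valued
  orbits of \<open>W\<close>. The chirp can be pulled out of the derivative again because
  \<open>prod\<close> is associative over complex factors.\<close>

lemma dirder_cis_quadratic:
  fixes B :: "'w::euclidean_space \<Rightarrow> 'w \<Rightarrow> real" and prod :: "complex \<Rightarrow> 'b::real_normed_vector \<Rightarrow> 'b"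
  assumes "bilinear B" and pr: "bounded_bilinear prod" and "\<And>c d x. prod (c * d) x = prod c (prod d x)"
    and "f differentiable (at x)"
  shows "((\<lambda>x. prod (cis (B x x)) (f x)) has_derivative
     (\<lambda>v. prod (cis (B x x)) (dirder v f x + (B x v + B v x) *\<^sub>R prod \<i> (f x)))) (at x)"
proof -
  interpret bounded_bilinear prod by fact
  have "((\<lambda>x. prod (cis (B x x)) (f x)) has_derivative
     (\<lambda>v. prod (cis (B x x)) (dirder v f x) + prod ((B x v + B v x) *\<^sub>R (\<i> * cis (B x x))) (f x))) (at x)"
    by (intro FDERIV has_derivative_cis_quadratic has_derivative_dirder assms)
  then show ?thesis by (simp add: assms add_right scaleR_left scaleR_right mult.commute[of \<i>])
qed

text \<open>The gradient of a quadratic form is linear, so a derivative of chirp times smooth is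
  again chirp times smooth.\<close>

lemma smooth_cis_quadratic:
  fixes B :: "'w::euclidean_space \<Rightarrow> 'w \<Rightarrow> real" and prod :: "complex \<Rightarrow> 'b::real_normed_vector \<Rightarrow> 'b"
  assumes "bilinear B" and pr: "bounded_bilinear prod" and "\<And>c d x. prod (c * d) x = prod c (prod d x)"
    and "smooth f"
  shows "smooth (\<lambda>x. prod (cis (B x x)) (f x))"
proof (rule smooth_coinduct)
  let ?V = "{\<lambda>x. prod (cis (B x x)) (f x) | f. smooth f}"
  show "(\<lambda>x. prod (cis (B x x)) (f x)) \<in> ?V" using assms by blast
  fix g assume "g \<in> ?V"
  then obtain f where g: "g = (\<lambda>x. prod (cis (B x x)) (f x))" and f: "smooth f" by blast
  note der = dirder_cis_quadratic[OF assms(1-3) smooth_differentiable[OF f]]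
  show "g differentiable (at x)" for x using der unfolding g differentiable_def by blast
  fix v
  obtain w where w: "\<And>x. B x v + B v x = x \<bullet> w" using bilinear_gradient[OF assms(1)] by blast
  have "dirder v g = (\<lambda>x. prod (cis (B x x)) (dirder v f x + (x \<bullet> w) *\<^sub>R prod \<i> (f x)))"
    unfolding g by (rule ext) (simp add: dirder_eqI[OF der] w)
  moreover have "smooth (\<lambda>x. dirder v f x + (x \<bullet> w) *\<^sub>R prod \<i> (f x))"
    by (intro smooth_add smooth_dirder smooth_scaleR_inner f
        smooth_bounded_linear[OF bounded_bilinear.bounded_linear_right[OF pr] f])
  ultimately show "dirder v g \<in> ?V" by (intro CollectI exI conjI)
qed

lemma iter_deriv_add:
  assumes "smooth f" "smooth g"
  shows "iter_deriv vs (\<lambda>x. f x + g x) = (\<lambda>x. iter_deriv vs f x + iter_deriv vs g x)"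
  using assms
  by (induction vs)
     (auto simp: iter_deriv_Cons dirder_add smooth_differentiable smooth_iter_deriv simp del: iter_deriv.simps(2))

lemma iter_deriv_bounded_linear:
  assumes "bounded_linear h" "smooth f"
  shows "iter_deriv vs (\<lambda>x. h (f x)) = (\<lambda>x. h (iter_deriv vs f x))"
  using assms
  by (induction vs)
     (auto simp: iter_deriv_Cons dirder_bounded_linear smooth_differentiable smooth_iter_deriv simp del: iter_deriv.simps(2))

section \<open>Schwartz functions and operators\<close>

lemma schwartz_smooth: "f \<in> schwartz \<Longrightarrow> smooth f"
  by (simp add: schwartz_def)

lemma schwartz_differentiable: "f \<in> schwartz \<Longrightarrow> f differentiable (at x)"
  by (simp add: schwartz_smooth smooth_differentiable)

lemma schwartz_dirder: "f \<in> schwartz \<Longrightarrow> dirder v f \<in> schwartz"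
  unfolding schwartz_def by (auto simp: smooth_dirder simp flip: iter_deriv_snoc)

lemma schwartz_seminorm_upper:
  assumes "f \<in> schwartz"
  shows "norm x ^ k * norm (iter_deriv vs f x) \<le> schwartz_seminorm k vs f"
  unfolding schwartz_seminorm_def
proof (rule cSUP_upper)
  show "bdd_above (range (\<lambda>x. norm x ^ k * norm (iter_deriv vs f x)))"
    using assms unfolding schwartz_def bdd_above_def by blast
qed simp

lemma schwartz_seminorm_least:
  "(\<And>x. norm x ^ k * norm (iter_deriv vs f x) \<le> C) \<Longrightarrow> schwartz_seminorm k vs f \<le> C"
  unfolding schwartz_seminorm_def by (rule cSUP_least) auto

lemma schwartz_seminorm_nonneg: "f \<in> schwartz \<Longrightarrow> 0 \<le> schwartz_seminorm k vs f"
  by (rule order_trans[OF _ schwartz_seminorm_upper[of f 0]]) auto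

lemma schwartz_add:
  assumes "f \<in> schwartz" "g \<in> schwartz"
  shows "(\<lambda>x. f x + g x) \<in> schwartz"
    and "schwartz_seminorm k vs (\<lambda>x. f x + g x) \<le> schwartz_seminorm k vs f + schwartz_seminorm k vs g"
proof -
  have *: "norm x ^ k * norm (iter_deriv vs (\<lambda>x. f x + g x) x) \<le> schwartz_seminorm k vs f + schwartz_seminorm k vs g"
    for x k vs
  proof -
    have "norm x ^ k * norm (iter_deriv vs (\<lambda>x. f x + g x) x)
      \<le> norm x ^ k * norm (iter_deriv vs f x) + norm x ^ k * norm (iter_deriv vs g x)"
      using assms by (simp add: iter_deriv_add schwartz_smooth flip: distrib_left)
        (intro mult_left_mono norm_triangle_ineq; simp)
    then show ?thesis using schwartz_seminorm_upper[OF assms(1)] schwartz_seminorm_upper[OF assms(2)]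
      by (meson add_mono order_trans)
  qed
  then show "(\<lambda>x. f x + g x) \<in> schwartz"
    using assms by (auto simp: schwartz_def intro: smooth_add)
  show "schwartz_seminorm k vs (\<lambda>x. f x + g x) \<le> schwartz_seminorm k vs f + schwartz_seminorm k vs g"
    by (rule schwartz_seminorm_least[OF *])
qed

lemma schwartz_mult_const:
  assumes "f \<in> schwartz"
  shows "(\<lambda>x. c * f x) \<in> schwartz"
    and "schwartz_seminorm k vs (\<lambda>x. c * f x) \<le> norm c * schwartz_seminorm k vs f"
proof -
  have *: "norm x ^ k * norm (iter_deriv vs (\<lambda>x. c * f x) x) \<le> norm c * schwartz_seminorm k vs f"
    for x k vs
    using mult_left_mono[OF schwartz_seminorm_upper[OF assms, of x k vs], of "norm c"]
    by (simp add: iter_deriv_bounded_linear[OF bounded_linear_mult_right schwartz_smooth[OF assms]]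
        norm_mult mult_ac)
  then show "(\<lambda>x. c * f x) \<in> schwartz"
    using assms by (auto simp: schwartz_def intro: smooth_bounded_linear[OF bounded_linear_mult_right])
  show "schwartz_seminorm k vs (\<lambda>x. c * f x) \<le> norm c * schwartz_seminorm k vs f"
    by (rule schwartz_seminorm_least[OF *])
qed

lemma schwartz_minus: "f \<in> schwartz \<Longrightarrow> (\<lambda>x. - f x) \<in> schwartz"
  using schwartz_mult_const(1)[of f "-1"] by simp

lemma schwartz_diff: "f \<in> schwartz \<Longrightarrow> g \<in> schwartz \<Longrightarrow> (\<lambda>x. f x - g x) \<in> schwartz"
  using schwartz_add(1)[OF _ schwartz_minus, of f g] by simp

text \<open>Trades one power of the norm for multiplications by coordinates, through the bound of
  the norm by the sum of the absolute coordinates.\<close>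

lemma norm_Suc_power_le:
  fixes x :: "'w::euclidean_space" and y :: "'b::real_normed_vector"
  shows "norm x ^ Suc k * norm y \<le> (\<Sum>b\<in>Basis. norm x ^ k * norm ((x \<bullet> b) *\<^sub>R y))"
proof -
  have "norm x ^ Suc k * norm y = norm x * (norm x ^ k * norm y)" by simp
  also have "\<dots> \<le> (\<Sum>b\<in>Basis. \<bar>x \<bullet> b\<bar>) * (norm x ^ k * norm y)"
    by (intro mult_right_mono norm_le_l1) simp
  finally show ?thesis by (simp add: sum_distrib_left sum_distrib_right mult_ac)
qed

text \<open>Plain boundedness on \<open>V\<close> is enough: \<open>norm_Suc_power_le\<close>
  absorbs the weight one power at a time into coordinate multiples, which stay in
  \<open>V\<close>.\<close>

lemma schwartz_coinduct [consumes 1, case_names diff bound dirder inner]: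
  assumes "f \<in> V" and diff: "\<And>g x. g \<in> V \<Longrightarrow> g differentiable (at x)"
    and bound: "\<And>g. g \<in> V \<Longrightarrow> \<exists>C. \<forall>x. norm (g x) \<le> C"
    and dirder: "\<And>g v. g \<in> V \<Longrightarrow> dirder v g \<in> V"
    and inner: "\<And>g w. g \<in> V \<Longrightarrow> (\<lambda>x. (x \<bullet> w) *\<^sub>R g x) \<in> V"
  shows "f \<in> schwartz"
proof -
  have 1: "\<exists>C. \<forall>x. norm x ^ k * norm (g x) \<le> C" if "g \<in> V" for g k
    using that
  proof (induction k arbitrary: g)
    case (Suc k)
    have "\<forall>b. \<exists>C. \<forall>x. norm x ^ k * norm ((x \<bullet> b) *\<^sub>R g x) \<le> C"
      using Suc.IH[OF inner[OF Suc.prems]] by blast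
    then obtain C where C: "\<And>b x. norm x ^ k * norm ((x \<bullet> b) *\<^sub>R g x) \<le> C b" by metis
    have "norm x ^ Suc k * norm (g x) \<le> (\<Sum>b\<in>Basis. C b)" for x
      by (rule order_trans[OF norm_Suc_power_le]) (intro sum_mono C)
    then show ?case by blast
  qed (use bound in simp)
  have "iter_deriv vs f \<in> V" for vs
    by (induction vs) (auto simp: iter_deriv_Cons assms simp del: iter_deriv.simps(2))
  then have "\<exists>C. \<forall>x. norm x ^ k * norm (iter_deriv vs f x) \<le> C" for k vs
    using 1 by blast
  moreover have "smooth f"
    using assms(1) by (rule smooth_coinduct) (use diff dirder in auto)
  ultimately show ?thesis unfolding schwartz_def by blast
qed

section \<open>Operators bounded by Schwartz seminorms\<close>

text \<open>Bounds by nonnegative combinations of finitely many seminorms, generated inductively so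
  that no finite family of indices has to be carried along. Each rule contains an inequality, which
  builds in monotonicity.\<close>

inductive dominated :: "(('w::euclidean_space \<Rightarrow> complex) \<Rightarrow> real) \<Rightarrow> bool" where
  seminorm: "(\<And>f. f \<in> schwartz \<Longrightarrow> r f \<le> schwartz_seminorm k vs f) \<Longrightarrow> dominated r"
| add: "dominated p \<Longrightarrow> dominated q \<Longrightarrow> (\<And>f. f \<in> schwartz \<Longrightarrow> r f \<le> p f + q f) \<Longrightarrow> dominated r"
| scale: "dominated p \<Longrightarrow> 0 \<le> c \<Longrightarrow> (\<And>f. f \<in> schwartz \<Longrightarrow> r f \<le> c * p f) \<Longrightarrow> dominated r"

lemma dominated_seminorm: "dominated (schwartz_seminorm k vs)"
  by (rule dominated.seminorm, rule order_refl)

lemma dominated_add: "dominated p \<Longrightarrow> dominated q \<Longrightarrow> dominated (\<lambda>f. p f + q f)"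
  by (rule dominated.add[of p q]) auto

lemma dominated_scale: "dominated p \<Longrightarrow> 0 \<le> c \<Longrightarrow> dominated (\<lambda>f. c * p f)"
  by (rule dominated.scale[of p c]) auto

lemma dominated_mono: "dominated q \<Longrightarrow> (\<And>f. f \<in> schwartz \<Longrightarrow> p f \<le> q f) \<Longrightarrow> dominated p"
  by (rule dominated.scale[of q 1]) auto

lemma dominated_zero: "dominated (\<lambda>f. 0)"
  using dominated_scale[OF dominated_seminorm order_refl] by simp

lemma dominated_sum: "finite I \<Longrightarrow> (\<And>i. i \<in> I \<Longrightarrow> dominated (p i)) \<Longrightarrow> dominated (\<lambda>f. \<Sum>i\<in>I. p i f)"
  by (induction I rule: finite_induct) (auto simp: dominated_zero dominated_add)

definition schwartz_op ::
  "(('w::euclidean_space \<Rightarrow> complex) \<Rightarrow> ('w \<Rightarrow> complex)) \<Rightarrow> bool" where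
  "schwartz_op A \<longleftrightarrow> (\<forall>f\<in>schwartz. A f \<in> schwartz) \<and>
     (\<forall>k vs. dominated (\<lambda>f. schwartz_seminorm k vs (A f)))"

lemma schwartz_opD: "schwartz_op A \<Longrightarrow> f \<in> schwartz \<Longrightarrow> A f \<in> schwartz"
  by (simp add: schwartz_op_def)

lemma schwartz_op_id: "schwartz_op (\<lambda>f. f)"
  unfolding schwartz_op_def using dominated_seminorm by auto

lemma dominated_comp:
  assumes "dominated p" "schwartz_op A"
  shows "dominated (\<lambda>f. p (A f))"
  using assms(1)
proof induction
  case (seminorm r k vs)
  have "dominated (\<lambda>f. schwartz_seminorm k vs (A f))" using assms(2) by (simp add: schwartz_op_def)
  then show ?case by (rule dominated_mono) (use seminorm schwartz_opD[OF assms(2)] in blast)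
next
  case (add p q r)
  show ?case by (rule dominated.add[OF add.IH]) (use add.hyps schwartz_opD[OF assms(2)] in blast)
next
  case (scale p c r)
  show ?case by (rule dominated.scale[OF scale.IH scale.hyps(2)]) (use scale.hyps schwartz_opD[OF assms(2)] in blast)
qed

lemma schwartz_op_comp:
  assumes "schwartz_op A" "schwartz_op B"
  shows "schwartz_op (\<lambda>f. A (B f))"
  using assms dominated_comp[of _ B] unfolding schwartz_op_def by auto

text \<open>The uniform counterpart of \<open>schwartz_coinduct\<close>: the family consists of
  operators and not of functions, because one bound \<open>p\<close> must serve all \<open>f\<close>
  at once.\<close>

lemma schwartz_opI [case_names elem diff bound dirder inner]:
  assumes "L \<in> \<L>" and diff: "\<And>L f x. L \<in> \<L> \<Longrightarrow> f \<in> schwartz \<Longrightarrow> L f differentiable (at x)"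
    and bound: "\<And>L. L \<in> \<L> \<Longrightarrow> \<exists>p. dominated p \<and> (\<forall>f\<in>schwartz. \<forall>x. norm (L f x) \<le> p f)"
    and dirder: "\<And>L v. L \<in> \<L> \<Longrightarrow> \<exists>L'\<in>\<L>. \<forall>f\<in>schwartz. dirder v (L f) = L' f"
    and inner: "\<And>L w. L \<in> \<L> \<Longrightarrow> \<exists>L'\<in>\<L>. \<forall>f\<in>schwartz. (\<lambda>x. (x \<bullet> w) *\<^sub>R L f x) = L' f"
  shows "schwartz_op L"
proof -
  have 1: "\<exists>p. dominated p \<and> (\<forall>f\<in>schwartz. \<forall>x. norm x ^ k * norm (L f x) \<le> p f)"
    if "L \<in> \<L>" for L k
    using that
  proof (induction k arbitrary: L)
    case (Suc k)
    have "\<forall>b. \<exists>p. dominated p \<and> (\<forall>f\<in>schwartz. \<forall>x. norm x ^ k * norm ((x \<bullet> b) *\<^sub>R L f x) \<le> p f)"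
    proof
      fix b
      obtain L' where "L' \<in> \<L>" and L': "\<And>f. f \<in> schwartz \<Longrightarrow> (\<lambda>x. (x \<bullet> b) *\<^sub>R L f x) = L' f"
        using inner[OF Suc.prems, of b] by blast
      then obtain p where p: "dominated p" "\<And>f x. f \<in> schwartz \<Longrightarrow> norm x ^ k * norm (L' f x) \<le> p f"
        using Suc.IH[OF \<open>L' \<in> \<L>\<close>] by blast
      have "norm x ^ k * norm ((x \<bullet> b) *\<^sub>R L f x) \<le> p f" if "f \<in> schwartz" for f x
        using p(2)[OF that, of x] fun_cong[OF L'[OF that], of x] by simp
      with p(1) show "\<exists>p. dominated p \<and> (\<forall>f\<in>schwartz. \<forall>x. norm x ^ k * norm ((x \<bullet> b) *\<^sub>R L f x) \<le> p f)"
        by blast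
    qed
    then obtain p where p: "\<And>b. dominated (p b)"
      "\<And>b f x. f \<in> schwartz \<Longrightarrow> norm x ^ k * norm ((x \<bullet> b) *\<^sub>R L f x) \<le> p b f" by metis
    have "norm x ^ Suc k * norm (L f x) \<le> (\<Sum>b\<in>Basis. p b f)" if "f \<in> schwartz" for f x
      by (rule order_trans[OF norm_Suc_power_le]) (intro sum_mono p(2) that)
    moreover have "dominated (\<lambda>f. \<Sum>b\<in>Basis. p b f)" by (intro dominated_sum p) simp
    ultimately show ?case by blast
  qed (use bound in simp)
  have 2: "\<exists>L'\<in>\<L>. \<forall>f\<in>schwartz. iter_deriv vs (L f) = L' f" for vs
  proof (induction vs)
    case (Cons v vs)
    then obtain L' where "L' \<in> \<L>" "\<forall>f\<in>schwartz. iter_deriv vs (L f) = L' f" by blast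
    moreover obtain L'' where "L'' \<in> \<L>" "\<forall>f\<in>schwartz. dirder v (L' f) = L'' f"
      using dirder[OF \<open>L' \<in> \<L>\<close>] by blast
    ultimately show ?case by (auto simp: iter_deriv_Cons simp del: iter_deriv.simps(2))
  qed (use assms(1) in auto)
  have 3: "\<exists>p. dominated p \<and> (\<forall>f\<in>schwartz. \<forall>x. norm x ^ k * norm (iter_deriv vs (L f) x) \<le> p f)" for k vs
  proof -
    obtain L' where "L' \<in> \<L>" and L': "\<forall>f\<in>schwartz. iter_deriv vs (L f) = L' f" using 2 by blast
    from 1[OF this(1), of k] show ?thesis using L' by auto
  qed
  have "L f \<in> schwartz" if f: "f \<in> schwartz" for f
  proof -
    have "iter_deriv vs (L f) differentiable (at x)" for vs x
    proof -
      obtain L' where "L' \<in> \<L>" and L': "\<forall>f\<in>schwartz. iter_deriv vs (L f) = L' f" using 2 by blast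
      then show ?thesis using diff[of L' f x] f by auto
    qed
    moreover have "\<exists>C. \<forall>x. norm x ^ k * norm (iter_deriv vs (L f) x) \<le> C" for k vs
      using 3[of k vs] f by blast
    ultimately show ?thesis unfolding schwartz_def smooth_def by blast
  qed
  moreover have "dominated (\<lambda>f. schwartz_seminorm k vs (L f))" for k vs
  proof -
    from 3[of k vs] obtain p where "dominated p" and
      p: "\<forall>f\<in>schwartz. \<forall>x. norm x ^ k * norm (iter_deriv vs (L f) x) \<le> p f" by (elim exE conjE)
    have "schwartz_seminorm k vs (L f) \<le> p f" if "f \<in> schwartz" for f
      by (rule schwartz_seminorm_least) (rule bspec[OF p that, THEN spec])
    with \<open>dominated p\<close> show ?thesis by (rule dominated_mono)
  qed
  ultimately show ?thesis by (simp add: schwartz_op_def)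
qed

section \<open>Differential operators with polynomial coefficients\<close>

text \<open>Coefficients stand to the left of the derivatives, so multiplication by a coordinate is
  a rule and only a further derivative on the left needs an argument.\<close>

inductive polydiff :: "(('w::euclidean_space \<Rightarrow> complex) \<Rightarrow> ('w \<Rightarrow> complex)) \<Rightarrow> bool" where
  deriv: "polydiff (iter_deriv vs)"
| inner: "polydiff L \<Longrightarrow> (\<And>f. N f = (\<lambda>x. (x \<bullet> w) *\<^sub>R L f x)) \<Longrightarrow> polydiff N"
| scale: "polydiff L \<Longrightarrow> (\<And>f. N f = (\<lambda>x. c * L f x)) \<Longrightarrow> polydiff N"
| add: "polydiff L \<Longrightarrow> polydiff M \<Longrightarrow> (\<And>f. N f = (\<lambda>x. L f x + M f x)) \<Longrightarrow> polydiff N"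

lemma polydiff_inner: "polydiff L \<Longrightarrow> polydiff (\<lambda>f x. (x \<bullet> w) *\<^sub>R L f x)"
  by (rule polydiff.inner) auto

lemma polydiff_scale: "polydiff L \<Longrightarrow> polydiff (\<lambda>f x. c * L f x)"
  by (rule polydiff.scale) auto

lemma polydiff_add: "polydiff L \<Longrightarrow> polydiff M \<Longrightarrow> polydiff (\<lambda>f x. L f x + M f x)"
  by (rule polydiff.add) auto

lemmas polydiff_intros = polydiff_inner polydiff_scale polydiff_add

lemma polydiff_id: "polydiff (\<lambda>f. f)"
proof -
  have "iter_deriv [] = (\<lambda>f :: 'a \<Rightarrow> complex. f)" by (rule ext) simp
  then show ?thesis using polydiff.deriv[of "[]"] by metis
qed

lemma polydiff_dirder: "polydiff (dirder v)"
proof -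
  have "iter_deriv [v] = (dirder v :: ('a \<Rightarrow> complex) \<Rightarrow> _)" by (rule ext) (simp add: dirder_def)
  then show ?thesis using polydiff.deriv[of "[v]"] by metis
qed

lemma polydiff_differentiable: "polydiff L \<Longrightarrow> f \<in> schwartz \<Longrightarrow> L f differentiable (at x)"
proof (induction rule: polydiff.induct)
  case (deriv vs)
  then show ?case by (simp add: schwartz_smooth smooth_iter_deriv_differentiable)
next
  case (inner L N w)
  then show ?case
    unfolding inner.hyps by (intro differentiable_scaleR differentiable_inner_const) auto
next
  case (scale L N c)
  then show ?case unfolding scale.hyps by (intro differentiable_mult) auto
next
  case (add L M N)
  then show ?case unfolding add.hyps by (intro differentiable_add) auto
qed

lemma polydiff_bound:
  "polydiff L \<Longrightarrow> \<exists>p. dominated p \<and> (\<forall>f\<in>schwartz. \<forall>x. norm x ^ k * norm (L f x) \<le> p f)"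
proof (induction arbitrary: k rule: polydiff.induct)
  case (deriv vs)
  then show ?case using dominated_seminorm schwartz_seminorm_upper by blast
next
  case (inner L N w)
  \<comment> \<open>The linear factor costs one power of the weight, hence the induction with
    \<open>k\<close> arbitrary.\<close>
  obtain p where p: "dominated p" "\<And>f x. f \<in> schwartz \<Longrightarrow> norm x ^ Suc k * norm (L f x) \<le> p f"
    using inner.IH by blast
  have "norm x ^ k * norm ((x \<bullet> w) *\<^sub>R L f x) \<le> norm w * p f" if "f \<in> schwartz" for f x
  proof -
    have "norm x ^ k * norm ((x \<bullet> w) *\<^sub>R L f x) \<le> norm x ^ k * ((norm x * norm w) * norm (L f x))"
      by (simp add: mult_left_mono mult_right_mono Cauchy_Schwarz_ineq2)
    also have "\<dots> \<le> norm w * p f"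
      using mult_left_mono[OF p(2)[OF that, of x], of "norm w"] by (simp add: mult_ac)
    finally show ?thesis .
  qed
  then show ?case unfolding inner.hyps using dominated_scale[OF p(1) norm_ge_zero[of w]] by blast
next
  case (scale L N c)
  obtain p where p: "dominated p" "\<And>f x. f \<in> schwartz \<Longrightarrow> norm x ^ k * norm (L f x) \<le> p f"
    using scale.IH by blast
  have "norm x ^ k * norm (c * L f x) \<le> norm c * p f" if "f \<in> schwartz" for f x
    using mult_left_mono[OF p(2)[OF that, of x], of "norm c"] by (simp add: mult_ac norm_mult)
  then show ?case unfolding scale.hyps using dominated_scale[OF p(1) norm_ge_zero[of c]] by blast
next
  case (add L M N)
  obtain p where p: "dominated p" "\<And>f x. f \<in> schwartz \<Longrightarrow> norm x ^ k * norm (L f x) \<le> p f"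
    using add.IH by blast
  obtain q where q: "dominated q" "\<And>f x. f \<in> schwartz \<Longrightarrow> norm x ^ k * norm (M f x) \<le> q f"
    using add.IH by blast
  have "norm x ^ k * norm (L f x + M f x) \<le> p f + q f" if "f \<in> schwartz" for f x
    using p(2)[OF that, of x] q(2)[OF that, of x]
      mult_left_mono[OF norm_triangle_ineq[of "L f x" "M f x"], of "norm x ^ k"] by (simp add: distrib_left)
  then show ?case unfolding add.hyps using dominated_add[OF p(1) q(1)] by blast
qed

text \<open>The product rule pushes the new derivative past the coefficients. The two operators are
  compared on Schwartz functions only, where everything involved is differentiable.\<close>

lemma polydiff_dirder_closed:
  "polydiff L \<Longrightarrow> \<exists>L'. polydiff L' \<and> (\<forall>f\<in>schwartz. dirder v (L f) = L' f)"
proof (induction rule: polydiff.induct)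
  case (deriv vs)
  then show ?case using polydiff.deriv[of "v # vs"] by (metis iter_deriv_Cons)
next
  case (inner L N w)
  obtain L' where L': "polydiff L'" "\<And>f. f \<in> schwartz \<Longrightarrow> dirder v (L f) = L' f"
    using inner.IH by blast
  have "polydiff (\<lambda>f x. of_real (v \<bullet> w) * L f x + (x \<bullet> w) *\<^sub>R L' f x)"
    by (intro polydiff_intros L' inner)
  moreover have "dirder v (\<lambda>x. (x \<bullet> w) *\<^sub>R L f x) = (\<lambda>x. of_real (v \<bullet> w) * L f x + (x \<bullet> w) *\<^sub>R L' f x)"
    if "f \<in> schwartz" for f
    using dirder_scaleR_inner[OF polydiff_differentiable[OF inner.hyps(1) that], of v w] L'(2)[OF that]
    by (simp add: scaleR_conv_of_real)
  ultimately show ?case unfolding inner.hyps by blast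
next
  case (scale L N c)
  obtain L' where L': "polydiff L'" "\<And>f. f \<in> schwartz \<Longrightarrow> dirder v (L f) = L' f"
    using scale.IH by blast
  have "dirder v (\<lambda>x. c * L f x) = (\<lambda>x. c * L' f x)" if "f \<in> schwartz" for f
    using that L' scale
    by (simp add: dirder_bounded_linear[OF bounded_linear_mult_right] polydiff_differentiable)
  then show ?case unfolding scale.hyps using polydiff_scale[OF L'(1)] by blast
next
  case (add L M N)
  obtain L' where L': "polydiff L'" "\<And>f. f \<in> schwartz \<Longrightarrow> dirder v (L f) = L' f"
    using add.IH by blast
  obtain M' where M': "polydiff M'" "\<And>f. f \<in> schwartz \<Longrightarrow> dirder v (M f) = M' f"
    using add.IH by blast
  have "dirder v (\<lambda>x. L f x + M f x) = (\<lambda>x. L' f x + M' f x)" if "f \<in> schwartz" for f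
    using that L' M' add by (simp add: dirder_add polydiff_differentiable)
  then show ?case unfolding add.hyps using polydiff_add[OF L'(1) M'(1)] by blast
qed

lemma schwartz_op_polydiff:
  assumes "polydiff L"
  shows "schwartz_op L"
proof (rule schwartz_opI)
  show "L \<in> {L. polydiff L}" using assms by simp
  fix L :: "('a \<Rightarrow> complex) \<Rightarrow> 'a \<Rightarrow> complex" assume L: "L \<in> {L. polydiff L}"
  show "\<exists>p. dominated p \<and> (\<forall>f\<in>schwartz. \<forall>x. norm (L f x) \<le> p f)"
    using polydiff_bound[of L 0] L by simp
  show "\<exists>L'\<in>{L. polydiff L}. \<forall>f\<in>schwartz. dirder v (L f) = L' f" for v
    using polydiff_dirder_closed L by blast
  show "\<exists>L'\<in>{L. polydiff L}. \<forall>f\<in>schwartz. (\<lambda>x. (x \<bullet> w) *\<^sub>R L f x) = L' f" for w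
    using polydiff_inner[of L w] L by (intro bexI[of _ "\<lambda>f x. (x \<bullet> w) *\<^sub>R L f x"]) auto
qed (use polydiff_differentiable in blast)

lemma schwartz_scaleR_inner: "f \<in> schwartz \<Longrightarrow> (\<lambda>x. (x \<bullet> w) *\<^sub>R f x) \<in> schwartz"
  using schwartz_opD[OF schwartz_op_polydiff[OF polydiff_inner[OF polydiff_id]]] .

text \<open>The closed family is formed by the \<open>L \<circ> A\<close>: whatever is done to the
  output of \<open>L\<close> is moved to its input. Chirps, linear substitutions and the Fourier
  transform all fit this pattern.\<close>

lemma schwartz_op_intertwine:
  assumes diff: "\<And>f x. f \<in> schwartz \<Longrightarrow> L f differentiable (at x)"
    and bound: "dominated p" "\<And>f x. f \<in> schwartz \<Longrightarrow> norm (L f x) \<le> p f"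
    and dirder: "\<And>v. \<exists>A. polydiff A \<and> (\<forall>f\<in>schwartz. dirder v (L f) = L (A f))"
    and inner: "\<And>w. \<exists>A. schwartz_op A \<and> (\<forall>f\<in>schwartz. (\<lambda>x. (x \<bullet> w) *\<^sub>R L f x) = L (A f))"
  shows "schwartz_op L"
proof (rule schwartz_opI)
  let ?L = "{\<lambda>f. L (A f) | A. schwartz_op A}"
  have mem: "(\<lambda>f. L (A f)) \<in> ?L" if "schwartz_op A" for A
    using that by (intro CollectI exI[of _ A] conjI refl)
  show "L \<in> ?L" using mem[OF schwartz_op_id] .
  fix M assume "M \<in> ?L"
  then obtain A where A: "schwartz_op A" "M = (\<lambda>f. L (A f))" by blast
  show "M f differentiable (at x)" if "f \<in> schwartz" for f x
    unfolding A using diff schwartz_opD[OF A(1) that] by blast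
  show "\<exists>p. dominated p \<and> (\<forall>f\<in>schwartz. \<forall>x. norm (M f x) \<le> p f)"
    by (intro exI[of _ "\<lambda>f. p (A f)"]) (auto simp: A(2) bound(2) schwartz_opD[OF A(1)] dominated_comp[OF bound(1) A(1)])
  show "\<exists>L'\<in>?L. \<forall>f\<in>schwartz. dirder v (M f) = L' f" for v
  proof -
    obtain B where B: "polydiff B" "\<And>f. f \<in> schwartz \<Longrightarrow> dirder v (L f) = L (B f)" using dirder by blast
    have "schwartz_op (\<lambda>f. B (A f))" by (rule schwartz_op_comp[OF schwartz_op_polydiff[OF B(1)] A(1)])
    from mem[OF this] show ?thesis
      by (rule rev_bexI) (simp add: A(2) B(2) schwartz_opD[OF A(1)])
  qed
  show "\<exists>L'\<in>?L. \<forall>f\<in>schwartz. (\<lambda>x. (x \<bullet> w) *\<^sub>R M f x) = L' f" for w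
  proof -
    from inner[of w] obtain B where B: "schwartz_op B"
      and LB: "\<forall>f\<in>schwartz. (\<lambda>x. (x \<bullet> w) *\<^sub>R L f x) = L (B f)" by (elim exE conjE)
    have "schwartz_op (\<lambda>f. B (A f))" by (rule schwartz_op_comp[OF B A(1)])
    from mem[OF this] show ?thesis
      by (rule rev_bexI) (simp only: A(2), intro ballI bspec[OF LB] schwartz_opD[OF A(1)])
  qed
qed

lemma schwartz_norm_le: "f \<in> schwartz \<Longrightarrow> norm (f x) \<le> schwartz_seminorm 0 [] f"
  using schwartz_seminorm_upper[of f x 0 "[]"] by simp

lemma schwartz_op_cis_quadratic:
  fixes B :: "'w::euclidean_space \<Rightarrow> 'w \<Rightarrow> real"
  assumes "bilinear B"
  shows "schwartz_op (\<lambda>f x. cis (B x x) * f x)"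
proof -
  note der = dirder_cis_quadratic[OF assms bounded_bilinear_mult mult.assoc schwartz_differentiable]
  show ?thesis
  proof (rule schwartz_op_intertwine[where p = "schwartz_seminorm 0 []" and L = "\<lambda>f x. cis (B x x) * f x"])
    show "(\<lambda>x. cis (B x x) * f x) differentiable (at x)" if "f \<in> schwartz" for f x
      using der[OF that] unfolding differentiable_def by blast
    show "norm (cis (B x x) * f x) \<le> schwartz_seminorm 0 [] f" if "f \<in> schwartz" for f x
      using schwartz_norm_le[OF that] by (simp add: norm_mult)
    show "\<exists>A. polydiff A \<and> (\<forall>f\<in>schwartz. dirder v (\<lambda>x. cis (B x x) * f x) = (\<lambda>x. cis (B x x) * A f x))" for v
    proof -
      obtain w where w: "\<And>x. B x v + B v x = x \<bullet> w" using bilinear_gradient[OF assms(1)] by blast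
      have "polydiff (\<lambda>f x. dirder v f x + (x \<bullet> w) *\<^sub>R (\<i> * f x))"
        by (intro polydiff_intros polydiff_dirder polydiff_id)
      moreover have "dirder v (\<lambda>x. cis (B x x) * f x) =
          (\<lambda>x. cis (B x x) * (dirder v f x + (x \<bullet> w) *\<^sub>R (\<i> * f x)))" if "f \<in> schwartz" for f
        by (rule ext) (simp add: dirder_eqI[OF der[OF that]] w)
      ultimately show ?thesis
        by (intro exI[of _ "\<lambda>f x. dirder v f x + (x \<bullet> w) *\<^sub>R (\<i> * f x)"] conjI ballI)
    qed
    show "\<exists>A. schwartz_op A \<and> (\<forall>f\<in>schwartz. (\<lambda>x. (x \<bullet> w) *\<^sub>R (cis (B x x) * f x)) = (\<lambda>x. cis (B x x) * A f x))" for w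
      using schwartz_op_polydiff[OF polydiff_inner[OF polydiff_id, of w]]
      by (intro exI[of _ "\<lambda>f x. (x \<bullet> w) *\<^sub>R f x"] conjI ballI) auto
  qed (rule dominated_seminorm)
qed

lemma schwartz_op_compose_linear:
  fixes S :: "'w::euclidean_space \<Rightarrow> 'w"
  assumes "linear S" "bij S"
  shows "schwartz_op (\<lambda>f. f \<circ> S)"
proof -
  have bl: "bounded_linear S" by (rule linear_conv_bounded_linear[THEN iffD1, OF assms(1)])
  have der: "((f \<circ> S) has_derivative (\<lambda>v. dirder (S v) f (S x))) (at x)" if "f \<in> schwartz"
    for f :: "'w \<Rightarrow> complex" and x
    unfolding comp_def
    by (rule has_derivative_compose[OF bounded_linear_imp_has_derivative[OF bl]])
       (rule has_derivative_dirder[OF schwartz_differentiable[OF that]])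
  show ?thesis
  proof (rule schwartz_op_intertwine[where p = "schwartz_seminorm 0 []" and L = "\<lambda>f. f \<circ> S"])
    show "f \<circ> S differentiable (at x)" if "f \<in> schwartz" for f :: "'w \<Rightarrow> complex" and x
      using der[OF that] unfolding differentiable_def by blast
    show "norm ((f \<circ> S) x) \<le> schwartz_seminorm 0 [] f" if "f \<in> schwartz" for f x using schwartz_norm_le[OF that] by simp
    show "\<exists>A. polydiff A \<and> (\<forall>f\<in>schwartz. dirder v (f \<circ> S) = A f \<circ> S)" for v
    proof (intro exI conjI ballI)
      show "polydiff (dirder (S v))" by (rule polydiff_dirder)
      show "dirder v (f \<circ> S) = dirder (S v) f \<circ> S" if "f \<in> schwartz" for f :: "'w \<Rightarrow> complex"
        by (rule ext) (simp add: dirder_eqI[OF der[OF that]])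
    qed
    show "\<exists>A. schwartz_op A \<and> (\<forall>f\<in>schwartz. (\<lambda>x. (x \<bullet> w) *\<^sub>R (f \<circ> S) x) = A f \<circ> S)" for w
    proof -
      \<comment> \<open>The factor \<open>x \<bullet> w\<close> has to be read as a linear
        functional of \<open>S x\<close> before it can be moved to the input.\<close>
      have "linear (\<lambda>x. inv S x \<bullet> w)"
        using inj_linear_imp_inv_linear[OF assms(1) bij_is_inj[OF assms(2)]]
        by (intro linearI) (simp_all add: linear_add linear_cmul inner_add_left)
      then obtain u where u: "\<And>x. inv S x \<bullet> w = x \<bullet> u" using linear_functional_inner[of "\<lambda>x. inv S x \<bullet> w"] by blast
      have "x \<bullet> w = S x \<bullet> u" for x using u[of "S x"] assms by (simp add: bij_is_inj)
      then show ?thesis using schwartz_op_polydiff[OF polydiff_inner[OF polydiff_id, of u]]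
        by (intro exI[of _ "\<lambda>f x. (x \<bullet> u) *\<^sub>R f x"] conjI ballI) (auto simp: comp_def)
    qed
  qed (rule dominated_seminorm)
qed

section \<open>Haar measures\<close>

lemma haar_measure_sigma_finite:
  assumes "haar_measure M"
  shows "sigma_finite_measure M"
proof
  have sets: "sets M = sets borel" using assms by (simp add: haar_measure_def)
  show "\<exists>A. countable A \<and> A \<subseteq> sets M \<and> \<Union>A = space M \<and> (\<forall>a\<in>A. emeasure M a \<noteq> \<infinity>)"
  proof (intro exI conjI ballI)
    show "\<Union>(range (\<lambda>n. cball 0 (real n))) = space M"
      using sets_eq_imp_space_eq[OF sets] by (auto simp: real_arch_simple)
    show "emeasure M a \<noteq> \<infinity>" if "a \<in> range (\<lambda>n. cball 0 (real n))" for a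
      using that assms unfolding haar_measure_def by (auto simp: less_top)
  qed (auto simp: sets)
qed

text \<open>Integrating \<open>1\<^sub>A(x) 1\<^sub>B(y - x)\<close> in either order, with the substitution \<open>x \<mapsto> y + x\<close> in between,
  gives \<open>M(A) \<lambda>(B) = M(-B) \<lambda>(A)\<close>.\<close>

lemma haar_measure_eq_density:
  fixes M :: "'w::euclidean_space measure"
  assumes "haar_measure M"
  shows "M = density lborel (\<lambda>_. emeasure M (cbox 0 One))"
proof (rule measure_eqI)
  have sets[measurable_cong]: "sets M = sets borel" using assms by (simp add: haar_measure_def)
  then show "sets M = sets (density lborel (\<lambda>_. emeasure M (cbox 0 One)))" by simp
  fix A assume "A \<in> sets M"
  then have [measurable]: "A \<in> sets borel" by (simp add: sets)
  interpret M: sigma_finite_measure M by (rule haar_measure_sigma_finite[OF assms])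
  interpret P: pair_sigma_finite M lborel ..
  \<comment> \<open>The reflected unit cube: its Lebesgue measure is 1, and its reflection is the
    cube that normalises \<open>M\<close>.\<close>
  define B :: "'w set" where "B = cbox (- One) 0"
  have [measurable]: "B \<in> sets borel" by (simp add: B_def)
  have transM: "(\<integral>\<^sup>+x. h (v + x) \<partial>M) = (\<integral>\<^sup>+x. h x \<partial>M)" if [measurable]: "h \<in> borel_measurable borel" for h v
  proof -
    have "distr M borel (\<lambda>x. v + x) = M" using assms by (simp add: haar_measure_def)
    then have "(\<integral>\<^sup>+x. h x \<partial>M) = (\<integral>\<^sup>+x. h x \<partial>distr M borel (\<lambda>x. v + x))" by simp
    also have "\<dots> = (\<integral>\<^sup>+x. h (v + x) \<partial>M)" by (rule nn_integral_distr) measurable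
    finally show ?thesis by simp
  qed
  have transL: "(\<integral>\<^sup>+x. h (v + x) \<partial>lborel) = (\<integral>\<^sup>+x. h x \<partial>lborel)"
    if [measurable]: "h \<in> borel_measurable borel" for h and v :: 'w
  proof -
    have "(\<integral>\<^sup>+x. h x \<partial>lborel) = (\<integral>\<^sup>+x. h x \<partial>distr lborel borel ((+) v))" by (simp add: lborel_distr_plus)
    also have "\<dots> = (\<integral>\<^sup>+x. h (v + x) \<partial>lborel)" by (rule nn_integral_distr) measurable
    finally show ?thesis by simp
  qed
  have B1: "emeasure lborel B = 1"
    unfolding B_def by (subst emeasure_lborel_cbox) auto
  have minusB: "x \<in> cbox 0 One \<longleftrightarrow> - x \<in> B" for x
    by (auto simp: B_def mem_box)
  have "emeasure M A = (\<integral>\<^sup>+x. indicator A x * (\<integral>\<^sup>+y. indicator B (-x + y) \<partial>lborel) \<partial>M)"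
    using transL[of "indicator B"] by (subst transL) (simp_all add: B1 sets)
  also have "\<dots> = (\<integral>\<^sup>+x. \<integral>\<^sup>+y. indicator A x * indicator B (y - x) \<partial>lborel \<partial>M)"
    by (simp add: nn_integral_cmult)
  also have "\<dots> = (\<integral>\<^sup>+y. \<integral>\<^sup>+x. indicator A x * indicator B (y - x) \<partial>M \<partial>lborel)"
    by (rule P.Fubini'[symmetric]) measurable
  also have "\<dots> = (\<integral>\<^sup>+y. \<integral>\<^sup>+x. indicator A (y + x) * indicator B (- x) \<partial>M \<partial>lborel)"
  proof (rule nn_integral_cong)
    fix y show "(\<integral>\<^sup>+x. indicator A x * indicator B (y - x) \<partial>M) = (\<integral>\<^sup>+x. indicator A (y + x) * indicator B (- x) \<partial>M)"
      using transM[of "\<lambda>x. indicator A x * indicator B (y - x)" y] by simp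
  qed
  also have "\<dots> = (\<integral>\<^sup>+x. \<integral>\<^sup>+y. indicator B (- x) * indicator A (x + y) \<partial>lborel \<partial>M)"
    by (subst P.Fubini') (simp_all add: mult.commute add.commute)
  also have "\<dots> = (\<integral>\<^sup>+x. indicator (cbox 0 One) x * emeasure lborel A \<partial>M)"
    using transL[of "indicator A"] by (simp add: nn_integral_cmult indicator_def[of "cbox 0 One"] indicator_def[of B] minusB)
  also have "\<dots> = emeasure M (cbox 0 One) * emeasure lborel A"
    by (subst nn_integral_multc) (simp_all add: sets)
  finally show "emeasure M A = emeasure (density lborel (\<lambda>_. emeasure M (cbox 0 One))) A"
    by (simp add: emeasure_density_const)
qed

lemma haar_measure_cube:
  assumes "haar_measure (M :: 'w::euclidean_space measure)"
  shows "emeasure M (cbox 0 One) = ennreal (measure M (cbox 0 One))" "0 < measure M (cbox 0 One)"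
proof -
  have "emeasure M (cbox 0 One) < \<infinity>" using assms by (simp add: haar_measure_def)
  then show 1: "emeasure M (cbox 0 One) = ennreal (measure M (cbox 0 One))"
    by (intro emeasure_eq_ennreal_measure) auto
  have sets: "sets M = sets borel" using assms by (simp add: haar_measure_def)
  have "box (0::'w) One \<noteq> {}" by (auto simp: box_ne_empty)
  then have "0 < emeasure M (box 0 One)" using assms open_box unfolding haar_measure_def by blast
  also have "\<dots> \<le> emeasure M (cbox 0 One)" by (intro emeasure_mono box_subset_cbox) (simp add: sets)
  finally show "0 < measure M (cbox 0 One)" using 1 by simp
qed

lemma haar_measure_density:
  assumes "0 < c"
  shows "haar_measure (density lborel (\<lambda>_. ennreal c) :: 'w::euclidean_space measure)"
  unfolding haar_measure_def
proof (intro conjI allI impI)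
  let ?M = "density lborel (\<lambda>_. ennreal c) :: 'w measure"
  show "distr ?M borel (\<lambda>x. v + x) = ?M" for v
  proof (rule measure_eqI)
    fix A assume "A \<in> sets (distr ?M borel ((+) v))"
    then have [measurable]: "A \<in> sets borel" by simp
    have "emeasure lborel A = emeasure (distr lborel borel ((+) v)) A" by (simp add: lborel_distr_plus)
    also have "\<dots> = emeasure lborel ((\<lambda>x. v + x) -` A)" by (subst emeasure_distr) auto
    finally have "emeasure lborel ((+) v -` A) = emeasure lborel A" ..
    moreover have "(+) v -` A \<in> sets lborel" using measurable_sets_borel[of "(+) v" borel A] by simp
    ultimately show "emeasure (distr ?M borel ((+) v)) A = emeasure ?M A"
      by (subst emeasure_distr) (simp_all add: emeasure_density_const)
  qed simp
  show "emeasure ?M K < \<infinity>" if "compact K" for K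
    using that emeasure_compact_finite[OF that]
    by (simp add: emeasure_density_const compact_imp_closed ennreal_mult_less_top)
  show "0 < emeasure ?M U" if "open U" "U \<noteq> {}" for U
  proof -
    have "\<not> U \<in> null_sets lborel"
      using that open_not_negligible[of U] by (auto simp: negligible_iff_null_sets null_sets_completionI)
    then have "0 < emeasure lborel U" using that by (simp add: null_sets_def zero_less_iff_neq_zero)
    then show ?thesis using that assms by (simp add: emeasure_density_const ennreal_zero_less_mult_iff)
  qed
qed simp

section \<open>Linear change of variables\<close>

text \<open>With uniqueness of Haar measure this gives the change of variables formula without
  determinants. Invariance holds because translating by \<open>v\<close> after \<open>S\<close> is
  translating by \<open>inv S v\<close> before it.\<close>

lemma haar_measure_distr_linear:
  fixes S :: "'w::euclidean_space \<Rightarrow> 'w"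
  assumes S: "linear S" "bij S"
  shows "haar_measure (distr lborel borel S)"
  unfolding haar_measure_def
proof (intro conjI allI impI)
  have S': "linear (inv S)" using inj_linear_imp_inv_linear[OF S(1) bij_is_inj[OF S(2)]] .
  have cont: "continuous_on UNIV S" "continuous_on UNIV (inv S)"
    using linear_continuous_on linear_conv_bounded_linear S(1) S' by blast+
  have [measurable]: "S \<in> borel_measurable borel" using borel_measurable_continuous_onI[OF cont(1)] .
  have haar: "haar_measure (lborel :: 'w measure)" using haar_measure_density[of 1] by (simp add: density_1)
  show "distr (distr lborel borel S) borel ((+) v) = distr lborel borel S" for v
  proof -
    have "(+) v \<circ> S = S \<circ> (+) (inv S v)"
      using S by (auto simp: fun_eq_iff linear_add bij_is_surj surj_f_inv_f)
    then have "distr (distr lborel borel S) borel ((+) v) = distr (distr lborel borel ((+) (inv S v))) borel S"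
      by (simp add: distr_distr)
    then show ?thesis by (simp add: lborel_distr_plus)
  qed
  show "emeasure (distr lborel borel S) K < \<infinity>" if "compact K" for K
  proof -
    have "S -` K = inv S ` K" using S(2) by (simp add: bij_vimage_eq_inv_image)
    then have "compact (S -` K)"
      using compact_continuous_image[OF continuous_on_subset[OF cont(2)] that] by simp
    then show ?thesis using that emeasure_compact_finite by (simp add: emeasure_distr compact_imp_closed)
  qed
  show "0 < emeasure (distr lborel borel S) U" if "open U" "U \<noteq> {}" for U
  proof -
    have "open (S -` U)" using that cont(1) by (simp add: continuous_on_open_vimage)
    moreover have "S -` U \<noteq> {}" using that S(2) by (metis bij_is_surj surj_vimage_empty)
    ultimately have "0 < emeasure lborel (S -` U)" using haar by (simp add: haar_measure_def)
    then show ?thesis using that by (simp add: emeasure_distr)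
  qed
qed simp

text \<open>This is the inverse absolute determinant, in the very form of the factor in
  \<open>pullback_dist\<close>.\<close>

definition inv_det :: "('w::euclidean_space \<Rightarrow> 'w) \<Rightarrow> real" where
  "inv_det S = measure lborel (S -` cbox 0 One)"

lemma
  fixes S :: "'w::euclidean_space \<Rightarrow> 'w" and g :: "'w \<Rightarrow> 'b::{banach, second_countable_topology}"
  assumes S: "linear S" "bij S"
  shows inv_det_pos: "0 < inv_det S"
    and lborel_integral_linear: "g \<in> borel_measurable borel \<Longrightarrow> (LINT x|lborel. g (S x)) = inv_det S *\<^sub>R (LINT x|lborel. g x)"
proof -
  note haar = haar_measure_distr_linear[OF S]
  have [measurable]: "S \<in> borel_measurable borel"
    using linear_continuous_on linear_conv_bounded_linear S(1) borel_measurable_continuous_onI by blast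
  have m: "measure (distr lborel borel S) (cbox 0 One) = inv_det S"
    unfolding inv_det_def by (subst measure_distr) auto
  then show "0 < inv_det S" using haar_measure_cube(2)[OF haar] by simp
  have eq: "distr lborel borel S = density lborel (\<lambda>_. ennreal (inv_det S))"
    using haar_measure_eq_density[OF haar] haar_measure_cube(1)[OF haar] m by simp
  assume [measurable]: "g \<in> borel_measurable borel"
  have "(LINT x|lborel. g (S x)) = (LINT x|distr lborel borel S. g x)"
    by (subst integral_distr) auto
  also have "\<dots> = inv_det S *\<^sub>R (LINT x|lborel. g x)"
    unfolding eq using \<open>0 < inv_det S\<close> by (subst integral_density) auto
  finally show "(LINT x|lborel. g (S x)) = inv_det S *\<^sub>R (LINT x|lborel. g x)" .
qed

lemma lborel_integral_translation:
  fixes g :: "'w::euclidean_space \<Rightarrow> 'b::{banach, second_countable_topology}"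
  assumes [measurable]: "g \<in> borel_measurable borel"
  shows "(LINT x|lborel. g (x + v)) = (LINT x|lborel. g x)"
proof -
  have "(LINT x|lborel. g x) = (LINT x|distr lborel borel ((+) v). g x)" by (simp add: lborel_distr_plus)
  also have "\<dots> = (LINT x|lborel. g (v + x))" by (subst integral_distr) auto
  finally show ?thesis by (simp add: add.commute)
qed

section \<open>Integrals of Schwartz functions\<close>

text \<open>Two powers per dimension: each factor \<open>1 + (x \<bullet> b)\<^sup>2\<close> is at
  most \<open>(1 + norm x)\<^sup>2\<close>, so the weight lies below a product of one-dimensional
  integrable functions.\<close>

lemma integrable_weight:
  "integrable lborel (\<lambda>x::'w::euclidean_space. 1 / (1 + norm x) ^ (2 * DIM('w)))"
proof (rule integrableI_bounded)
  let ?g = "\<lambda>x::real. inverse (1 + x\<^sup>2)"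
  have "integrable lborel ?g"
    using integrable_inverse_1_plus_square by (simp add: set_integrable_def einterval_def)
  then have fin: "(\<integral>\<^sup>+x. ennreal (?g x) \<partial>lborel) < \<infinity>"
    by (simp add: integrable_iff_bounded)
  have "(\<integral>\<^sup>+(x::'w). ennreal (norm (1 / (1 + norm x) ^ (2 * DIM('w)))) \<partial>lborel)
      \<le> (\<integral>\<^sup>+(x::'w). (\<Prod>b\<in>Basis. ennreal (?g (x \<bullet> b))) \<partial>lborel)"
  proof (rule nn_integral_mono)
    fix x :: 'w
    have "(\<Prod>b\<in>(Basis::'w set). 1 + (x \<bullet> b)\<^sup>2) \<le> (\<Prod>b\<in>(Basis::'w set). (1 + norm x)\<^sup>2)"
    proof (rule prod_mono)
      fix b :: 'w assume "b \<in> Basis"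
      then have "\<bar>x \<bullet> b\<bar> \<le> norm x" by (rule Basis_le_norm)
      then have "(x \<bullet> b)\<^sup>2 \<le> (norm x)\<^sup>2" by (metis abs_ge_zero power2_abs power_mono)
      then show "0 \<le> 1 + (x \<bullet> b)\<^sup>2 \<and> 1 + (x \<bullet> b)\<^sup>2 \<le> (1 + norm x)\<^sup>2"
        using norm_ge_zero[of x] unfolding power2_sum by (simp del: norm_ge_zero)
    qed
    also have "\<dots> = (1 + norm x) ^ (2 * DIM('w))" by (simp add: power_mult)
    finally have le: "(\<Prod>b\<in>(Basis::'w set). 1 + (x \<bullet> b)\<^sup>2) \<le> (1 + norm x) ^ (2 * DIM('w))" .
    have "(\<Prod>b\<in>(Basis::'w set). ?g (x \<bullet> b)) = inverse (\<Prod>b\<in>(Basis::'w set). 1 + (x \<bullet> b)\<^sup>2)"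
      using prod_inversef[of "\<lambda>b. 1 + (x \<bullet> b)\<^sup>2" "Basis :: 'w set"] by (simp add: comp_def)
    then have "1 / (1 + norm x) ^ (2 * DIM('w)) \<le> (\<Prod>b\<in>(Basis::'w set). ?g (x \<bullet> b))"
      using le_imp_inverse_le[OF le] by (simp add: inverse_eq_divide prod_pos add_pos_nonneg)
    then show "ennreal (norm (1 / (1 + norm x) ^ (2 * DIM('w)))) \<le> (\<Prod>b\<in>(Basis::'w set). ennreal (?g (x \<bullet> b)))"
      by (subst prod_ennreal) (auto intro!: ennreal_leI)
  qed
  also have "\<dots> = (\<Prod>b\<in>(Basis::'w set). (\<integral>\<^sup>+x. ennreal (?g x) \<partial>lborel))"
    by (rule nn_integral_lborel_prod) auto
  also have "\<dots> < \<infinity>" using fin by (simp add: less_top[symmetric] ennreal_top_eq_mult_iff power_eq_top_ennreal)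
  finally show "(\<integral>\<^sup>+(x::'w). ennreal (norm (1 / (1 + norm x) ^ (2 * DIM('w)))) \<partial>lborel) < \<infinity>" .
qed measurable

text \<open>The coefficients are those of the binomial expansion of \<open>(1 + norm x) ^ N\<close>,
  a weight that vanishes nowhere and can be divided by.\<close>

definition decay_bound :: "nat \<Rightarrow> ('w::euclidean_space \<Rightarrow> complex) \<Rightarrow> real" where
  "decay_bound N f = (\<Sum>k\<le>N. real (N choose k) * schwartz_seminorm k [] f)"

lemma dominated_decay_bound: "dominated (decay_bound N)"
  unfolding decay_bound_def[abs_def]
  by (intro dominated_sum dominated_scale dominated_seminorm) auto

lemma decay_bound:
  assumes "f \<in> schwartz"
  shows "(1 + norm x) ^ N * norm (f x) \<le> decay_bound N f"
proof -
  have "(1 + norm x) ^ N * norm (f x) = (\<Sum>k\<le>N. real (N choose k) * (norm x ^ k * norm (f x)))"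
    using binomial_ring[of "norm x" 1 N] by (simp add: add.commute sum_distrib_right mult.assoc)
  also have "\<dots> \<le> decay_bound N f"
    unfolding decay_bound_def using schwartz_seminorm_upper[OF assms, of x _ "[]"]
    by (intro sum_mono mult_left_mono) auto
  finally show ?thesis .
qed

lemma decay_bound_divide:
  assumes "f \<in> schwartz"
  shows "norm (f x) \<le> decay_bound N f * (1 / (1 + norm x) ^ N)"
  using decay_bound[OF assms, of x N] by (simp add: field_simps add_pos_nonneg)

lemma schwartz_continuous: "f \<in> schwartz \<Longrightarrow> continuous_on A f"
  by (meson continuous_at_imp_continuous_on differentiable_imp_continuous_within schwartz_differentiable)

lemma schwartz_measurable [measurable_dest]: "f \<in> schwartz \<Longrightarrow> f \<in> borel_measurable borel"
  by (simp add: borel_measurable_continuous_onI schwartz_continuous)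

lemma schwartz_integrable: "f \<in> schwartz \<Longrightarrow> integrable lborel f"
  for f :: "'w::euclidean_space \<Rightarrow> complex"
  by (rule Bochner_Integration.integrable_bound[OF integrable_mult_right[OF integrable_weight, of "decay_bound (2 * DIM('w)) f"]])
     (auto intro!: AE_I2 order_trans[OF decay_bound_divide[of f _ "2 * DIM('w)"]] divide_right_mono simp: schwartz_measurable)

lemma schwartz_integral_norm_le:
  fixes f :: "'w::euclidean_space \<Rightarrow> complex"
  assumes "f \<in> schwartz"
  shows "(LINT x|lborel. norm (f x)) \<le>
    (LINT (x::'w)|lborel. 1 / (1 + norm x) ^ (2 * DIM('w))) * decay_bound (2 * DIM('w)) f"
proof -
  have "(LINT x|lborel. norm (f x)) \<le> (LINT (x::'w)|lborel. decay_bound (2 * DIM('w)) f * (1 / (1 + norm x) ^ (2 * DIM('w))))"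
  proof (rule Bochner_Integration.integral_mono)
    show "integrable lborel (\<lambda>x. norm (f x))" by (rule integrable_norm[OF schwartz_integrable[OF assms]])
    show "integrable lborel (\<lambda>x::'w. decay_bound (2 * DIM('w)) f * (1 / (1 + norm x) ^ (2 * DIM('w))))"
      by (intro integrable_mult_right integrable_weight)
  qed (rule decay_bound_divide[OF assms])
  then show ?thesis by (simp only: integral_mult_right_zero mult.commute)
qed

text \<open>Translations are not linear substitutions, so coinduction is applied directly; the
  coordinate is split as \<open>x \<bullet> w = (x + v) \<bullet> w - v \<bullet> w\<close>.\<close>

lemma schwartz_translation:
  assumes "f \<in> schwartz"
  shows "(\<lambda>x. f (x + v)) \<in> schwartz"
proof (rule schwartz_coinduct)
  let ?V = "{\<lambda>x. f (x + v) | f :: 'a \<Rightarrow> complex. f \<in> schwartz}"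
  show "(\<lambda>x. f (x + v)) \<in> ?V" using assms by (intro CollectI exI[of _ f] conjI refl)
  fix g assume "g \<in> ?V"
  then obtain f where g: "g = (\<lambda>x. f (x + v))" and f: "f \<in> schwartz" by (elim CollectE exE conjE)
  have shift: "((\<lambda>x. x + v) has_derivative (\<lambda>u. u)) (at x)" for x :: 'a
    by (auto intro!: derivative_eq_intros)
  have der: "(g has_derivative (\<lambda>u. dirder u f (x + v))) (at x)" for x
    unfolding g by (rule has_derivative_compose[OF shift has_derivative_dirder[OF schwartz_differentiable[OF f]]])
  show "g differentiable (at x)" for x using der unfolding differentiable_def by blast
  show "\<exists>C. \<forall>x. norm (g x) \<le> C" unfolding g using schwartz_norm_le[OF f] by blast
  have "dirder u g = (\<lambda>x. dirder u f (x + v))" for u by (rule ext) (rule dirder_eqI[OF der])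
  then show "dirder u g \<in> ?V" for u
    by (intro CollectI exI[of _ "dirder u f"] conjI schwartz_dirder f)
  show "(\<lambda>x. (x \<bullet> w) *\<^sub>R g x) \<in> ?V" for w
  proof (intro CollectI exI conjI)
    show "(\<lambda>x. (x \<bullet> w) *\<^sub>R g x) = (\<lambda>x. ((x + v) \<bullet> w) *\<^sub>R f (x + v) - of_real (v \<bullet> w) * f (x + v))"
      by (simp add: g inner_add_left scaleR_conv_of_real algebra_simps)
    show "(\<lambda>x. (x \<bullet> w) *\<^sub>R f x - of_real (v \<bullet> w) * f x) \<in> schwartz"
      by (intro schwartz_diff schwartz_scaleR_inner schwartz_mult_const f)
  qed
qed

lemma schwartz_cnj:
  assumes "f \<in> schwartz"
  shows "(\<lambda>x. cnj (f x)) \<in> schwartz"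
  using assms unfolding schwartz_def
  by (auto simp: iter_deriv_bounded_linear[OF bounded_linear_cnj] intro: smooth_bounded_linear[OF bounded_linear_cnj])

section \<open>Gaussians\<close>

text \<open>One explicit Schwartz function with value 1 at the origin. Its Fourier transform is
  never computed.\<close>

definition gaussian :: "'w::euclidean_space \<Rightarrow> complex" where
  "gaussian x = of_real (exp (- (x \<bullet> x) / 2))"

lemma norm_gaussian_le: "norm (gaussian x) \<le> 1"
  by (simp add: gaussian_def)

text \<open>The real polynomial multiples of the Gaussian, which form the closed family for
  \<open>schwartz_coinduct\<close>.\<close>

inductive gaussian_span :: "('w::euclidean_space \<Rightarrow> complex) \<Rightarrow> bool" where
  gaussian: "gaussian_span gaussian"
| inner: "gaussian_span f \<Longrightarrow> (\<And>x. g x = (x \<bullet> w) *\<^sub>R f x) \<Longrightarrow> gaussian_span g"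
| scale: "gaussian_span f \<Longrightarrow> (\<And>x. g x = r *\<^sub>R f x) \<Longrightarrow> gaussian_span g"
| add: "gaussian_span f \<Longrightarrow> gaussian_span g \<Longrightarrow> (\<And>x. h x = f x + g x) \<Longrightarrow> gaussian_span h"

lemma has_derivative_gaussian:
  "(gaussian has_derivative (\<lambda>v. - (x \<bullet> v) *\<^sub>R gaussian x)) (at x)"
  unfolding gaussian_def[abs_def]
  by (auto intro!: derivative_eq_intros ext simp: scaleR_conv_of_real inner_commute)

lemma gaussian_span_derivative:
  "gaussian_span f \<Longrightarrow> (\<forall>x. f differentiable (at x)) \<and> (\<forall>v. gaussian_span (dirder v f))"
proof (induction rule: gaussian_span.induct)
  case gaussian
  have d: "dirder v gaussian x = (-1) *\<^sub>R ((x \<bullet> v) *\<^sub>R gaussian x)" for v x :: 'a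
    using dirder_eqI[OF has_derivative_gaussian[of x]] by simp
  have "gaussian_span (dirder v gaussian)" for v :: 'a
    by (rule gaussian_span.scale[OF gaussian_span.inner[OF gaussian_span.gaussian refl] d])
  then show ?case using has_derivative_gaussian by (auto simp: differentiable_def)
next
  case (inner f g w)
  have g: "g = (\<lambda>x. (x \<bullet> w) *\<^sub>R f x)" using inner by auto
  have "gaussian_span (dirder v g)" for v
    by (rule gaussian_span.add[OF gaussian_span.scale[OF inner.hyps(1) refl, of "v \<bullet> w"]
          gaussian_span.inner[OF _ refl, of "dirder v f" w]])
      (use inner in \<open>auto simp: g dirder_scaleR_inner\<close>)
  then show ?case
    using inner by (auto simp: g intro!: differentiable_scaleR differentiable_inner_const)
next
  case (scale f g r)
  have g: "g = (\<lambda>x. r *\<^sub>R f x)" using scale by auto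
  have "gaussian_span (dirder v g)" for v
    by (rule gaussian_span.scale[of "dirder v f" _ r])
      (use scale in \<open>auto simp: g dirder_bounded_linear[OF bounded_linear_scaleR_right]\<close>)
  then show ?case using scale by (auto simp: g intro!: differentiable_scaleR)
next
  case (add f g h)
  have h: "h = (\<lambda>x. f x + g x)" using add by auto
  have "gaussian_span (dirder v h)" for v
    by (rule gaussian_span.add[of "dirder v f" "dirder v g"]) (use add in \<open>auto simp: h dirder_add\<close>)
  then show ?case using add by (auto simp: h intro!: differentiable_add)
qed

lemma gaussian_span_bound:
  "gaussian_span f \<Longrightarrow> \<exists>C n. 0 \<le> C \<and> (\<forall>x. norm (f x) \<le> C * (1 + norm x) ^ n * norm (gaussian x))"
proof (induction rule: gaussian_span.induct)
  case gaussian
  show ?case by (intro exI[of _ 1] exI[of _ 0]) simp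
next
  case (inner f g w)
  then obtain C n where C: "0 \<le> C" "\<And>x. norm (f x) \<le> C * (1 + norm x) ^ n * norm (gaussian x)" by blast
  have "norm (g x) \<le> (norm w * C) * (1 + norm x) ^ Suc n * norm (gaussian x)" for x
  proof -
    have "\<bar>x \<bullet> w\<bar> \<le> norm w * (1 + norm x)"
      using Cauchy_Schwarz_ineq2[of x w] by (simp add: algebra_simps add_increasing)
    then have "\<bar>x \<bullet> w\<bar> * norm (f x) \<le> (norm w * (1 + norm x)) * (C * (1 + norm x) ^ n * norm (gaussian x))"
      using C by (intro mult_mono) auto
    then show ?thesis by (simp add: inner mult_ac)
  qed
  then show ?case using C(1) by (intro exI[of _ "norm w * C"] exI[of _ "Suc n"]) auto
next
  case (scale f g r)
  then obtain C n where C: "0 \<le> C" "\<And>x. norm (f x) \<le> C * (1 + norm x) ^ n * norm (gaussian x)" by blast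
  have "norm (g x) \<le> (\<bar>r\<bar> * C) * (1 + norm x) ^ n * norm (gaussian x)" for x
    using mult_left_mono[OF C(2)[of x], of "\<bar>r\<bar>"] by (simp add: scale mult_ac)
  then show ?case using C(1) by (intro exI[of _ "\<bar>r\<bar> * C"] exI[of _ n]) auto
next
  case (add f g h)
  then obtain C n where C: "0 \<le> C" "\<And>x. norm (f x) \<le> C * (1 + norm x) ^ n * norm (gaussian x)" by blast
  obtain D m where D: "0 \<le> D" "\<And>x. norm (g x) \<le> D * (1 + norm x) ^ m * norm (gaussian x)"
    using add by blast
  have "norm (h x) \<le> (C + D) * (1 + norm x) ^ (max n m) * norm (gaussian x)" for x
  proof -
    have "C * (1 + norm x) ^ n * norm (gaussian x) \<le> C * (1 + norm x) ^ (max n m) * norm (gaussian x)"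
      using C(1) by (intro mult_right_mono mult_left_mono power_increasing) auto
    moreover have "D * (1 + norm x) ^ m * norm (gaussian x) \<le> D * (1 + norm x) ^ (max n m) * norm (gaussian x)"
      using D(1) by (intro mult_right_mono mult_left_mono power_increasing) auto
    ultimately show ?thesis
      using C(2)[of x] D(2)[of x] norm_triangle_ineq[of "f x" "g x"] by (simp add: add distrib_right)
  qed
  then show ?case using C(1) D(1) by (intro exI[of _ "C + D"] exI[of _ "max n m"]) auto
qed

lemma gaussian_power_bound: "\<exists>C. \<forall>x. (1 + norm x) ^ n * norm (gaussian x) \<le> C"
proof -
  have "((\<lambda>r::real. (1 + r) ^ n * exp (- (r * r) / 2)) \<longlongrightarrow> 0) at_top"
    by real_asymp
  then have "eventually (\<lambda>r::real. (1 + r) ^ n * exp (- (r * r) / 2) < 1) at_top"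
    by (rule order_tendstoD) simp
  then obtain R where R: "\<And>r::real. R \<le> r \<Longrightarrow> (1 + r) ^ n * exp (- (r * r) / 2) < 1"
    by (auto simp: eventually_at_top_linorder)
  \<comment> \<open>The summand \<open>1\<close> bounds the product from radius \<open>R\<close> on;
    inside, the power alone does, as the Gaussian is at most 1.\<close>
  have "(1 + norm x) ^ n * norm (gaussian x) \<le> 1 + (1 + \<bar>R\<bar>) ^ n" for x :: 'a
  proof (cases "R \<le> norm x")
    case True
    have "(1 + norm x) ^ n * norm (gaussian x) < 1"
      using R[OF True] by (simp add: gaussian_def dot_square_norm power2_eq_square)
    moreover have "0 \<le> (1 + \<bar>R\<bar>) ^ n" by (rule zero_le_power) simp
    ultimately show ?thesis by linarith
  next
    case False
    then have "(1 + norm x) ^ n * norm (gaussian x) \<le> (1 + \<bar>R\<bar>) ^ n * 1"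
      by (intro mult_mono power_mono) (auto simp: gaussian_def)
    then show ?thesis by simp
  qed
  then show ?thesis by blast
qed

lemma gaussian_schwartz: "gaussian \<in> schwartz"
proof (rule schwartz_coinduct)
  show "gaussian \<in> Collect gaussian_span" by (simp add: gaussian_span.gaussian)
  fix g :: "'a \<Rightarrow> complex" assume "g \<in> Collect gaussian_span"
  then have g: "gaussian_span g" by simp
  show "\<exists>C. \<forall>x. norm (g x) \<le> C"
  proof -
    obtain C n where C: "0 \<le> C" "\<And>x. norm (g x) \<le> C * (1 + norm x) ^ n * norm (gaussian x)"
      using gaussian_span_bound[OF g] by blast
    obtain D where D: "\<And>x::'a. (1 + norm x) ^ n * norm (gaussian x) \<le> D"
      using gaussian_power_bound by blast
    have "norm (g x) \<le> C * D" for x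
      using C(2)[of x] mult_left_mono[OF D C(1), of x] by (simp add: mult.assoc)
    then show ?thesis by blast
  qed
  show "(\<lambda>x. (x \<bullet> w) *\<^sub>R g x) \<in> Collect gaussian_span" for w
    using gaussian_span.inner[OF g refl] by simp
qed (use gaussian_span_derivative in auto)

section \<open>Symplectic forms\<close>

lemma
  assumes "symplectic_form \<rho>"
  shows symplectic_bilinear: "bilinear \<rho>"
    and symplectic_antisym: "\<rho> \<xi> \<eta> = - \<rho> \<eta> \<xi>"
    and symplectic_nondegenerate: "(\<And>\<eta>. \<rho> \<xi> \<eta> = 0) \<Longrightarrow> \<xi> = 0"
  using assms unfolding symplectic_form_def by blast+

lemma symplectic_bounded_bilinear: "symplectic_form \<rho> \<Longrightarrow> bounded_bilinear \<rho>"
  using symplectic_bilinear bilinear_conv_bounded_bilinear by blast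

text \<open>Non-degeneracy makes \<open>u \<mapsto> \<rho>(\<cdot>, u)\<close> injective from the
  space to its dual; equality of dimensions makes it surjective.\<close>

lemma symplectic_represents:
  fixes \<rho> :: "'w::euclidean_space \<Rightarrow> 'w \<Rightarrow> real"
  assumes \<rho>: "symplectic_form \<rho>" and l: "linear l"
  obtains u where "\<And>x. l x = \<rho> x u"
proof -
  interpret bounded_bilinear \<rho> by (rule symplectic_bounded_bilinear[OF \<rho>])
  define g where "g u = (\<Sum>b\<in>Basis. \<rho> b u *\<^sub>R b)" for u
  have g: "x \<bullet> g u = \<rho> x u" for x u
  proof -
    have "\<rho> x u = \<rho> (\<Sum>b\<in>Basis. (x \<bullet> b) *\<^sub>R b) u" by (simp add: euclidean_representation)
    also have "\<dots> = (\<Sum>b\<in>Basis. (x \<bullet> b) * \<rho> b u)" by (simp add: sum_left scaleR_left)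
    finally show ?thesis by (simp add: g_def inner_sum_right mult.commute)
  qed
  have "linear g"
    by (intro linearI) (simp_all add: g_def add_right scaleR_right scaleR_add_left sum.distrib scaleR_sum_right)
  moreover have "inj g"
  proof (rule linear_injective_0[OF \<open>linear g\<close>, THEN iffD2], intro allI impI)
    fix u assume "g u = 0"
    then have "\<rho> x u = 0" for x using g[of x u] by simp
    then show "u = 0" using symplectic_antisym[OF \<rho>, of u] by (intro symplectic_nondegenerate[OF \<rho>]) simp
  qed
  ultimately have "surj g" by (intro linear_injective_imp_surjective) auto
  obtain w where w: "\<And>x. l x = x \<bullet> w" using linear_functional_inner[OF l] by blast
  obtain u where "w = g u" using \<open>surj g\<close> by blast
  then show thesis using w g that by simp
qed

section \<open>The Fourier transform on the Schwartz space\<close>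

lemma cis_expand: "exp (- \<i> * complex_of_real t) = cis (- t)"
  by (simp add: cis_conv_exp)

abbreviation lfourier :: "('w \<Rightarrow> 'w \<Rightarrow> real) \<Rightarrow> ('w::euclidean_space \<Rightarrow> complex) \<Rightarrow> 'w \<Rightarrow> complex" where
  "lfourier \<equiv> fourier_wrt lborel"

lemma lfourier_cis: "lfourier \<rho> f \<xi> = (LINT \<eta>|lborel. cis (- \<rho> \<xi> \<eta>) * f \<eta>)"
  by (simp only: fourier_wrt_def cis_expand)

lemma continuous_cis: "continuous_on A g \<Longrightarrow> continuous_on A (\<lambda>x. cis (g x))"
  unfolding cis_conv_exp by (intro continuous_intros)

lemma symplectic_continuous: "symplectic_form \<rho> \<Longrightarrow> continuous_on A f \<Longrightarrow> continuous_on A g \<Longrightarrow> continuous_on A (\<lambda>x. \<rho> (f x) (g x))"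
  using bounded_bilinear.continuous_on symplectic_bounded_bilinear by blast

lemma cis_symplectic_measurable:
  assumes "symplectic_form \<rho>" "continuous_on UNIV f" "continuous_on UNIV g"
  shows "(\<lambda>x. cis (- \<rho> (f x) (g x))) \<in> borel_measurable borel"
  by (rule borel_measurable_continuous_onI[OF continuous_cis[OF continuous_on_minus[OF symplectic_continuous[OF assms]]]])

lemma lfourier_integrable:
  assumes "symplectic_form \<rho>" "f \<in> schwartz"
  shows "integrable lborel (\<lambda>\<eta>. cis (- \<rho> \<xi> \<eta>) * f \<eta>)"
proof (rule Bochner_Integration.integrable_bound[OF schwartz_integrable[OF assms(2)]])
  have [measurable]: "(\<lambda>\<eta>. cis (- \<rho> \<xi> \<eta>)) \<in> borel_measurable borel"
    by (intro cis_symplectic_measurable assms continuous_on_const continuous_on_id)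
  have [measurable]: "f \<in> borel_measurable borel" by (rule schwartz_measurable[OF assms(2)])
  show "(\<lambda>\<eta>. cis (- \<rho> \<xi> \<eta>) * f \<eta>) \<in> borel_measurable lborel" by measurable
qed (simp add: norm_mult)

lemma lfourier_add:
  assumes "symplectic_form \<rho>" "f \<in> schwartz" "g \<in> schwartz"
  shows "lfourier \<rho> (\<lambda>x. f x + g x) = (\<lambda>\<xi>. lfourier \<rho> f \<xi> + lfourier \<rho> g \<xi>)"
  using lfourier_integrable[OF assms(1)] assms(2,3) by (intro ext) (simp add: lfourier_cis distrib_left)

lemma lfourier_cmult:
  assumes "symplectic_form \<rho>" "f \<in> schwartz"
  shows "lfourier \<rho> (\<lambda>x. c * f x) = (\<lambda>\<xi>. c * lfourier \<rho> f \<xi>)"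
  by (intro ext) (simp add: lfourier_cis mult.left_commute[of _ c])

lemma lfourier_norm_le:
  assumes "symplectic_form \<rho>" "f \<in> schwartz"
  shows "norm (lfourier \<rho> f \<xi>) \<le> (LINT \<eta>|lborel. norm (f \<eta>))"
proof -
  have "norm (lfourier \<rho> f \<xi>) \<le> (LINT \<eta>|lborel. norm (cis (- \<rho> \<xi> \<eta>) * f \<eta>))"
    unfolding lfourier_cis by (rule integral_norm_bound)
  then show ?thesis by (simp add: norm_mult)
qed

lemma lfourier_translation:
  assumes "symplectic_form \<rho>" "f \<in> schwartz"
  shows "lfourier \<rho> (\<lambda>\<eta>. f (\<eta> + v)) \<xi> = cis (\<rho> \<xi> v) * lfourier \<rho> f \<xi>"
proof -
  interpret bounded_bilinear \<rho> by (rule symplectic_bounded_bilinear[OF assms(1)])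
  let ?g = "\<lambda>\<eta>. cis (- \<rho> \<xi> \<eta>) * f \<eta>"
  have "cis (\<rho> \<xi> v) * lfourier \<rho> f \<xi> = cis (\<rho> \<xi> v) * (LINT \<eta>|lborel. ?g (\<eta> + v))"
    using lborel_integral_translation[of ?g v] borel_measurable_integrable[OF lfourier_integrable[OF assms]]
    by (simp add: lfourier_cis)
  also have "\<dots> = (LINT \<eta>|lborel. cis (\<rho> \<xi> v) * ?g (\<eta> + v))" by simp
  also have "\<dots> = (LINT \<eta>|lborel. cis (- \<rho> \<xi> \<eta>) * f (\<eta> + v))"
  proof -
    have "cis (\<rho> \<xi> v) * ?g (\<eta> + v) = cis (- \<rho> \<xi> \<eta>) * f (\<eta> + v)" for \<eta>
      by (simp add: add_right cis_mult flip: mult.assoc)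
    then show ?thesis by (simp only:)
  qed
  finally show ?thesis by (simp add: lfourier_cis)
qed

section \<open>Derivatives and multiplication under the Fourier transform\<close>

lemma norm_cis_minus_linear: "norm (cis b - 1 - \<i> * b) \<le> b\<^sup>2"
proof -
  have "norm (cis b - 1 - \<i> * b) \<le> \<bar>b\<bar>\<^sup>2 / 2"
    using iexp_approx1[of b 1] by (simp add: cis_conv_exp algebra_simps power2_eq_square numeral_2_eq_2)
  then show ?thesis using zero_le_power2[of b] unfolding power2_abs by linarith
qed

text \<open>Differentiation under the integral by a direct estimate: the first-order Taylor
  remainder of the phase is at most \<open>(\<rho> h \<eta>)\<^sup>2\<close>, which is quadratic in
  \<open>h\<close> with an integrable coefficient.\<close>

lemma lfourier_has_derivative:
  fixes \<rho> :: "'w::euclidean_space \<Rightarrow> 'w \<Rightarrow> real"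
  assumes \<rho>: "symplectic_form \<rho>" and f: "f \<in> schwartz"
  shows "(lfourier \<rho> f has_derivative (\<lambda>h. lfourier \<rho> (\<lambda>\<eta>. \<rho> h \<eta> *\<^sub>R (- \<i> * f \<eta>)) \<xi>)) (at \<xi>)"
proof -
  interpret bounded_bilinear \<rho> by (rule symplectic_bounded_bilinear[OF \<rho>])
  have Sch: "(\<lambda>\<eta>. \<rho> h \<eta> *\<^sub>R (- \<i> * f \<eta>)) \<in> schwartz" for h
  proof -
    obtain w where "\<And>\<eta>. \<rho> h \<eta> = \<eta> \<bullet> w"
      using linear_functional_inner[of "\<rho> h"] symplectic_bilinear[OF \<rho>] by (auto simp: bilinear_def)
    then show ?thesis using schwartz_scaleR_inner[OF schwartz_mult_const(1)[OF f], of w "- \<i>"] by simp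
  qed
  obtain K where K: "K \<ge> 0" "\<And>a b. norm (\<rho> a b) \<le> norm a * norm b * K" using nonneg_bounded by blast
  \<comment> \<open>A majorant of \<open>norm \<eta> ^ 2 * norm (f \<eta>)\<close> that is visibly
    integrable, being a finite sum of norms of Schwartz functions.\<close>
  let ?g = "\<lambda>\<eta>::'w. (\<Sum>b\<in>Basis. (\<Sum>c\<in>Basis. norm ((\<eta> \<bullet> b) *\<^sub>R (\<eta> \<bullet> c) *\<^sub>R f \<eta>)))"
  have g_int: "integrable lborel ?g"
    by (intro Bochner_Integration.integrable_sum integrable_norm schwartz_integrable schwartz_scaleR_inner f)
  have g: "norm \<eta> ^ 2 * norm (f \<eta>) \<le> ?g \<eta>" for \<eta>
  proof -
    have "norm \<eta> ^ 2 * norm (f \<eta>) \<le> (\<Sum>b\<in>Basis. norm \<eta> ^ 1 * norm ((\<eta> \<bullet> b) *\<^sub>R f \<eta>))"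
      using norm_Suc_power_le[of \<eta> 1 "f \<eta>"] by (simp add: numeral_2_eq_2)
    also have "\<dots> \<le> ?g \<eta>"
    proof (rule sum_mono)
      fix b :: 'w
      show "norm \<eta> ^ 1 * norm ((\<eta> \<bullet> b) *\<^sub>R f \<eta>) \<le> (\<Sum>c\<in>Basis. norm ((\<eta> \<bullet> b) *\<^sub>R (\<eta> \<bullet> c) *\<^sub>R f \<eta>))"
        using norm_Suc_power_le[of \<eta> 0 "(\<eta> \<bullet> b) *\<^sub>R f \<eta>"] by (simp add: mult_ac)
    qed
    finally show ?thesis .
  qed
  let ?D = "\<lambda>h. lfourier \<rho> (\<lambda>\<eta>. \<rho> h \<eta> *\<^sub>R (- \<i> * f \<eta>)) \<xi>"
  have bl: "bounded_linear ?D"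
  proof (rule linear_conv_bounded_linear[THEN iffD1], rule linearI)
    show "?D (a + b) = ?D a + ?D b" for a b
      using fun_cong[OF lfourier_add[OF \<rho> Sch[of a] Sch[of b]], of \<xi>] by (simp add: add_left scaleR_add_left)
    show "?D (r *\<^sub>R a) = r *\<^sub>R ?D a" for r a
      using fun_cong[OF lfourier_cmult[OF \<rho> Sch[of a], of "of_real r"], of \<xi>]
      by (simp add: scaleR_left scaleR_conv_of_real mult_ac)
  qed
  show ?thesis
  proof (rule has_derivativeI_sandwich[OF zero_less_one bl])
    let ?H = "\<lambda>y. K\<^sup>2 * (LINT \<eta>|lborel. ?g \<eta>) * norm (y - \<xi>)"
    show "(?H \<longlongrightarrow> 0) (at \<xi>)"
      by (auto intro!: tendsto_eq_intros)
    fix y assume "y \<noteq> \<xi>"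
    define h where "h = y - \<xi>"
    have y: "y = \<xi> + h" and h: "h \<noteq> 0" using \<open>y \<noteq> \<xi>\<close> by (auto simp: h_def)
    note I1 = lfourier_integrable[OF \<rho> f] and I2 = lfourier_integrable[OF \<rho> Sch[of h]]
    have "lfourier \<rho> f y - lfourier \<rho> f \<xi> - ?D h =
        (LINT \<eta>|lborel. cis (- \<rho> y \<eta>) * f \<eta> - cis (- \<rho> \<xi> \<eta>) * f \<eta> - cis (- \<rho> \<xi> \<eta>) * (\<rho> h \<eta> *\<^sub>R (- \<i> * f \<eta>)))"
      unfolding lfourier_cis
      by (simp only: Bochner_Integration.integral_diff[OF Bochner_Integration.integrable_diff[OF I1 I1] I2]
          Bochner_Integration.integral_diff[OF I1 I1])
    also have "norm \<dots> \<le> (LINT \<eta>|lborel. (K\<^sup>2 * norm h ^ 2) * ?g \<eta>)"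
    proof (rule Bochner_Integration.integral_norm_bound_integral)
      show "integrable lborel (\<lambda>\<eta>. cis (- \<rho> y \<eta>) * f \<eta> - cis (- \<rho> \<xi> \<eta>) * f \<eta> - cis (- \<rho> \<xi> \<eta>) * (\<rho> h \<eta> *\<^sub>R (- \<i> * f \<eta>)))"
        by (intro Bochner_Integration.integrable_diff lfourier_integrable \<rho> f Sch)
      show "integrable lborel (\<lambda>\<eta>. (K\<^sup>2 * norm h ^ 2) * ?g \<eta>)" using g_int by (intro integrable_mult_right)
      fix \<eta>
      have split: "cis (- \<rho> y \<eta>) = cis (- \<rho> \<xi> \<eta>) * cis (- \<rho> h \<eta>)"
        by (simp add: y add_left cis_mult)
      have "cis (- \<rho> y \<eta>) * f \<eta> - cis (- \<rho> \<xi> \<eta>) * f \<eta> - cis (- \<rho> \<xi> \<eta>) * (\<rho> h \<eta> *\<^sub>R (- \<i> * f \<eta>))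
          = cis (- \<rho> \<xi> \<eta>) * (cis (- \<rho> h \<eta>) - 1 - \<i> * (- \<rho> h \<eta>)) * f \<eta>"
        by (simp add: split scaleR_conv_of_real algebra_simps)
      then have "norm (cis (- \<rho> y \<eta>) * f \<eta> - cis (- \<rho> \<xi> \<eta>) * f \<eta> - cis (- \<rho> \<xi> \<eta>) * (\<rho> h \<eta> *\<^sub>R (- \<i> * f \<eta>)))
          = norm (cis (- \<rho> h \<eta>) - 1 - \<i> * (- \<rho> h \<eta>)) * norm (f \<eta>)"
        by (simp only: norm_mult norm_cis mult_1)
      also have "\<dots> \<le> (- \<rho> h \<eta>)\<^sup>2 * norm (f \<eta>)"
        using norm_cis_minus_linear[of "- \<rho> h \<eta>"] by (intro mult_right_mono) auto
      also have "\<dots> \<le> (norm h * norm \<eta> * K)\<^sup>2 * norm (f \<eta>)"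
        using power_mono[OF K(2)[of h \<eta>], of 2] by (intro mult_right_mono) auto
      also have "\<dots> = (K\<^sup>2 * norm h ^ 2) * (norm \<eta> ^ 2 * norm (f \<eta>))" by (simp add: power_mult_distrib)
      also have "\<dots> \<le> (K\<^sup>2 * norm h ^ 2) * ?g \<eta>" by (intro mult_left_mono g) simp
      finally show "norm (cis (- \<rho> y \<eta>) * f \<eta> - cis (- \<rho> \<xi> \<eta>) * f \<eta> - cis (- \<rho> \<xi> \<eta>) * (\<rho> h \<eta> *\<^sub>R (- \<i> * f \<eta>)))
        \<le> (K\<^sup>2 * norm h ^ 2) * ?g \<eta>" .
    qed
    also have "\<dots> = (K\<^sup>2 * norm h ^ 2) * (LINT \<eta>|lborel. ?g \<eta>)" by (rule integral_mult_right_zero)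
    finally show "norm (lfourier \<rho> f y - lfourier \<rho> f \<xi> - ?D (y - \<xi>)) / norm (y - \<xi>) \<le> ?H y"
      using h by (simp add: h_def[symmetric] field_simps power2_eq_square)
  qed
qed

text \<open>The mean value inequality along the segment, then
  \<open>1 + norm x \<le> (1 + norm y) * (1 + norm u)\<close> to carry the decay from the
  intermediate point \<open>y\<close> back to \<open>x\<close>. After division by \<open>t\<close>
  the bound no longer depends on \<open>t\<close>, which dominated convergence requires.\<close>

lemma schwartz_difference_le:
  assumes f: "f \<in> schwartz" and t: "0 \<le> t" "t \<le> 1"
  shows "norm (f (x + t *\<^sub>R u) - f x) \<le>
    t * (decay_bound N (dirder u f) * (1 + norm u) ^ N * (1 / (1 + norm x) ^ N))"
proof -
  let ?B = "decay_bound N (dirder u f) * (1 + norm u) ^ N * (1 / (1 + norm x) ^ N)"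
  have bound: "norm (dirder u f (x + s *\<^sub>R u)) \<le> ?B" if s: "0 \<le> s" "s \<le> 1" for s
  proof -
    let ?y = "x + s *\<^sub>R u"
    have "norm x \<le> norm ?y + s * norm u"
      using norm_triangle_ineq4[of ?y "s *\<^sub>R u"] s by simp
    moreover have "s * norm u \<le> norm u" using s by (simp add: mult_left_le_one_le)
    moreover have "(1 + norm ?y) * (1 + norm u) = 1 + norm ?y + norm u + norm ?y * norm u"
      by (simp only: distrib_left distrib_right mult_1 mult_1_right add.assoc)
    moreover have "0 \<le> norm ?y * norm u" by (intro mult_nonneg_nonneg norm_ge_zero)
    ultimately have "1 + norm x \<le> (1 + norm ?y) * (1 + norm u)" by linarith
    then have "(1 + norm x) ^ N \<le> (1 + norm ?y) ^ N * (1 + norm u) ^ N"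
      using power_mono[of "1 + norm x" "(1 + norm ?y) * (1 + norm u)" N] by (simp add: power_mult_distrib)
    then have "(1 + norm x) ^ N * norm (dirder u f ?y) \<le> (1 + norm ?y) ^ N * (1 + norm u) ^ N * norm (dirder u f ?y)"
      by (rule mult_right_mono) simp
    also have "\<dots> = (1 + norm u) ^ N * ((1 + norm ?y) ^ N * norm (dirder u f ?y))" by simp
    also have "\<dots> \<le> (1 + norm u) ^ N * decay_bound N (dirder u f)"
      by (intro mult_left_mono decay_bound schwartz_dirder f) simp
    finally show ?thesis by (simp add: field_simps add_pos_nonneg)
  qed
  have "norm (f (x + t *\<^sub>R u) - f (x + 0 *\<^sub>R u)) \<le> ?B * norm (t - 0)"
  proof (rule differentiable_bound[of "{0..1}" "\<lambda>s. f (x + s *\<^sub>R u)" "\<lambda>s h. h *\<^sub>R dirder u f (x + s *\<^sub>R u)"])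
    show "((\<lambda>s. f (x + s *\<^sub>R u)) has_derivative (\<lambda>h. h *\<^sub>R dirder u f (x + s *\<^sub>R u))) (at s within {0..1})" for s
      using has_vector_derivative_line[OF schwartz_differentiable[OF f]] by (simp add: has_vector_derivative_def)
    show "onorm (\<lambda>h. h *\<^sub>R dirder u f (x + s *\<^sub>R u)) \<le> ?B" if "s \<in> {0..1}" for s
    proof (rule onorm_le)
      show "norm (h *\<^sub>R dirder u f (x + s *\<^sub>R u)) \<le> ?B * norm h" for h
        using mult_right_mono[OF bound[of s] norm_ge_zero[of h]] that
        by (simp only: norm_scaleR mult.commute[of "norm (dirder _ _ _)"] real_norm_def atLeastAtMost_iff)
    qed
  qed (use t in auto)
  then show ?thesis using t by (simp add: mult.commute)
qed

lemma has_vector_derivative_quotient: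
  assumes "(g has_vector_derivative d) (at 0)"
  shows "((\<lambda>t. (g t - g 0) /\<^sub>R t) \<longlongrightarrow> d) (at 0)"
proof -
  have "((\<lambda>h. norm (g h - g 0 - h *\<^sub>R d) / norm h) \<longlongrightarrow> 0) (at 0)"
    using assms by (simp add: has_vector_derivative_def has_derivative_at)
  moreover have "\<forall>\<^sub>F h in at 0. norm (g h - g 0 - h *\<^sub>R d) / norm h = norm ((g h - g 0) /\<^sub>R h - d)"
  proof -
    have "norm (g h - g 0 - h *\<^sub>R d) / norm h = norm ((g h - g 0) /\<^sub>R h - d)" if "h \<noteq> 0" for h
    proof -
      have "(g h - g 0) /\<^sub>R h - d = (g h - g 0 - h *\<^sub>R d) /\<^sub>R h"
        using that by (simp add: scaleR_diff_right)
      then show ?thesis by (simp add: divide_inverse mult.commute)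
    qed
    then show ?thesis by (simp add: eventually_at_filter)
  qed
  ultimately have "((\<lambda>h. norm ((g h - g 0) /\<^sub>R h - d)) \<longlongrightarrow> 0) (at 0)"
    by (rule Lim_transform_eventually)
  then show ?thesis by (simp only: tendsto_norm_zero_iff LIM_zero_iff)
qed

lemma has_vector_derivative_cis_zero: "((\<lambda>t. cis (t * a)) has_vector_derivative \<i> * a) (at 0)"
  unfolding has_vector_derivative_def
  by (rule has_derivative_eq_rhs[OF has_derivative_cis]) (auto intro!: derivative_eq_intros simp: scaleR_conv_of_real)

text \<open>Replaces integration by parts: a translation of \<open>f\<close> becomes a phase on the
  transform, and the difference quotient of this identity has the two sides as its limits.\<close>

lemma lfourier_dirder:
  fixes \<rho> :: "'w::euclidean_space \<Rightarrow> 'w \<Rightarrow> real"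
  assumes \<rho>: "symplectic_form \<rho>" and f: "f \<in> schwartz"
  shows "lfourier \<rho> (dirder u f) \<xi> = \<i> * \<rho> \<xi> u * lfourier \<rho> f \<xi>"
proof -
  interpret bounded_bilinear \<rho> by (rule symplectic_bounded_bilinear[OF \<rho>])
  \<comment> \<open>A sequence, as dominated convergence demands; its terms are positive, so they
    can be divided by, and at most 1, as \<open>schwartz_difference_le\<close> demands.\<close>
  define t :: "nat \<Rightarrow> real" where "t n = 1 / real (Suc n)" for n
  have t: "0 < t n" "t n \<le> 1" for n by (auto simp: t_def)
  have t_lim: "t \<longlonglongrightarrow> 0" unfolding t_def[abs_def] using lim_1_over_n by (rule LIMSEQ_Suc)
  then have t_at: "filterlim t (at 0) sequentially"
    using t by (auto simp: filterlim_at less_imp_neq[symmetric])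
  let ?s = "\<lambda>n \<eta>. cis (- \<rho> \<xi> \<eta>) * ((f (\<eta> + t n *\<^sub>R u) - f \<eta>) /\<^sub>R t n)"
  have s_eq: "(LINT \<eta>|lborel. ?s n \<eta>) = ((cis (t n * \<rho> \<xi> u) - 1) /\<^sub>R t n) * lfourier \<rho> f \<xi>" for n
  proof -
    have "(LINT \<eta>|lborel. ?s n \<eta>) = (LINT \<eta>|lborel. (1 / t n) *\<^sub>R (cis (- \<rho> \<xi> \<eta>) * f (\<eta> + t n *\<^sub>R u) - cis (- \<rho> \<xi> \<eta>) * f \<eta>))"
      by (simp add: algebra_simps divide_inverse)
    also have "\<dots> = (1 / t n) *\<^sub>R (lfourier \<rho> (\<lambda>\<eta>. f (\<eta> + t n *\<^sub>R u)) \<xi> - lfourier \<rho> f \<xi>)"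
      using lfourier_integrable[OF \<rho> f] lfourier_integrable[OF \<rho> schwartz_translation[OF f]]
      by (simp add: lfourier_cis)
    finally show ?thesis
      by (simp add: lfourier_translation[OF \<rho> f] scaleR_right algebra_simps divide_inverse)
  qed
  have "(\<lambda>n. LINT \<eta>|lborel. ?s n \<eta>) \<longlonglongrightarrow> (LINT \<eta>|lborel. cis (- \<rho> \<xi> \<eta>) * dirder u f \<eta>)"
  proof (rule integral_dominated_convergence)
    show "(\<lambda>\<eta>. cis (- \<rho> \<xi> \<eta>) * dirder u f \<eta>) \<in> borel_measurable lborel"
      by (rule borel_measurable_integrable[OF lfourier_integrable[OF \<rho> schwartz_dirder[OF f]]])
    show "?s n \<in> borel_measurable lborel" for n
    proof -
      have "(\<lambda>\<eta>. of_real (1 / t n) * (f (\<eta> + t n *\<^sub>R u) - f \<eta>)) \<in> schwartz"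
        by (intro schwartz_mult_const schwartz_diff schwartz_translation f)
      from borel_measurable_integrable[OF lfourier_integrable[OF \<rho> this]]
      show ?thesis by (simp add: scaleR_conv_of_real divide_inverse)
    qed
    let ?B = "decay_bound (2 * DIM('w)) (dirder u f) * (1 + norm u) ^ (2 * DIM('w))"
    show "integrable lborel (\<lambda>\<eta>::'w. ?B * (1 / (1 + norm \<eta>) ^ (2 * DIM('w))))"
      by (intro integrable_mult_right integrable_weight)
    show "AE \<eta> in lborel. norm (?s n \<eta>) \<le> ?B * (1 / (1 + norm \<eta>) ^ (2 * DIM('w)))" for n
    proof (rule AE_I2)
      fix \<eta>
      have "norm (?s n \<eta>) = norm (f (\<eta> + t n *\<^sub>R u) - f \<eta>) / t n"
        using t(1)[of n] by (simp add: norm_mult divide_inverse)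
      also have "\<dots> \<le> ?B * (1 / (1 + norm \<eta>) ^ (2 * DIM('w)))"
        using schwartz_difference_le[OF f less_imp_le[OF t(1)[of n]] t(2), of \<eta> u "2 * DIM('w)"] t(1)[of n]
        by (simp add: pos_divide_le_eq mult_ac)
      finally show "norm (?s n \<eta>) \<le> ?B * (1 / (1 + norm \<eta>) ^ (2 * DIM('w)))" .
    qed
    show "AE \<eta> in lborel. (\<lambda>n. ?s n \<eta>) \<longlonglongrightarrow> cis (- \<rho> \<xi> \<eta>) * dirder u f \<eta>"
    proof (rule AE_I2)
      fix \<eta>
      have "((\<lambda>t. f (\<eta> + t *\<^sub>R u)) has_vector_derivative dirder u f (\<eta> + 0 *\<^sub>R u)) (at 0)"
        by (rule has_vector_derivative_line[OF schwartz_differentiable[OF f]])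
      then have "((\<lambda>t. (f (\<eta> + t *\<^sub>R u) - f \<eta>) /\<^sub>R t) \<longlongrightarrow> dirder u f \<eta>) (at 0)"
        using has_vector_derivative_quotient by fastforce
      then have "(\<lambda>n. (f (\<eta> + t n *\<^sub>R u) - f \<eta>) /\<^sub>R t n) \<longlonglongrightarrow> dirder u f \<eta>"
        by (rule filterlim_compose[OF _ t_at])
      then show "(\<lambda>n. ?s n \<eta>) \<longlonglongrightarrow> cis (- \<rho> \<xi> \<eta>) * dirder u f \<eta>" by (rule tendsto_mult_left)
    qed
  qed
  moreover have "(\<lambda>n. LINT \<eta>|lborel. ?s n \<eta>) \<longlonglongrightarrow> \<i> * \<rho> \<xi> u * lfourier \<rho> f \<xi>"
  proof -
    have "((\<lambda>t. cis (t * \<rho> \<xi> u)) has_vector_derivative \<i> * \<rho> \<xi> u) (at 0)"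
      by (rule has_vector_derivative_cis_zero)
    then have "((\<lambda>t. (cis (t * \<rho> \<xi> u) - 1) /\<^sub>R t) \<longlongrightarrow> \<i> * \<rho> \<xi> u) (at 0)"
      using has_vector_derivative_quotient by fastforce
    then have "(\<lambda>n. (cis (t n * \<rho> \<xi> u) - 1) /\<^sub>R t n) \<longlonglongrightarrow> \<i> * \<rho> \<xi> u"
      by (rule filterlim_compose[OF _ t_at])
    then show ?thesis unfolding s_eq by (rule tendsto_mult_right)
  qed
  ultimately show ?thesis unfolding lfourier_cis[of \<rho> "dirder u f"] by (rule LIMSEQ_unique)
qed

lemma schwartz_op_lfourier:
  fixes \<rho> :: "'w::euclidean_space \<Rightarrow> 'w \<Rightarrow> real"
  assumes \<rho>: "symplectic_form \<rho>"
  shows "schwartz_op (lfourier \<rho>)"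
proof (rule schwartz_op_intertwine[where p = "\<lambda>f. (LINT (x::'w)|lborel. 1 / (1 + norm x) ^ (2 * DIM('w))) * decay_bound (2 * DIM('w)) f"])
  show "lfourier \<rho> f differentiable (at \<xi>)" if "f \<in> schwartz" for f \<xi>
    using lfourier_has_derivative[OF \<rho> that] unfolding differentiable_def by blast
  show "dominated (\<lambda>f. (LINT (x::'w)|lborel. 1 / (1 + norm x) ^ (2 * DIM('w))) * decay_bound (2 * DIM('w)) f)"
    by (intro dominated_scale dominated_decay_bound Bochner_Integration.integral_nonneg) simp
  show "norm (lfourier \<rho> f \<xi>) \<le> (LINT (x::'w)|lborel. 1 / (1 + norm x) ^ (2 * DIM('w))) * decay_bound (2 * DIM('w)) f"
    if "f \<in> schwartz" for f \<xi>
    by (rule order_trans[OF lfourier_norm_le[OF \<rho> that] schwartz_integral_norm_le[OF that]])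
  show "\<exists>A. polydiff A \<and> (\<forall>f\<in>schwartz. dirder v (lfourier \<rho> f) = lfourier \<rho> (A f))" for v
  proof -
    obtain w where w: "\<And>\<eta>. \<rho> v \<eta> = \<eta> \<bullet> w"
      using linear_functional_inner[of "\<rho> v"] symplectic_bilinear[OF \<rho>] by (auto simp: bilinear_def)
    have "dirder v (lfourier \<rho> f) = lfourier \<rho> (\<lambda>\<eta>. (\<eta> \<bullet> w) *\<^sub>R (- \<i> * f \<eta>))" if "f \<in> schwartz" for f
      by (rule ext) (simp add: dirder_eqI[OF lfourier_has_derivative[OF \<rho> that]] w)
    moreover have "polydiff (\<lambda>f \<eta>. (\<eta> \<bullet> w) *\<^sub>R (- \<i> * f \<eta>))"
      by (intro polydiff_intros polydiff_id)
    ultimately show ?thesis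
      by (intro exI[of _ "\<lambda>f \<eta>. (\<eta> \<bullet> w) *\<^sub>R (- \<i> * f \<eta>)"] conjI ballI)
  qed
  show "\<exists>A. schwartz_op A \<and> (\<forall>f\<in>schwartz. (\<lambda>\<xi>. (\<xi> \<bullet> w) *\<^sub>R lfourier \<rho> f \<xi>) = lfourier \<rho> (A f))" for w
  proof -
    \<comment> \<open>Non-degeneracy: every coordinate is \<open>\<rho> \<xi> u\<close> for some
      direction \<open>u\<close>, the factor that a derivative along \<open>u\<close>
      produces.\<close>
    obtain u where u: "\<And>\<xi>. \<xi> \<bullet> w = \<rho> \<xi> u"
      using symplectic_represents[OF \<rho> bounded_linear.linear[OF bounded_linear_inner_left]] by blast
    have "(\<lambda>\<xi>. (\<xi> \<bullet> w) *\<^sub>R lfourier \<rho> f \<xi>) = lfourier \<rho> (\<lambda>\<eta>. - \<i> * dirder u f \<eta>)" if "f \<in> schwartz" for f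
      by (rule ext) (simp only: lfourier_cmult[OF \<rho> schwartz_dirder[OF that]] lfourier_dirder[OF \<rho> that] u scaleR_conv_of_real,
        simp add: mult.assoc[symmetric])
    moreover have "schwartz_op (\<lambda>f \<eta>. - \<i> * dirder u f \<eta>)"
      by (intro schwartz_op_polydiff polydiff_intros polydiff_dirder)
    ultimately show ?thesis
      by (intro exI[of _ "\<lambda>f \<eta>. - \<i> * dirder u f \<eta>"] conjI ballI)
  qed
qed

section \<open>Fourier inversion\<close>

text \<open>The reflection turns one kernel into the other, because \<open>\<rho>(-\<xi>, \<eta>) = \<rho>(\<eta>, \<xi>)\<close>.\<close>

lemma lfourier_duality:
  fixes \<rho> :: "'w::euclidean_space \<Rightarrow> 'w \<Rightarrow> real"
  assumes \<rho>: "symplectic_form \<rho>" and f: "f \<in> schwartz" and g: "g \<in> schwartz"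
  shows "(LINT \<xi>|lborel. lfourier \<rho> f (- \<xi>) * g \<xi>) = (LINT \<eta>|lborel. f \<eta> * lfourier \<rho> g \<eta>)"
proof -
  interpret bounded_bilinear \<rho> by (rule symplectic_bounded_bilinear[OF \<rho>])
  have [measurable]: "f \<in> borel_measurable borel" "g \<in> borel_measurable borel"
    using f g by (auto intro: schwartz_measurable)
  have eq: "- \<rho> (- \<xi>) \<eta> = - \<rho> \<eta> \<xi>" for \<xi> \<eta>
    using symplectic_antisym[OF \<rho>, of \<xi> \<eta>] by (simp add: minus_left)
  let ?h = "\<lambda>\<xi> \<eta>. cis (- \<rho> \<eta> \<xi>) * (f \<eta> * g \<xi>)"
  have "continuous_on UNIV (\<lambda>p :: 'w \<times> 'w. cis (- \<rho> (snd p) (fst p)))"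
    by (rule continuous_cis[OF continuous_on_minus[OF symplectic_continuous[OF \<rho>]]])
      (auto intro: continuous_on_snd continuous_on_fst continuous_on_id)
  then have [measurable]: "(\<lambda>p :: 'w \<times> 'w. cis (- \<rho> (snd p) (fst p))) \<in> borel_measurable (borel \<Otimes>\<^sub>M borel)"
    unfolding borel_prod by (rule borel_measurable_continuous_onI)
  have "integrable (lborel \<Otimes>\<^sub>M lborel) (case_prod ?h)"
  proof (rule lborel_pair.Fubini_integrable)
    show "case_prod ?h \<in> borel_measurable (lborel \<Otimes>\<^sub>M lborel)"
      unfolding case_prod_unfold by measurable
    have "integrable lborel (\<lambda>\<xi>. (LINT \<eta>|lborel. norm (f \<eta>)) * norm (g \<xi>))"
      by (intro integrable_mult_right integrable_norm schwartz_integrable g)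
    then show "integrable lborel (\<lambda>\<xi>. LINT \<eta>|lborel. norm (case_prod ?h (\<xi>, \<eta>)))"
      by (simp add: norm_mult)
    show "AE \<xi> in lborel. integrable lborel (\<lambda>\<eta>. case_prod ?h (\<xi>, \<eta>))"
    proof (rule AE_I2)
      fix \<xi>
      have "integrable lborel (\<lambda>\<eta>. cis (- \<rho> (- \<xi>) \<eta>) * f \<eta> * g \<xi>)"
        by (intro integrable_mult_left lfourier_integrable \<rho> f)
      then show "integrable lborel (\<lambda>\<eta>. case_prod ?h (\<xi>, \<eta>))" unfolding eq by (simp add: mult_ac)
    qed
  qed
  then have "(LINT \<eta>|lborel. LINT \<xi>|lborel. ?h \<xi> \<eta>) = (LINT \<xi>|lborel. LINT \<eta>|lborel. ?h \<xi> \<eta>)"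
    by (rule lborel_pair.Fubini_integral)
  moreover have "(LINT \<eta>|lborel. ?h \<xi> \<eta>) = lfourier \<rho> f (- \<xi>) * g \<xi>" for \<xi>
    unfolding lfourier_cis eq by (simp flip: mult.assoc)
  moreover have "(LINT \<xi>|lborel. ?h \<xi> \<eta>) = f \<eta> * lfourier \<rho> g \<eta>" for \<eta>
    unfolding lfourier_cis by (simp add: mult.left_commute[of _ "f \<eta>"])
  ultimately show ?thesis by simp
qed

text \<open>\<open>\<xi>'\<close> is the image of \<open>\<xi>\<close> under the \<rho>-adjoint of
  \<open>inv S\<close>. It stays a hypothesis so that dilations, R and the inverse of R are all
  instances.\<close>

lemma lfourier_linear:
  fixes \<rho> :: "'w::euclidean_space \<Rightarrow> 'w \<Rightarrow> real"
  assumes \<rho>: "symplectic_form \<rho>" and f: "f \<in> schwartz" and S: "linear S" "bij S"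
    and S': "\<And>\<eta>. \<rho> \<xi> (inv S \<eta>) = \<rho> \<xi>' \<eta>"
  shows "lfourier \<rho> (f \<circ> S) \<xi> = inv_det S * lfourier \<rho> f \<xi>'"
proof -
  have eq: "\<rho> \<xi> \<eta> = \<rho> \<xi>' (S \<eta>)" for \<eta>
    using S'[of "S \<eta>"] S(2) by (simp add: bij_is_inj)
  show ?thesis
    using lborel_integral_linear[OF S, of "\<lambda>\<eta>. cis (- \<rho> \<xi>' \<eta>) * f \<eta>"]
      borel_measurable_integrable[OF lfourier_integrable[OF \<rho> f, of \<xi>']]
    by (simp add: lfourier_cis eq scaleR_conv_of_real)
qed

lemma linear_scaleR_bij:
  assumes "c \<noteq> 0"
  shows "linear (\<lambda>x::'w::euclidean_space. c *\<^sub>R x)" "bij (\<lambda>x::'w. c *\<^sub>R x)" "inv (\<lambda>x::'w. c *\<^sub>R x) = (\<lambda>x. (1 / c) *\<^sub>R x)"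
proof -
  have *: "(\<lambda>x::'w. c *\<^sub>R x) \<circ> (\<lambda>x. (1 / c) *\<^sub>R x) = id" "(\<lambda>x::'w. (1 / c) *\<^sub>R x) \<circ> (\<lambda>x. c *\<^sub>R x) = id"
    using assms by auto
  show "linear (\<lambda>x::'w. c *\<^sub>R x)" by (rule bounded_linear.linear[OF bounded_linear_scaleR_right])
  show "bij (\<lambda>x::'w. c *\<^sub>R x)" by (rule o_bij[OF *(2,1)])
  show "inv (\<lambda>x::'w. c *\<^sub>R x) = (\<lambda>x. (1 / c) *\<^sub>R x)" by (rule inv_unique_comp[OF *(1,2)])
qed

text \<open>With \<open>\<gamma>\<close> the Gaussian, duality and rescaling give
  \<open>\<integral> (\<F>f)(-\<xi>) \<gamma>(\<epsilon>\<xi>) d\<xi> = \<integral> f(\<epsilon>\<eta>) (\<F>\<gamma>)(\<eta>) d\<eta>\<close>; let \<open>\<epsilon>\<close> tend to \<open>0\<close>.\<close>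

lemma lfourier_inversion_at_zero:
  fixes \<rho> :: "'w::euclidean_space \<Rightarrow> 'w \<Rightarrow> real"
  assumes \<rho>: "symplectic_form \<rho>" and f: "f \<in> schwartz"
  shows "(LINT \<xi>|lborel. lfourier \<rho> f (- \<xi>)) = f 0 * (LINT \<eta>|lborel. lfourier \<rho> gaussian \<eta>)"
proof -
  interpret bounded_bilinear \<rho> by (rule symplectic_bounded_bilinear[OF \<rho>])
  define t :: "nat \<Rightarrow> real" where "t n = 1 / real (Suc n)" for n
  have t: "t n \<noteq> 0" for n by (simp add: t_def)
  have t_lim: "t \<longlonglongrightarrow> 0" unfolding t_def[abs_def] using lim_1_over_n by (rule LIMSEQ_Suc)
  have scaled: "(\<lambda>n. g (t n *\<^sub>R x)) \<longlonglongrightarrow> g 0" if "g \<in> schwartz" for g and x :: 'w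
  proof -
    have "(\<lambda>n. t n *\<^sub>R x) \<longlonglongrightarrow> 0" using tendsto_scaleR[OF t_lim tendsto_const, of x] by simp
    moreover have "isCont g 0"
      using that by (simp add: differentiable_imp_continuous_within schwartz_differentiable)
    ultimately show ?thesis by (rule isCont_tendsto_compose[rotated])
  qed
  have F: "lfourier \<rho> g \<in> schwartz" if "g \<in> schwartz" for g
    by (rule schwartz_opD[OF schwartz_op_lfourier[OF \<rho>] that])
  have refl: "(\<lambda>\<xi>. g (- \<xi>)) \<in> schwartz" if "g \<in> schwartz" for g :: "'w \<Rightarrow> complex"
    using schwartz_opD[OF schwartz_op_compose_linear[OF linear_scaleR_bij(1,2)[of "-1"]] that] by (simp add: comp_def)
  have resc: "(\<lambda>x. g (t n *\<^sub>R x)) \<in> schwartz" if "g \<in> schwartz" for g :: "'w \<Rightarrow> complex" and n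
    using schwartz_opD[OF schwartz_op_compose_linear[OF linear_scaleR_bij(1,2)[OF t[of n]]] that] by (simp add: comp_def)
  have eq: "(LINT \<xi>|lborel. lfourier \<rho> f (- \<xi>) * gaussian (t n *\<^sub>R \<xi>)) =
      (LINT \<eta>|lborel. f (t n *\<^sub>R \<eta>) * lfourier \<rho> gaussian \<eta>)" for n
  proof -
    let ?S = "\<lambda>x::'w. t n *\<^sub>R x"
    note S = linear_scaleR_bij[OF t[of n], where 'w = 'w]
    have "(LINT \<xi>|lborel. lfourier \<rho> f (- \<xi>) * gaussian (t n *\<^sub>R \<xi>)) =
        (LINT \<eta>|lborel. f \<eta> * lfourier \<rho> (gaussian \<circ> ?S) \<eta>)"
      using lfourier_duality[OF \<rho> f resc[OF gaussian_schwartz, of n]] by (simp add: comp_def)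
    also have "\<dots> = (LINT \<eta>|lborel. inv_det ?S *\<^sub>R (f \<eta> * lfourier \<rho> gaussian ((1 / t n) *\<^sub>R \<eta>)))"
    proof -
      have "lfourier \<rho> (gaussian \<circ> ?S) \<eta> = inv_det ?S * lfourier \<rho> gaussian ((1 / t n) *\<^sub>R \<eta>)" for \<eta>
        by (rule lfourier_linear[OF \<rho> gaussian_schwartz S(1,2)]) (simp add: S(3) scaleR_left scaleR_right)
      then show ?thesis by (simp add: scaleR_conv_of_real mult_ac)
    qed
    also have "\<dots> = inv_det ?S *\<^sub>R (LINT \<eta>|lborel. f \<eta> * lfourier \<rho> gaussian ((1 / t n) *\<^sub>R \<eta>))"
      by (rule integral_scaleR_right)
    \<comment> \<open>The factor \<open>inv_det ?S\<close> is absorbed by the same dilation, now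
      applied to the variable of integration.\<close>
    also have "\<dots> = (LINT \<eta>|lborel. f (t n *\<^sub>R \<eta>) * lfourier \<rho> gaussian \<eta>)"
    proof -
      have "f \<in> borel_measurable borel" "(\<lambda>\<eta>. lfourier \<rho> gaussian ((1 / t n) *\<^sub>R \<eta>)) \<in> borel_measurable borel"
        using schwartz_measurable[OF f] schwartz_measurable[OF F[OF gaussian_schwartz]] by measurable
      then have "(\<lambda>\<eta>. f \<eta> * lfourier \<rho> gaussian ((1 / t n) *\<^sub>R \<eta>)) \<in> borel_measurable borel" by measurable
      from lborel_integral_linear[OF S(1,2) this] show ?thesis using t[of n] by simp
    qed
    finally show ?thesis .
  qed
  have "(\<lambda>n. LINT \<xi>|lborel. lfourier \<rho> f (- \<xi>) * gaussian (t n *\<^sub>R \<xi>)) \<longlonglongrightarrow> (LINT \<xi>|lborel. lfourier \<rho> f (- \<xi>))"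
  proof (rule integral_dominated_convergence)
    show "integrable lborel (\<lambda>\<xi>. norm (lfourier \<rho> f (- \<xi>)))"
      by (rule integrable_norm[OF schwartz_integrable[OF refl[OF F[OF f]]]])
    show "(\<lambda>\<xi>. lfourier \<rho> f (- \<xi>)) \<in> borel_measurable lborel"
      using schwartz_measurable[OF refl[OF F[OF f]]] by simp
    then show "(\<lambda>\<xi>. lfourier \<rho> f (- \<xi>) * gaussian (t n *\<^sub>R \<xi>)) \<in> borel_measurable lborel" for n
      using schwartz_measurable[OF resc[OF gaussian_schwartz, of n]] by simp
    show "AE \<xi> in lborel. norm (lfourier \<rho> f (- \<xi>) * gaussian (t n *\<^sub>R \<xi>)) \<le> norm (lfourier \<rho> f (- \<xi>))" for n
    proof (rule AE_I2)
      fix \<xi> :: 'w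
      show "norm (lfourier \<rho> f (- \<xi>) * gaussian (t n *\<^sub>R \<xi>)) \<le> norm (lfourier \<rho> f (- \<xi>))"
        unfolding norm_mult by (rule mult_left_le[OF norm_gaussian_le]) simp
    qed
    show "AE \<xi> in lborel. (\<lambda>n. lfourier \<rho> f (- \<xi>) * gaussian (t n *\<^sub>R \<xi>)) \<longlonglongrightarrow> lfourier \<rho> f (- \<xi>)"
      using tendsto_mult_left[OF scaled[OF gaussian_schwartz]] by (intro AE_I2) (simp add: gaussian_def)
  qed
  moreover have "(\<lambda>n. LINT \<eta>|lborel. f (t n *\<^sub>R \<eta>) * lfourier \<rho> gaussian \<eta>) \<longlonglongrightarrow>
      (LINT \<eta>|lborel. f 0 * lfourier \<rho> gaussian \<eta>)"
  proof (rule integral_dominated_convergence)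
    note F\<gamma> = F[OF gaussian_schwartz]
    show "integrable lborel (\<lambda>\<eta>. schwartz_seminorm 0 [] f * norm (lfourier \<rho> gaussian \<eta>))"
      by (intro integrable_mult_right integrable_norm schwartz_integrable F\<gamma>)
    show "(\<lambda>\<eta>. f 0 * lfourier \<rho> gaussian \<eta>) \<in> borel_measurable lborel"
      using schwartz_measurable[OF F\<gamma>] by simp
    show "(\<lambda>\<eta>. f (t n *\<^sub>R \<eta>) * lfourier \<rho> gaussian \<eta>) \<in> borel_measurable lborel" for n
      using schwartz_measurable[OF F\<gamma>] schwartz_measurable[OF resc[OF f, of n]] by simp
    show "AE \<eta> in lborel. norm (f (t n *\<^sub>R \<eta>) * lfourier \<rho> gaussian \<eta>)
        \<le> schwartz_seminorm 0 [] f * norm (lfourier \<rho> gaussian \<eta>)" for n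
      by (rule AE_I2) (simp add: norm_mult mult_right_mono schwartz_norm_le[OF f])
    show "AE \<eta> in lborel. (\<lambda>n. f (t n *\<^sub>R \<eta>) * lfourier \<rho> gaussian \<eta>) \<longlonglongrightarrow> f 0 * lfourier \<rho> gaussian \<eta>"
      by (intro AE_I2 tendsto_mult_right scaled f)
  qed
  ultimately show ?thesis
    unfolding eq by (simp add: LIMSEQ_unique)
qed

text \<open>If the integral were 0, the zero set would be closed and of full measure, hence the
  whole space.\<close>

lemma integral_pos_continuous:
  fixes h :: "'w::euclidean_space \<Rightarrow> real"
  assumes "integrable lborel h" "continuous_on UNIV h" "\<And>x. 0 \<le> h x" "h x0 \<noteq> 0"
  shows "0 < (LINT x|lborel. h x)"
proof -
  have "\<not> (AE x in lborel. h x = 0)"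
  proof
    assume "AE x in lborel. h x = 0"
    then have "AE x in lebesgue. x \<in> {x. h x = 0}" by (simp add: AE_completion)
    moreover have "closed {x. h x = 0}"
      using continuous_closed_preimage_constant[OF assms(2) closed_UNIV, of 0] by simp
    ultimately have "x0 \<in> {x. h x = 0}" by (intro mem_closed_if_AE_lebesgue)
    then show False using assms(4) by simp
  qed
  then have "(LINT x|lborel. h x) \<noteq> 0"
    using integral_nonneg_eq_0_iff_AE[OF assms(1)] assms(3) by simp
  moreover have "0 \<le> (LINT x|lborel. h x)" using assms(3) by (rule Bochner_Integration.integral_nonneg)
  ultimately show ?thesis by simp
qed

lemma schwartz_norm_square_integrable:
  assumes "f \<in> schwartz"
  shows "integrable lborel (\<lambda>x. (norm (f x))\<^sup>2)"
proof (rule Bochner_Integration.integrable_bound)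
  show "integrable lborel (\<lambda>x. schwartz_seminorm 0 [] f * norm (f x))"
    by (intro integrable_mult_right integrable_norm schwartz_integrable assms)
  show "(\<lambda>x. (norm (f x))\<^sup>2) \<in> borel_measurable lborel" using schwartz_measurable[OF assms] by simp
  show "AE x in lborel. norm ((norm (f x))\<^sup>2) \<le> norm (schwartz_seminorm 0 [] f * norm (f x))"
    using schwartz_norm_le[OF assms] schwartz_seminorm_nonneg[OF assms]
    by (intro AE_I2) (simp add: power2_eq_square mult_right_mono)
qed

lemma schwartz_norm_square_pos:
  assumes "f \<in> schwartz" "f x0 \<noteq> 0"
  shows "0 < (LINT x|lborel. (norm (f x))\<^sup>2)"
  by (rule integral_pos_continuous[of _ x0])
    (use assms in \<open>auto intro!: schwartz_norm_square_integrable continuous_intros schwartz_continuous\<close>)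

text \<open>Translation carries the inversion formula from the origin to every point, and duality
  turns it into Plancherel with the same constant. That the constant is real and positive is only
  seen afterwards.\<close>

lemma lfourier_inversion:
  fixes \<rho> :: "'w::euclidean_space \<Rightarrow> 'w \<Rightarrow> real"
  assumes \<rho>: "symplectic_form \<rho>"
  obtains K :: real where "0 < K"
    "\<And>f x. f \<in> schwartz \<Longrightarrow> lfourier \<rho> (lfourier \<rho> f) x = of_real K * (f x :: complex)"
    "\<And>f g. f \<in> schwartz \<Longrightarrow> g \<in> schwartz \<Longrightarrow>
       (LINT \<xi>|lborel. cnj (lfourier \<rho> f \<xi>) * lfourier \<rho> g \<xi>) = of_real K * (LINT \<xi>|lborel. cnj (f \<xi>) * g \<xi>)"
proof -
  interpret bounded_bilinear \<rho> by (rule symplectic_bounded_bilinear[OF \<rho>])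
  define d where "d = inv_det (uminus :: 'w \<Rightarrow> 'w)"
  have um: "linear (uminus :: 'w \<Rightarrow> 'w)" "bij (uminus :: 'w \<Rightarrow> 'w)"
    by (auto intro!: linearI o_bij[of uminus] simp: comp_def)
  have d: "0 < d" unfolding d_def by (rule inv_det_pos[OF um])
  \<comment> \<open>The division by \<open>d\<close> undoes the reflection in
    \<open>lfourier_inversion_at_zero\<close>; for now \<open>K'\<close> is just a complex
    number.\<close>
  define K' where "K' = (LINT \<eta>|lborel. lfourier \<rho> gaussian \<eta>) / d"
  have F: "lfourier \<rho> g \<in> schwartz" if "g \<in> schwartz" for g
    by (rule schwartz_opD[OF schwartz_op_lfourier[OF \<rho>] that])
  have inv: "lfourier \<rho> (lfourier \<rho> f) x = K' * f x" if f: "f \<in> schwartz" for f x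
  proof -
    note fx = schwartz_translation[OF f, of x]
    have "cis (- \<rho> x \<eta>) * lfourier \<rho> f \<eta> = lfourier \<rho> (\<lambda>y. f (y + x)) \<eta>" for \<eta>
      using symplectic_antisym[OF \<rho>, of x \<eta>] by (simp add: lfourier_translation[OF \<rho> f])
    then have "lfourier \<rho> (lfourier \<rho> f) x = (LINT \<eta>|lborel. lfourier \<rho> (\<lambda>y. f (y + x)) \<eta>)"
      by (simp add: lfourier_cis[of \<rho> "lfourier \<rho> f"])
    moreover have "of_real d * (LINT \<eta>|lborel. lfourier \<rho> (\<lambda>y. f (y + x)) \<eta>) =
        f x * (LINT \<eta>|lborel. lfourier \<rho> gaussian \<eta>)"
      using lborel_integral_linear[OF um, of "lfourier \<rho> (\<lambda>y. f (y + x))"] schwartz_measurable[OF F[OF fx]]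
        lfourier_inversion_at_zero[OF \<rho> fx] by (simp add: d_def scaleR_conv_of_real)
    ultimately show ?thesis using d by (simp add: K'_def field_simps)
  qed
  have planch: "(LINT \<xi>|lborel. cnj (lfourier \<rho> f \<xi>) * lfourier \<rho> g \<xi>) = K' * (LINT \<xi>|lborel. cnj (f \<xi>) * g \<xi>)"
    if f: "f \<in> schwartz" and g: "g \<in> schwartz" for f g
  proof -
    have "cnj (lfourier \<rho> f \<xi>) = lfourier \<rho> (\<lambda>x. cnj (f x)) (- \<xi>)" for \<xi>
    proof -
      have "cnj (lfourier \<rho> f \<xi>) = (LINT \<eta>|lborel. cnj (cis (- \<rho> \<xi> \<eta>) * f \<eta>))"
        unfolding lfourier_cis by (rule Bochner_Integration.integral_cnj[symmetric])
      then show ?thesis by (simp add: lfourier_cis cis_cnj minus_left)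
    qed
    then have "(LINT \<xi>|lborel. cnj (lfourier \<rho> f \<xi>) * lfourier \<rho> g \<xi>) =
        (LINT \<xi>|lborel. cnj (f \<xi>) * lfourier \<rho> (lfourier \<rho> g) \<xi>)"
      using lfourier_duality[OF \<rho> schwartz_cnj[OF f] F[OF g]] by simp
    also have "\<dots> = (LINT \<xi>|lborel. K' * (cnj (f \<xi>) * g \<xi>))"
      by (simp add: inv[OF g] mult_ac)
    also have "\<dots> = K' * (LINT \<xi>|lborel. cnj (f \<xi>) * g \<xi>)" by (rule integral_mult_right_zero)
    finally show ?thesis .
  qed
  have sq: "(LINT \<xi>|lborel. cnj (f \<xi>) * f \<xi>) = of_real (LINT \<xi>|lborel. (norm (f \<xi>))\<^sup>2)" for f :: "'w \<Rightarrow> complex"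
  proof -
    have "cnj (f \<xi>) * f \<xi> = of_real ((norm (f \<xi>))\<^sup>2)" for \<xi>
      by (simp only: complex_norm_square mult.commute)
    then show ?thesis by (simp only: integral_complex_of_real)
  qed
  define a where "a = (LINT \<xi>::'w|lborel. (norm (gaussian \<xi>))\<^sup>2)"
  define b where "b = (LINT \<xi>|lborel. (norm (lfourier \<rho> gaussian \<xi>))\<^sup>2)"
  have a: "0 < a" unfolding a_def by (rule schwartz_norm_square_pos[OF gaussian_schwartz, of 0]) (simp add: gaussian_def)
  have b: "0 < b" unfolding b_def
  proof (rule schwartz_norm_square_pos[OF F[OF gaussian_schwartz], of 0])
    have "lfourier \<rho> gaussian 0 = of_real (LINT x::'w|lborel. exp (- (x \<bullet> x) / 2))"
      by (simp add: lfourier_cis zero_left gaussian_def[abs_def])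
    moreover have "0 < (LINT x::'w|lborel. exp (- (x \<bullet> x) / 2))"
      using integrable_norm[OF schwartz_integrable[OF gaussian_schwartz]]
      by (intro integral_pos_continuous[of _ 0]) (auto simp: gaussian_def[abs_def] intro!: continuous_intros)
    ultimately show "lfourier \<rho> gaussian 0 \<noteq> 0" by simp
  qed
  \<comment> \<open>Plancherel for the Gaussian against itself exhibits \<open>K'\<close> as a
    quotient of positive reals.\<close>
  have "of_real b = K' * of_real a"
    using planch[OF gaussian_schwartz gaussian_schwartz] by (simp only: sq a_def b_def)
  then have K': "K' = of_real (b / a)" using a by (simp add: field_simps)
  show thesis
  proof (rule that[of "b / a"])
    show "0 < b / a" using a b by simp
  qed (use inv planch in \<open>auto simp: K'\<close>)
qed

section \<open>The normalised Haar measure\<close>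

text \<open>The density of the normalised Haar measure with respect to Lebesgue measure, and the
  factor carried by \<open>form_pairing\<close>.\<close>

definition form_density :: "('w::euclidean_space \<Rightarrow> 'w \<Rightarrow> real) \<Rightarrow> real" where
  "form_density \<rho> = measure (form_measure \<rho>) (cbox 0 One)"

lemma fourier_wrt_density:
  assumes "0 < c" "symplectic_form \<rho>" "f \<in> schwartz"
  shows "fourier_wrt (density lborel (\<lambda>_. ennreal c)) \<rho> f = (\<lambda>\<xi>. c * lfourier \<rho> f \<xi>)"
proof
  fix \<xi>
  note m = borel_measurable_integrable[OF lfourier_integrable[OF assms(2,3), of \<xi>]]
  show "fourier_wrt (density lborel (\<lambda>_. ennreal c)) \<rho> f \<xi> = c * lfourier \<rho> f \<xi>"
    unfolding fourier_wrt_def cis_expand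
    by (subst integral_density) (use assms m in \<open>auto simp: scaleR_conv_of_real\<close>)
qed

lemma form_density:
  fixes \<rho> :: "'w::euclidean_space \<Rightarrow> 'w \<Rightarrow> real"
  assumes \<rho>: "symplectic_form \<rho>"
  shows form_density_pos: "0 < form_density \<rho>"
    and form_density_inversion: "f \<in> schwartz \<Longrightarrow> (form_density \<rho>)\<^sup>2 * lfourier \<rho> (lfourier \<rho> f) x = f x"
    and fourier_eq: "f \<in> schwartz \<Longrightarrow> fourier \<rho> f = (\<lambda>\<xi>. form_density \<rho> * lfourier \<rho> f \<xi>)"
proof -
  obtain K :: real where K: "0 < K"
    and inv: "\<And>f x. f \<in> schwartz \<Longrightarrow> lfourier \<rho> (lfourier \<rho> f) x = of_real K * (f x :: complex)"
    and planch: "\<And>f g. f \<in> schwartz \<Longrightarrow> g \<in> schwartz \<Longrightarrow>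
       (LINT \<xi>|lborel. cnj (lfourier \<rho> f \<xi>) * lfourier \<rho> g \<xi>) = of_real K * (LINT \<xi>|lborel. cnj (f \<xi>) * g \<xi>)"
    by (rule lfourier_inversion[OF \<rho>]) (rule that)
  have F: "lfourier \<rho> g \<in> schwartz" if "g \<in> schwartz" for g
    by (rule schwartz_opD[OF schwartz_op_lfourier[OF \<rho>] that])
  define c where "c = 1 / sqrt K"
  have c: "0 < c" "c\<^sup>2 * K = 1" using K by (auto simp: c_def power_divide)
  let ?M = "\<lambda>c. density lborel (\<lambda>_. ennreal c) :: 'w measure"
  have twice: "fourier_wrt (?M c) \<rho> (fourier_wrt (?M c) \<rho> f) x = of_real (c\<^sup>2 * K) * f x"
    if "f \<in> schwartz" "0 < c" for f c x
    using that by (simp add: fourier_wrt_density \<rho> F schwartz_mult_const lfourier_cmult inv power2_eq_square mult_ac)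
  have "form_measure \<rho> = ?M c"
    unfolding form_measure_def
  proof (rule the_equality, intro conjI ballI)
    show "haar_measure (?M c)" by (rule haar_measure_density[OF c(1)])
    show "fourier_wrt (?M c) \<rho> (fourier_wrt (?M c) \<rho> f) = f" if "f \<in> schwartz" for f
      using twice[OF that c(1)] c(2) by (intro ext) simp
    show "(LINT \<xi>|?M c. cnj (fourier_wrt (?M c) \<rho> f \<xi>) * fourier_wrt (?M c) \<rho> g \<xi>) = (LINT \<xi>|?M c. cnj (f \<xi>) * g \<xi>)"
      if "f \<in> schwartz" "g \<in> schwartz" for f g
    proof -
      have [measurable]: "f \<in> borel_measurable borel" "g \<in> borel_measurable borel"
        "lfourier \<rho> f \<in> borel_measurable borel" "lfourier \<rho> g \<in> borel_measurable borel"
        "(\<lambda>x. cnj (f x)) \<in> borel_measurable borel" "(\<lambda>\<xi>. cnj (lfourier \<rho> f \<xi>)) \<in> borel_measurable borel"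
        using that F schwartz_cnj by (auto intro: schwartz_measurable)
      \<comment> \<open>Three factors \<open>c\<close>: one from each transform and one from the
        measure. Plancherel supplies a \<open>K\<close> that cancels two of them.\<close>
      have "(LINT \<xi>|?M c. cnj (fourier_wrt (?M c) \<rho> f \<xi>) * fourier_wrt (?M c) \<rho> g \<xi>) =
          (LINT \<xi>|lborel. of_real (c * c\<^sup>2) * (cnj (lfourier \<rho> f \<xi>) * lfourier \<rho> g \<xi>))"
        using c(1) that
        unfolding fourier_wrt_density[OF c(1) \<rho> that(1)] fourier_wrt_density[OF c(1) \<rho> that(2)]
          complex_cnj_mult complex_cnj_complex_of_real
        by (subst integral_density; measurable?) (auto simp: scaleR_conv_of_real power2_eq_square mult_ac)
      also have "\<dots> = of_real (c * (c\<^sup>2 * K)) * (LINT \<xi>|lborel. cnj (f \<xi>) * g \<xi>)"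
        by (subst integral_mult_right_zero) (simp add: planch that)
      also have "\<dots> = (LINT \<xi>|?M c. cnj (f \<xi>) * g \<xi>)"
        using c by (subst integral_density; measurable?) (auto simp: scaleR_conv_of_real)
      finally show ?thesis .
    qed
  next
    fix M :: "'w measure"
    assume M: "haar_measure M \<and> (\<forall>f\<in>schwartz. fourier_wrt M \<rho> (fourier_wrt M \<rho> f) = f) \<and>
     (\<forall>f\<in>schwartz. \<forall>g\<in>schwartz. (LINT \<xi>|M. cnj (fourier_wrt M \<rho> f \<xi>) * fourier_wrt M \<rho> g \<xi>) =
        (LINT \<xi>|M. cnj (f \<xi>) * g \<xi>))"
    define c' where "c' = measure M (cbox 0 One)"
    have M_eq: "M = ?M c'" and c': "0 < c'"
      using haar_measure_eq_density[of M] haar_measure_cube[of M] M by (auto simp: c'_def)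
    \<comment> \<open>Uniqueness: involutivity on one function that does not vanish at the origin
      forces \<open>c'\<^sup>2 * K = 1\<close>, and positivity selects the root.\<close>
    have "fourier_wrt M \<rho> (fourier_wrt M \<rho> gaussian) = gaussian" using M gaussian_schwartz by blast
    then have "fourier_wrt M \<rho> (fourier_wrt M \<rho> gaussian) 0 = 1" by (simp add: gaussian_def)
    then have "of_real (c'\<^sup>2 * K) * gaussian (0::'w) = (1 :: complex)"
      using twice[OF gaussian_schwartz c', of 0] M_eq by simp
    then have "c'\<^sup>2 * K = 1" by (simp add: gaussian_def flip: of_real_mult of_real_power)
    then have "c'\<^sup>2 = c\<^sup>2" using c(2) K by (metis mult_right_cancel less_irrefl)
    then have "c' = c" using c' c(1) by (simp add: power2_eq_iff_nonneg)
    then show "M = ?M c" using M_eq by simp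
  qed
  moreover have "measure (?M c) (cbox 0 One) = c"
    using c(1) by (subst measure_density_const) auto
  ultimately have M: "form_measure \<rho> = ?M c" "form_density \<rho> = c" by (simp_all add: form_density_def)
  show "0 < form_density \<rho>" using c M by simp
  show "(form_density \<rho>)\<^sup>2 * lfourier \<rho> (lfourier \<rho> f) x = f x" if "f \<in> schwartz"
  proof -
    have "of_real (c\<^sup>2) * (of_real K * f x) = of_real (c\<^sup>2 * K) * f x" by simp
    then show ?thesis unfolding M inv[OF that] c(2) by simp
  qed
  show "fourier \<rho> f = (\<lambda>\<xi>. form_density \<rho> * lfourier \<rho> f \<xi>)" if "f \<in> schwartz"
    unfolding fourier_def M by (rule fourier_wrt_density[OF c(1) \<rho> that])
qed

section \<open>Tempered distributions\<close>

lemma schwartz_mem_ball: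
  assumes "f \<in> schwartz"
  shows "f \<in> \<Union>{{g \<in> schwartz. schwartz_seminorm k vs (\<lambda>x. g x - f x) < e} | k vs f e. f \<in> schwartz \<and> 0 < e}"
proof (rule UnionI)
  show "f \<in> {g \<in> schwartz. schwartz_seminorm 0 [] (\<lambda>x. g x - f x) < 1}"
    using assms by (simp add: schwartz_seminorm_def)
qed (use assms zero_less_one in blast)

lemma topspace_schwartz: "topspace schwartz_topology = (schwartz :: ('w::euclidean_space \<Rightarrow> complex) set)"
  unfolding schwartz_topology_def topology_generated_by_topspace
  by (rule antisym) (blast, rule subsetI, rule schwartz_mem_ball)

lemma openin_schwartz_ball:
  assumes "f \<in> schwartz" "0 < e"
  shows "openin schwartz_topology {g \<in> schwartz. schwartz_seminorm k vs (\<lambda>x. g x - f x) < e}"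
  unfolding schwartz_topology_def
  by (rule topology_generated_by_Basis) (use assms in blast)

text \<open>Links the inductive bounds to the topology generated by seminorm balls: sums become
  intersections of neighbourhoods, multiples become smaller radii.\<close>

lemma dominated_neighbourhood:
  assumes "dominated p" "f \<in> schwartz" "0 < e"
  shows "\<exists>U. openin schwartz_topology U \<and> f \<in> U \<and> (\<forall>g\<in>U. p (\<lambda>x. g x - f x) < e)"
  using assms(1,3)
proof (induction arbitrary: e)
  case (seminorm r k vs)
  let ?U = "{g \<in> schwartz. schwartz_seminorm k vs (\<lambda>x. g x - f x) < e}"
  have "schwartz_seminorm k vs (\<lambda>x. f x - f x) \<le> 0"
    using schwartz_mult_const(2)[OF assms(2), of k vs 0] by simp
  then have "f \<in> ?U" using assms(2) seminorm.prems by simp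
  moreover have "r (\<lambda>x. g x - f x) < e" if "g \<in> ?U" for g
    using that seminorm.hyps[OF schwartz_diff[of g f]] assms(2) by force
  ultimately show ?case using openin_schwartz_ball[OF assms(2) seminorm.prems] by blast
next
  case (add p q r)
  obtain U where U: "openin schwartz_topology U" "f \<in> U" "\<And>g. g \<in> U \<Longrightarrow> p (\<lambda>x. g x - f x) < e / 2"
    using add.IH(1)[of "e / 2"] add.prems by auto
  obtain V where V: "openin schwartz_topology V" "f \<in> V" "\<And>g. g \<in> V \<Longrightarrow> q (\<lambda>x. g x - f x) < e / 2"
    using add.IH(2)[of "e / 2"] add.prems by auto
  have "r (\<lambda>x. g x - f x) < e" if "g \<in> U \<inter> V" for g
  proof -
    have "g \<in> schwartz" using that openin_subset[OF U(1)] by (auto simp: topspace_schwartz)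
    then have "r (\<lambda>x. g x - f x) \<le> p (\<lambda>x. g x - f x) + q (\<lambda>x. g x - f x)"
      by (intro add.hyps schwartz_diff assms)
    then show ?thesis using that U(3)[of g] V(3)[of g] by simp
  qed
  then show ?case using U V by (intro exI[of _ "U \<inter> V"]) (simp add: openin_Int)
next
  case (scale p c r)
  \<comment> \<open>Dividing by \<open>c + 1\<close> covers \<open>c = 0\<close> and keeps the final
    inequality strict.\<close>
  obtain U where U: "openin schwartz_topology U" "f \<in> U" "\<And>g. g \<in> U \<Longrightarrow> p (\<lambda>x. g x - f x) < e / (c + 1)"
    using scale.IH[of "e / (c + 1)"] scale.prems scale.hyps by auto
  have "r (\<lambda>x. g x - f x) < e" if "g \<in> U" for g
  proof -
    have "g \<in> schwartz" using that openin_subset[OF U(1)] by (auto simp: topspace_schwartz)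
    then have "r (\<lambda>x. g x - f x) \<le> c * p (\<lambda>x. g x - f x)"
      by (intro scale.hyps schwartz_diff assms)
    also have "\<dots> \<le> c * (e / (c + 1))" using U(3)[OF that] scale.hyps by (intro mult_left_mono) auto
    also have "\<dots> < e" using scale.prems scale.hyps by (simp add: field_simps)
    finally show ?thesis .
  qed
  then show ?case using U by blast
qed

section \<open>Operations on distributions as transposes\<close>

definition schwartz_linear :: "(('w::euclidean_space \<Rightarrow> complex) \<Rightarrow> ('w \<Rightarrow> complex)) \<Rightarrow> bool" where
  "schwartz_linear L \<longleftrightarrow>
     (\<forall>f\<in>schwartz. \<forall>g\<in>schwartz. L (\<lambda>x. f x + g x) = (\<lambda>x. L f x + L g x)) \<and>
     (\<forall>c. \<forall>f\<in>schwartz. L (\<lambda>x. c * f x) = (\<lambda>x. c * L f x))"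

lemma schwartz_linear_diff:
  assumes "schwartz_linear L" "f \<in> schwartz" "g \<in> schwartz"
  shows "L (\<lambda>x. f x - g x) = (\<lambda>x. L f x - L g x)"
proof -
  have "\<forall>f\<in>schwartz. \<forall>g\<in>schwartz. L (\<lambda>x. f x + g x) = (\<lambda>x. L f x + L g x)"
    using assms(1) by (simp add: schwartz_linear_def)
  from bspec[OF bspec[OF this assms(2)] schwartz_mult_const(1)[OF assms(3), of "-1"]]
  have "L (\<lambda>x. f x + (-1) * g x) = (\<lambda>x. L f x + L (\<lambda>x. (-1) * g x) x)" .
  also have "L (\<lambda>x. (-1) * g x) = (\<lambda>x. (-1) * L g x)"
    using assms unfolding schwartz_linear_def by blast
  finally show ?thesis by simp
qed

lemma schwartz_op_continuous_map:
  fixes L :: "('w::euclidean_space \<Rightarrow> complex) \<Rightarrow> 'w \<Rightarrow> complex"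
  assumes L: "schwartz_op L" "schwartz_linear L"
  shows "continuous_map schwartz_topology schwartz_topology L"
  unfolding schwartz_topology_def continuous_on_generated_topo_iff
  unfolding schwartz_topology_def[symmetric] topspace_schwartz
proof (intro conjI allI impI)
  show "L ` schwartz \<subseteq> \<Union>{{g \<in> schwartz. schwartz_seminorm k vs (\<lambda>x. g x - f x) < e} | k vs f e. f \<in> schwartz \<and> 0 < e}"
    using schwartz_mem_ball[OF schwartz_opD[OF L(1)]] by (rule image_subsetI)
  fix B :: "('w \<Rightarrow> complex) set" assume "B \<in> {{g \<in> schwartz. schwartz_seminorm k vs (\<lambda>x. g x - f x) < e} | k vs f e. f \<in> schwartz \<and> 0 < e}"
  then obtain k vs f e where B: "B = {g \<in> schwartz. schwartz_seminorm k vs (\<lambda>x. g x - f x) < e}" and f: "f \<in> schwartz"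
    by blast
  have dom: "dominated (\<lambda>f. schwartz_seminorm k vs (L f))" using L(1) by (simp add: schwartz_op_def)
  show "openin schwartz_topology (L -` B \<inter> schwartz)"
  proof (subst openin_subopen, intro ballI)
    fix h assume h: "h \<in> L -` B \<inter> schwartz"
    \<comment> \<open>The ball \<open>B\<close> is centred at \<open>f\<close>, not at
      \<open>L h\<close>; \<delta> is the room left around \<open>L h\<close>, and subadditivity of
      the seminorm keeps the smaller ball inside \<open>B\<close>.\<close>
    define \<delta> where "\<delta> = e - schwartz_seminorm k vs (\<lambda>x. L h x - f x)"
    have "0 < \<delta>" using h by (simp add: B \<delta>_def)
    then obtain U where U: "openin schwartz_topology U" "h \<in> U"
      "\<And>g. g \<in> U \<Longrightarrow> schwartz_seminorm k vs (L (\<lambda>x. g x - h x)) < \<delta>"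
      using dominated_neighbourhood[OF dom, of h \<delta>] h by auto
    have "g \<in> L -` B \<inter> schwartz" if "g \<in> U" for g
    proof -
      have g: "g \<in> schwartz" using that openin_subset[OF U(1)] by (auto simp: topspace_schwartz)
      have "(\<lambda>x. L g x - f x) = (\<lambda>x. L (\<lambda>x. g x - h x) x + (L h x - f x))"
        using schwartz_linear_diff[OF L(2) g, of h] h by simp
      then have "schwartz_seminorm k vs (\<lambda>x. L g x - f x) \<le>
          schwartz_seminorm k vs (L (\<lambda>x. g x - h x)) + schwartz_seminorm k vs (\<lambda>x. L h x - f x)"
        using schwartz_add(2)[OF schwartz_opD[OF L(1) schwartz_diff[OF g, of h]] schwartz_diff[OF schwartz_opD[OF L(1), of h] f], of k vs] h
        by simp
      then show ?thesis using U(3)[OF that] g schwartz_opD[OF L(1) g] by (simp add: B \<delta>_def)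
    qed
    then show "\<exists>U. openin schwartz_topology U \<and> h \<in> U \<and> U \<subseteq> L -` B \<inter> schwartz" using U by blast
  qed
qed

text \<open>Fourier transform, multiplication and pullback are all of this form. The constant
  \<open>c\<close> is the Jacobian in the pullback and 1 in the other two.\<close>

lemma tempered_comp:
  assumes u: "u \<in> tempered_distributions" and L: "schwartz_op L" "schwartz_linear L"
  shows "(\<lambda>\<phi>\<in>schwartz. c * u (L \<phi>)) \<in> tempered_distributions"
  unfolding tempered_distributions_def mem_Collect_eq
proof (intro conjI ballI allI)
  show "(\<lambda>\<phi>\<in>schwartz. c * u (L \<phi>)) \<in> extensional schwartz" by (rule restrict_extensional)
  show "(\<lambda>\<phi>\<in>schwartz. c * u (L \<phi>)) (\<lambda>x. f x + g x) = (\<lambda>\<phi>\<in>schwartz. c * u (L \<phi>)) f + (\<lambda>\<phi>\<in>schwartz. c * u (L \<phi>)) g"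
    if "f \<in> schwartz" "g \<in> schwartz" for f g
  proof -
    have "u (L (\<lambda>x. f x + g x)) = u (L f) + u (L g)"
      using that u L(2) schwartz_opD[OF L(1)] by (simp add: tempered_distributions_def schwartz_linear_def)
    then show ?thesis using that schwartz_add(1)[OF that] by (simp add: distrib_left)
  qed
  show "(\<lambda>\<phi>\<in>schwartz. c * u (L \<phi>)) (\<lambda>x. b * f x) = cnj b * (\<lambda>\<phi>\<in>schwartz. c * u (L \<phi>)) f"
    if "f \<in> schwartz" for b f
  proof -
    have "u (L (\<lambda>x. b * f x)) = cnj b * u (L f)"
      using that u L(2) schwartz_opD[OF L(1)] by (simp add: tempered_distributions_def schwartz_linear_def)
    then show ?thesis using that schwartz_mult_const(1)[OF that] by simp
  qed
  have "continuous_map schwartz_topology euclidean u" using u by (simp add: tempered_distributions_def)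
  then have "continuous_map schwartz_topology euclidean (u \<circ> L)"
    by (rule continuous_map_compose[OF schwartz_op_continuous_map[OF L]])
  moreover have "continuous_map euclidean euclidean (\<lambda>z. c * z)"
    by (intro continuous_map_iff_continuous2[THEN iffD2] continuous_intros)
  ultimately have "continuous_map schwartz_topology euclidean ((\<lambda>z. c * z) \<circ> (u \<circ> L))"
    by (rule continuous_map_compose)
  then show "continuous_map schwartz_topology euclidean (\<lambda>\<phi>\<in>schwartz. c * u (L \<phi>))"
    by (rule continuous_map_eq) (simp add: topspace_schwartz)
qed

text \<open>\<open>fourier_eq\<close> identifies \<open>fourier \<rho>\<close> with a multiple of
  \<open>lfourier \<rho>\<close> on Schwartz functions, so operator bounds must transfer along
  equality there.\<close>

lemma schwartz_op_cong:
  assumes "schwartz_op A" "\<And>f. f \<in> schwartz \<Longrightarrow> B f = A f"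
  shows "schwartz_op B"
  unfolding schwartz_op_def
proof (intro conjI allI ballI)
  show "B f \<in> schwartz" if "f \<in> schwartz" for f using assms schwartz_opD that by metis
  fix k vs
  have "dominated (\<lambda>f. schwartz_seminorm k vs (A f))" using assms(1) by (simp add: schwartz_op_def)
  then show "dominated (\<lambda>f. schwartz_seminorm k vs (B f))"
    by (rule dominated_mono) (simp add: assms(2))
qed

lemma schwartz_op_fourier:
  assumes "symplectic_form \<rho>"
  shows "schwartz_op (fourier \<rho>)"
proof (rule schwartz_op_cong)
  show "schwartz_op (\<lambda>f x. form_density \<rho> * lfourier \<rho> f x)"
    by (rule schwartz_op_comp[OF schwartz_op_polydiff[OF polydiff_scale[OF polydiff_id]] schwartz_op_lfourier[OF assms]])
qed (rule fourier_eq[OF assms])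

lemma schwartz_linear_fourier:
  assumes "symplectic_form \<rho>"
  shows "schwartz_linear (fourier \<rho>)"
  unfolding schwartz_linear_def
  by (auto simp: fourier_eq[OF assms] schwartz_add(1) schwartz_mult_const(1) lfourier_add[OF assms] lfourier_cmult[OF assms]
      distrib_left)

lemma fourier_fourier:
  assumes "symplectic_form \<rho>" "f \<in> schwartz"
  shows "fourier \<rho> (fourier \<rho> f) = f"
proof
  fix x
  note F = schwartz_opD[OF schwartz_op_lfourier[OF assms(1)] assms(2)]
  show "fourier \<rho> (fourier \<rho> f) x = f x"
    using form_density_inversion[OF assms, of x]
    by (simp add: fourier_eq[OF assms(1)] assms(2) schwartz_mult_const(1)[OF F] lfourier_cmult[OF assms(1) F] power2_eq_square mult.assoc)
qed

lemma fourier_dist_tempered: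
  assumes "symplectic_form \<rho>" "u \<in> tempered_distributions"
  shows "fourier_dist \<rho> u \<in> tempered_distributions"
  using tempered_comp[OF assms(2) schwartz_op_fourier[OF assms(1)] schwartz_linear_fourier[OF assms(1)], of 1]
  by (simp add: fourier_dist_def)

lemma mult_dist_tempered:
  assumes "bilinear B" "\<And>x. l x = cis (B x x)" "u \<in> tempered_distributions"
  shows "mult_dist l u \<in> tempered_distributions"
proof -
  have B: "bilinear (\<lambda>x y. - B x y)"
    using assms(1) unfolding bilinear_def by (auto intro: linear_compose_neg)
  have eq: "(\<lambda>\<xi>. cnj (l \<xi>) * \<phi> \<xi>) = (\<lambda>\<xi>. cis (- B \<xi> \<xi>) * \<phi> \<xi>)" for \<phi> :: "'a \<Rightarrow> complex"
    by (simp add: assms(2) cis_cnj)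
  have "schwartz_linear (\<lambda>f x. cis (- B x x) * f x)"
    by (auto simp: schwartz_linear_def distrib_left)
  from tempered_comp[OF assms(3) schwartz_op_cis_quadratic[OF B] this, of 1]
  show ?thesis by (simp add: mult_dist_def eq)
qed

lemma pullback_dist_tempered:
  assumes "linear S" "bij S" "u \<in> tempered_distributions"
  shows "pullback_dist S u \<in> tempered_distributions"
proof -
  have S': "linear (inv S)" "bij (inv S)"
    using inj_linear_imp_inv_linear[OF assms(1) bij_is_inj[OF assms(2)]] bij_imp_bij_inv[OF assms(2)] .
  have "schwartz_linear (\<lambda>f. f \<circ> inv S)" by (auto simp: schwartz_linear_def comp_def)
  from tempered_comp[OF assms(3) schwartz_op_compose_linear[OF S'] this]
  show ?thesis by (simp add: pullback_dist_def)
qed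

section \<open>Unitary representations\<close>

lemma scaleC_one: "scaleC 1 (x :: 'h::complex_hilbert) = x"
  using scaleR_scaleC[of 1 x] by simp

lemma cinner_add_left: "cinner (x + y) z = cinner x z + cinner y z"
  by (metis cinner_add_right cinner_commute complex_cnj_add)

lemma cinner_scaleC_left: "cinner (scaleC c x) y = cnj c * cinner x y"
  by (metis cinner_scaleC_right cinner_commute complex_cnj_mult)

lemma norm_square_cinner: "(norm x)\<^sup>2 = Re (cinner x x)"
proof -
  have "0 \<le> Re (cinner x x)" using norm_ge_zero[of x] norm_eq_sqrt_cinner[of x] by (simp add: real_sqrt_ge_0_iff)
  then show ?thesis using norm_eq_sqrt_cinner[of x] by simp
qed

lemma norm_scaleC: "norm (scaleC c x) = norm c * norm x"
proof (rule power2_eq_imp_eq)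
  have "cinner (scaleC c x) (scaleC c x) = of_real ((norm c)\<^sup>2) * cinner x x"
    by (simp only: cinner_scaleC_left cinner_scaleC_right complex_norm_square mult.assoc mult.left_commute[of c])
  then show "(norm (scaleC c x))\<^sup>2 = (norm c * norm x)\<^sup>2"
    by (simp add: norm_square_cinner power_mult_distrib)
qed auto

text \<open>The norm already satisfies the triangle inequality, so Cauchy-Schwarz is read off from
  it by expanding the square of \<open>norm (x + y)\<close>.\<close>

lemma Re_cinner_le: "Re (cinner x y) \<le> norm x * norm y"
proof -
  have "(norm (x + y))\<^sup>2 \<le> (norm x + norm y)\<^sup>2" by (intro power_mono norm_triangle_ineq) simp
  moreover have "(norm (x + y))\<^sup>2 = (norm x)\<^sup>2 + (norm y)\<^sup>2 + 2 * Re (cinner x y)"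
    using cinner_commute[of x y] by (simp add: norm_square_cinner cinner_add_left cinner_add_right)
  ultimately show ?thesis by (simp add: power2_sum)
qed

lemma norm_cinner_le: "norm (cinner x y) \<le> norm x * norm y"
proof (cases "cinner x y = 0")
  case False
  \<comment> \<open>A unimodular factor that rotates the scalar product onto the positive real
    axis.\<close>
  define c where "c = cnj (cinner x y) / norm (cinner x y)"
  have "norm c = 1" using False by (simp add: c_def norm_divide)
  have "c * cinner x y = norm (cinner x y)"
    using False complex_norm_square[of "cinner x y"]
    by (simp add: c_def power2_eq_square mult.commute[of "cnj _"] nonzero_divide_eq_eq)
  then have "norm (cinner x y) = Re (cinner x (scaleC c y))" by (simp add: cinner_scaleC_right)
  also have "\<dots> \<le> norm x * norm (scaleC c y)" by (rule Re_cinner_le)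
  finally show ?thesis using \<open>norm c = 1\<close> by (simp add: norm_scaleC)
qed simp

lemma bounded_bilinear_cinner: "bounded_bilinear (cinner :: 'h::complex_hilbert \<Rightarrow> 'h \<Rightarrow> complex)"
  by (rule bounded_bilinear.intro)
     (auto simp: cinner_add_left cinner_add_right scaleR_scaleC cinner_scaleC_left cinner_scaleC_right scaleR_conv_of_real
       intro!: exI[of _ 1] norm_cinner_le)

lemma bounded_bilinear_scaleC: "bounded_bilinear (scaleC :: complex \<Rightarrow> 'h::complex_hilbert \<Rightarrow> 'h)"
  by (rule bounded_bilinear.intro)
     (auto simp: scaleC_add_left scaleC_add_right scaleR_scaleC scaleC_scaleC scaleR_conv_of_real mult.commute norm_scaleC
       intro!: exI[of _ 1])

lemma unitary_norm: "unitary_operator U \<Longrightarrow> norm (U x) = norm x"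
  by (simp add: unitary_operator_def norm_eq_sqrt_cinner)

lemma unitary_bounded_linear: "unitary_operator U \<Longrightarrow> bounded_linear U"
  by (rule bounded_linear_intro[where K = 1])
     (auto simp: unitary_norm, auto simp: unitary_operator_def scaleR_scaleC)

section \<open>The twisted form\<close>

text \<open>Resolves the definite description: non-degeneracy gives both existence, through
  \<open>symplectic_represents\<close> and a sign from antisymmetry, and uniqueness.\<close>

lemma symplectic_adjoint_eq:
  assumes \<sigma>: "symplectic_form \<sigma>" and T: "linear T"
  shows "\<sigma> (symplectic_adjoint \<sigma> T \<xi>) \<eta> = \<sigma> \<xi> (T \<eta>)"
proof -
  interpret bounded_bilinear \<sigma> by (rule symplectic_bounded_bilinear[OF \<sigma>])
  have "\<exists>u. \<forall>\<eta>. \<sigma> u \<eta> = \<sigma> \<xi> (T \<eta>)" for \<xi>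
  proof -
    have "linear (\<lambda>\<eta>. \<sigma> \<xi> (T \<eta>))"
      by (intro linearI) (simp_all add: linear_add[OF T] linear_cmul[OF T] add_right scaleR_right)
    then obtain u where u: "\<And>\<eta>. \<sigma> \<xi> (T \<eta>) = \<sigma> \<eta> u" by (rule symplectic_represents[OF \<sigma>]) (rule that)
    have "\<sigma> (- u) \<eta> = \<sigma> \<xi> (T \<eta>)" for \<eta>
      using u[of \<eta>] symplectic_antisym[OF \<sigma>, of \<eta> u] by (simp add: minus_left)
    then show ?thesis by blast
  qed
  then obtain T' where T': "\<And>\<xi> \<eta>. \<sigma> (T' \<xi>) \<eta> = \<sigma> \<xi> (T \<eta>)" by metis
  have "symplectic_adjoint \<sigma> T = T'"
    unfolding symplectic_adjoint_def
  proof (rule the_equality)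
    show "\<forall>\<xi> \<eta>. \<sigma> (T' \<xi>) \<eta> = \<sigma> \<xi> (T \<eta>)" using T' by blast
    fix T'' assume T'': "\<forall>\<xi> \<eta>. \<sigma> (T'' \<xi>) \<eta> = \<sigma> \<xi> (T \<eta>)"
    show "T'' = T'"
    proof
      fix \<xi>
      have "\<sigma> (T'' \<xi> - T' \<xi>) \<eta> = 0" for \<eta> using T' T'' by (simp add: diff_left)
      then show "T'' \<xi> = T' \<xi>" using symplectic_nondegenerate[OF \<sigma>] by fastforce
    qed
  qed
  then show ?thesis using T' by simp
qed

text \<open>The difference in \<open>twisted_form_eq\<close> is the phase by which
  \<open>W \<xi>\<close> and \<open>W \<eta>\<close> commute; this is how the twisted form reaches
  the matrix coefficients.\<close>

lemma
  assumes \<sigma>: "symplectic_form \<sigma>" and T: "linear T"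
  shows twisted_form_eq: "twisted_form \<sigma> T \<xi> \<eta> = \<sigma> \<xi> (T \<eta>) - \<sigma> \<eta> (T \<xi>)"
    and plus_adjoint_selfadjoint: "\<sigma> (plus_adjoint \<sigma> T \<xi>) \<eta> = \<sigma> \<xi> (plus_adjoint \<sigma> T \<eta>)"
proof -
  interpret bounded_bilinear \<sigma> by (rule symplectic_bounded_bilinear[OF \<sigma>])
  note anti = symplectic_antisym[OF \<sigma>] and adj = symplectic_adjoint_eq[OF \<sigma> T]
  have adj': "\<sigma> a (symplectic_adjoint \<sigma> T b) = - \<sigma> b (T a)" for a b
    using anti[of a "symplectic_adjoint \<sigma> T b"] adj by simp
  show "twisted_form \<sigma> T \<xi> \<eta> = \<sigma> \<xi> (T \<eta>) - \<sigma> \<eta> (T \<xi>)"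
    by (simp add: twisted_form_def plus_adjoint_def add_right adj')
  show "\<sigma> (plus_adjoint \<sigma> T \<xi>) \<eta> = \<sigma> \<xi> (plus_adjoint \<sigma> T \<eta>)"
    using anti[of "T \<xi>" \<eta>] by (simp add: plus_adjoint_def add_left add_right adj adj')
qed

text \<open>Self-adjointness moves the map off its argument, so its linearity becomes that of
  \<sigma> in the first slot, tested against all vectors.\<close>

lemma linear_plus_adjoint:
  assumes \<sigma>: "symplectic_form \<sigma>" and T: "linear T"
  shows "linear (plus_adjoint \<sigma> T)"
proof -
  interpret bounded_bilinear \<sigma> by (rule symplectic_bounded_bilinear[OF \<sigma>])
  note sa = plus_adjoint_selfadjoint[OF \<sigma> T]
  have *: "a = b" if "\<And>\<eta>. \<sigma> a \<eta> = \<sigma> b \<eta>" for a b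
    using symplectic_nondegenerate[OF \<sigma>, of "a - b"] that by (simp add: diff_left)
  show ?thesis
    by (intro linearI *) (simp_all add: sa add_left scaleR_left)
qed

lemma symplectic_twisted_form:
  assumes \<sigma>: "symplectic_form \<sigma>" and T: "linear T" and R: "bij (plus_adjoint \<sigma> T)"
  shows "symplectic_form (twisted_form \<sigma> T)"
  unfolding symplectic_form_def
proof (intro conjI allI impI)
  interpret bounded_bilinear \<sigma> by (rule symplectic_bounded_bilinear[OF \<sigma>])
  note R' = linear_plus_adjoint[OF \<sigma> T]
  show "bilinear (twisted_form \<sigma> T)"
    unfolding bilinear_def twisted_form_def
    by (auto intro!: linearI simp: linear_add[OF R'] linear_cmul[OF R'] add_left add_right scaleR_left scaleR_right)
  show "twisted_form \<sigma> T \<xi> \<eta> = - twisted_form \<sigma> T \<eta> \<xi>" for \<xi> \<eta>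
    by (simp add: twisted_form_eq[OF \<sigma> T])
  fix \<xi> assume 0: "\<forall>\<eta>. twisted_form \<sigma> T \<xi> \<eta> = 0"
  have "\<sigma> \<xi> \<eta> = 0" for \<eta>
    using 0 bij_is_surj[OF R] unfolding twisted_form_def surj_def by metis
  then show "\<xi> = 0" by (rule symplectic_nondegenerate[OF \<sigma>])
qed

section \<open>Matrix coefficients\<close>

lemma exp_i_cis: "exp (\<i> * complex_of_real t) = cis t"
  by (simp add: cis_conv_exp)

text \<open>In the notation of the paper this is \<open>\<i> \<phi>\<^sub>T(v) \<psi>\<close>: the phase between the two Weyl systems is
  quadratic along \<open>t \<mapsto> tv\<close>.\<close>

definition rep_deriv ::
  "('w::euclidean_space \<Rightarrow> 'h::complex_hilbert \<Rightarrow> 'h) \<Rightarrow> 'w \<Rightarrow> 'h \<Rightarrow> 'h" where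
  "rep_deriv W v \<psi> = dirder v (\<lambda>\<xi>. W \<xi> \<psi>) 0"

text \<open>Both vectors vary, because multiplication by a coordinate puts a generator on either
  side of the scalar product.\<close>

inductive coefficient_span ::
  "('w::euclidean_space \<Rightarrow> 'h::complex_hilbert \<Rightarrow> 'h) \<Rightarrow> ('w \<Rightarrow> complex) \<Rightarrow> bool" for W where
  coefficient: "\<phi> \<in> smooth_vectors W \<Longrightarrow> \<psi> \<in> smooth_vectors W \<Longrightarrow>
    (\<And>\<xi>. g \<xi> = cinner \<phi> (W \<xi> \<psi>)) \<Longrightarrow> coefficient_span W g"
| scale: "coefficient_span W f \<Longrightarrow> (\<And>\<xi>. g \<xi> = c * f \<xi>) \<Longrightarrow> coefficient_span W g"
| add: "coefficient_span W f \<Longrightarrow> coefficient_span W g \<Longrightarrow> (\<And>\<xi>. h \<xi> = f \<xi> + g \<xi>) \<Longrightarrow> coefficient_span W h"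

lemma omega_representationD:
  assumes "omega_representation \<sigma> T W"
  shows "unitary_operator (W \<xi>)" "W \<xi> (W \<eta> \<phi>) = scaleC (cis (\<sigma> \<xi> (T \<eta>))) (W (\<xi> + \<eta>) \<phi>)"
  using assms unfolding omega_representation_def exp_i_cis by blast+

context
  fixes \<sigma> :: "'w::euclidean_space \<Rightarrow> 'w \<Rightarrow> real" and T :: "'w \<Rightarrow> 'w" and W :: "'w \<Rightarrow> 'h::complex_hilbert \<Rightarrow> 'h"
  assumes \<sigma>: "symplectic_form \<sigma>" and T: "linear T" and W: "omega_representation \<sigma> T W"
begin

interpretation bounded_bilinear \<sigma> by (rule symplectic_bounded_bilinear[OF \<sigma>])

text \<open>The phase at the origin is 1, so \<open>W 0\<close> is idempotent; an isometric
  idempotent linear map is the identity.\<close>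

lemma rep_zero: "W 0 \<phi> = \<phi>"
proof -
  note U = omega_representationD(1)[OF W, of 0]
  have "W 0 (W 0 \<phi>) = W 0 \<phi>"
    using omega_representationD(2)[OF W, of 0 0 \<phi>] by (simp add: zero_left scaleC_one)
  then have "W 0 (W 0 \<phi> - \<phi>) = 0"
    using linear_diff[OF bounded_linear.linear[OF unitary_bounded_linear[OF U]]] by simp
  then show ?thesis using unitary_norm[OF U, of "W 0 \<phi> - \<phi>"] by simp
qed

lemma smooth_vector_differentiable: "\<psi> \<in> smooth_vectors W \<Longrightarrow> (\<lambda>\<xi>. W \<xi> \<psi>) differentiable (at \<xi>)"
  by (simp add: smooth_vectors_def smooth_differentiable)

lemma rep_line_derivative:
  assumes "\<psi> \<in> smooth_vectors W"
  shows "((\<lambda>t. W (t *\<^sub>R v) \<psi>) has_vector_derivative rep_deriv W v \<psi>) (at 0)"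
  using has_vector_derivative_line[where x = 0 and t = 0 and v = v, OF smooth_vector_differentiable[OF assms]] by (simp add: rep_deriv_def)

text \<open>The group law writes \<open>W (\<xi> + t v)\<close> as a phase times
  \<open>W \<xi> W (t v)\<close>; the second term is the derivative of that phase.\<close>

lemma dirder_rep:
  assumes \<psi>: "\<psi> \<in> smooth_vectors W"
  shows "dirder v (\<lambda>\<xi>. W \<xi> \<psi>) \<xi> = W \<xi> (rep_deriv W v \<psi>) - scaleC (\<i> * \<sigma> \<xi> (T v)) (W \<xi> \<psi>)"
proof (rule vector_derivative_unique_at)
  show "((\<lambda>t. W (\<xi> + t *\<^sub>R v) \<psi>) has_vector_derivative dirder v (\<lambda>\<xi>. W \<xi> \<psi>) \<xi>) (at 0)"
    using has_vector_derivative_line[where x = \<xi> and t = 0 and v = v, OF smooth_vector_differentiable[OF \<psi>]] by simp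
  have "W (\<xi> + t *\<^sub>R v) \<psi> = scaleC (cis (t * (- \<sigma> \<xi> (T v)))) (W \<xi> (W (t *\<^sub>R v) \<psi>))" for t
    by (simp add: omega_representationD(2)[OF W] scaleC_scaleC cis_mult linear_cmul[OF T] scaleR_right scaleC_one)
  moreover have "((\<lambda>t. W \<xi> (W (t *\<^sub>R v) \<psi>)) has_vector_derivative W \<xi> (rep_deriv W v \<psi>)) (at 0)"
    by (rule bounded_linear.has_vector_derivative[OF unitary_bounded_linear[OF omega_representationD(1)[OF W]] rep_line_derivative[OF \<psi>]])
  from bounded_bilinear.has_vector_derivative[OF bounded_bilinear_scaleC has_vector_derivative_cis_zero[of "- \<sigma> \<xi> (T v)"] this]
  have "((\<lambda>t. scaleC (cis (t * (- \<sigma> \<xi> (T v)))) (W \<xi> (W (t *\<^sub>R v) \<psi>))) has_vector_derivative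
      W \<xi> (rep_deriv W v \<psi>) + scaleC (\<i> * (- \<sigma> \<xi> (T v))) (W \<xi> \<psi>)) (at 0)"
    by (simp add: rep_zero scaleC_one)
  moreover have "scaleC (\<i> * (- \<sigma> \<xi> (T v))) (W \<xi> \<psi>) = - scaleC (\<i> * \<sigma> \<xi> (T v)) (W \<xi> \<psi>)"
    using bounded_bilinear.minus_left[OF bounded_bilinear_scaleC] by simp
  ultimately show "((\<lambda>t. W (\<xi> + t *\<^sub>R v) \<psi>) has_vector_derivative
      W \<xi> (rep_deriv W v \<psi>) - scaleC (\<i> * \<sigma> \<xi> (T v)) (W \<xi> \<psi>)) (at 0)"
    by simp
qed

text \<open>Solving \<open>dirder_rep\<close> for \<open>W \<xi> (rep_deriv W v \<psi>)\<close>
  leaves a derivative of a smooth orbit plus a linear multiple of that orbit.\<close>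

lemma rep_deriv_smooth:
  assumes \<psi>: "\<psi> \<in> smooth_vectors W"
  shows "rep_deriv W v \<psi> \<in> smooth_vectors W"
proof -
  have "linear (\<lambda>\<xi>. \<sigma> \<xi> (T v))" by (intro linearI) (simp_all add: add_left scaleR_left)
  then obtain w where w: "\<And>\<xi>. \<sigma> \<xi> (T v) = \<xi> \<bullet> w" by (rule linear_functional_inner) (rule that)
  have sm: "smooth (\<lambda>\<xi>. W \<xi> \<psi>)" using \<psi> by (simp add: smooth_vectors_def)
  have "smooth (\<lambda>\<xi>. dirder v (\<lambda>\<xi>. W \<xi> \<psi>) \<xi> + (\<xi> \<bullet> w) *\<^sub>R scaleC \<i> (W \<xi> \<psi>))"
    by (intro smooth_add smooth_dirder sm smooth_scaleR_inner
        smooth_bounded_linear[OF bounded_bilinear.bounded_linear_right[OF bounded_bilinear_scaleC] sm])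
  moreover have "(\<lambda>\<xi>. dirder v (\<lambda>\<xi>. W \<xi> \<psi>) \<xi> + (\<xi> \<bullet> w) *\<^sub>R scaleC \<i> (W \<xi> \<psi>)) = (\<lambda>\<xi>. W \<xi> (rep_deriv W v \<psi>))"
    by (rule ext) (simp add: dirder_rep[OF \<psi>] w scaleR_scaleC scaleC_scaleC mult.commute)
  ultimately show ?thesis by (simp add: smooth_vectors_def)
qed

text \<open>Differentiating \<open>\<langle>W(tv) \<phi>, W(tv) W(\<xi>) \<psi>\<rangle> = \<langle>\<phi>, W(\<xi>) \<psi>\<rangle>\<close> at \<open>t = 0\<close>, after moving \<open>W(tv)\<close> past
  \<open>W(\<xi>)\<close>.\<close>

lemma twisted_form_coefficient:
  assumes \<phi>: "\<phi> \<in> smooth_vectors W" and \<psi>: "\<psi> \<in> smooth_vectors W"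
  shows "\<i> * twisted_form \<sigma> T v \<xi> * cinner \<phi> (W \<xi> \<psi>) +
    (cinner \<phi> (W \<xi> (rep_deriv W v \<psi>)) + cinner (rep_deriv W v \<phi>) (W \<xi> \<psi>)) = 0"
proof (rule vector_derivative_unique_at)
  let ?f = "\<lambda>t. cis (t * twisted_form \<sigma> T v \<xi>) * cinner (W (t *\<^sub>R v) \<phi>) (W \<xi> (W (t *\<^sub>R v) \<psi>))"
  have comm: "W (t *\<^sub>R v) (W \<xi> \<psi>) = scaleC (cis (t * twisted_form \<sigma> T v \<xi>)) (W \<xi> (W (t *\<^sub>R v) \<psi>))" for t
    by (simp add: omega_representationD(2)[OF W] scaleC_scaleC cis_mult linear_cmul[OF T] scaleR_right scaleR_left
        twisted_form_eq[OF \<sigma> T] add.commute right_diff_distrib)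
  have "?f t = cinner \<phi> (W \<xi> \<psi>)" for t
  proof -
    have "?f t = cinner (W (t *\<^sub>R v) \<phi>) (W (t *\<^sub>R v) (W \<xi> \<psi>))" by (simp add: comm cinner_scaleC_right)
    then show ?thesis using omega_representationD(1)[OF W] by (simp add: unitary_operator_def)
  qed
  then show "(?f has_vector_derivative 0) (at 0)" by simp
  have "((\<lambda>t. W \<xi> (W (t *\<^sub>R v) \<psi>)) has_vector_derivative W \<xi> (rep_deriv W v \<psi>)) (at 0)"
    by (rule bounded_linear.has_vector_derivative[OF unitary_bounded_linear[OF omega_representationD(1)[OF W]] rep_line_derivative[OF \<psi>]])
  from bounded_bilinear.has_vector_derivative[OF bounded_bilinear_cinner rep_line_derivative[OF \<phi>] this]
  have "((\<lambda>t. cinner (W (t *\<^sub>R v) \<phi>) (W \<xi> (W (t *\<^sub>R v) \<psi>))) has_vector_derivative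
      cinner \<phi> (W \<xi> (rep_deriv W v \<psi>)) + cinner (rep_deriv W v \<phi>) (W \<xi> \<psi>)) (at 0)"
    by (simp add: rep_zero)
  from bounded_bilinear.has_vector_derivative[OF bounded_bilinear_mult has_vector_derivative_cis_zero this]
  show "(?f has_vector_derivative (\<i> * twisted_form \<sigma> T v \<xi> * cinner \<phi> (W \<xi> \<psi>) +
    (cinner \<phi> (W \<xi> (rep_deriv W v \<psi>)) + cinner (rep_deriv W v \<phi>) (W \<xi> \<psi>)))) (at 0)"
    by (simp add: rep_zero add.commute)
qed

text \<open>Here invertibility of R is used: each \<open>\<xi> \<bullet> w\<close> is a value of the
  twisted form, which \<open>twisted_form_coefficient\<close> turns into generators on \<phi> and
  \<psi>.\<close>

lemma coefficient_span_inner: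
  assumes R: "bij (plus_adjoint \<sigma> T)" and "coefficient_span W g"
  shows "coefficient_span W (\<lambda>\<xi>. (\<xi> \<bullet> w) *\<^sub>R g \<xi>)"
  using assms(2)
proof induction
  case (coefficient \<phi> \<psi> g)
  note \<tau> = symplectic_twisted_form[OF \<sigma> T R]
  have "linear (\<lambda>\<xi>. \<xi> \<bullet> w)" by (rule bounded_linear.linear[OF bounded_linear_inner_left])
  then obtain u where u: "\<And>\<xi>. \<xi> \<bullet> w = twisted_form \<sigma> T \<xi> u" by (rule symplectic_represents[OF \<tau>]) (rule that)
  let ?h = "\<lambda>\<xi>. cinner \<phi> (W \<xi> (rep_deriv W u \<psi>)) + cinner (rep_deriv W u \<phi>) (W \<xi> \<psi>)"
  have "coefficient_span W ?h"
    by (rule coefficient_span.add[OF coefficient_span.coefficient coefficient_span.coefficient])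
      (use coefficient rep_deriv_smooth in auto)
  moreover have "(\<xi> \<bullet> w) *\<^sub>R g \<xi> = (- \<i>) * ?h \<xi>" for \<xi>
  proof -
    have "?h \<xi> = - (\<i> * twisted_form \<sigma> T u \<xi> * cinner \<phi> (W \<xi> \<psi>))"
      using twisted_form_coefficient[OF coefficient(1,2), of u \<xi>] by (simp add: add_eq_0_iff)
    moreover have "twisted_form \<sigma> T u \<xi> = - (\<xi> \<bullet> w)"
      using symplectic_antisym[OF \<tau>, of u \<xi>] u[of \<xi>] by simp
    ultimately show ?thesis
      by (simp add: coefficient scaleR_conv_of_real mult.assoc[symmetric])
  qed
  ultimately show ?case by (rule coefficient_span.scale)
next
  case (scale f g c)
  show ?case by (rule coefficient_span.scale[OF scale.IH, of _ c]) (simp add: scale)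
next
  case (add f g h)
  show ?case by (rule coefficient_span.add[OF add.IH]) (simp add: add scaleR_add_right)
qed

text \<open>A derivative gives a generator on \<psi> and a linear factor from the phase;
  \<open>coefficient_span_inner\<close> takes the latter back into the span.\<close>

lemma coefficient_span_dirder:
  assumes R: "bij (plus_adjoint \<sigma> T)" and "coefficient_span W g"
  shows "(\<forall>\<xi>. g differentiable (at \<xi>)) \<and> coefficient_span W (dirder v g)"
  using assms(2)
proof induction
  case (coefficient \<phi> \<psi> g)
  have g: "g = (\<lambda>\<xi>. cinner \<phi> (W \<xi> \<psi>))" using coefficient by auto
  have bl: "bounded_linear (cinner \<phi>)" by (rule bounded_bilinear.bounded_linear_right[OF bounded_bilinear_cinner])
  have diff: "g differentiable (at \<xi>)" for \<xi>
    using bounded_linear.has_derivative[OF bl has_derivative_dirder[OF smooth_vector_differentiable[OF coefficient(2)]]]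
    unfolding g differentiable_def by blast
  have "linear (\<lambda>\<xi>. \<sigma> \<xi> (T v))" by (intro linearI) (simp_all add: add_left scaleR_left)
  then obtain w where w: "\<And>\<xi>. \<sigma> \<xi> (T v) = \<xi> \<bullet> w" by (rule linear_functional_inner) (rule that)
  have "coefficient_span W g" by (rule coefficient_span.coefficient[OF coefficient])
  then have inner: "coefficient_span W (\<lambda>\<xi>. (- \<i>) * ((\<xi> \<bullet> w) *\<^sub>R g \<xi>))"
    by (rule coefficient_span.scale[OF coefficient_span_inner[OF R] refl])
  have main: "coefficient_span W (\<lambda>\<xi>. cinner \<phi> (W \<xi> (rep_deriv W v \<psi>)))"
    by (rule coefficient_span.coefficient[OF coefficient(1) rep_deriv_smooth[OF coefficient(2)] refl])
  have "dirder v g \<xi> = cinner \<phi> (W \<xi> (rep_deriv W v \<psi>)) + (- \<i>) * ((\<xi> \<bullet> w) *\<^sub>R g \<xi>)" for \<xi>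
  proof -
    have "dirder v g \<xi> = cinner \<phi> (dirder v (\<lambda>\<xi>. W \<xi> \<psi>) \<xi>)"
      unfolding g using fun_cong[OF dirder_bounded_linear[OF bl smooth_vector_differentiable[OF coefficient(2)]]] .
    then show ?thesis
      by (simp add: dirder_rep[OF coefficient(2)] bounded_bilinear.diff_right[OF bounded_bilinear_cinner]
          cinner_scaleC_right w g scaleR_conv_of_real)
  qed
  from coefficient_span.add[OF main inner this] show ?case using diff by blast
next
  case (scale f g c)
  have g: "g = (\<lambda>\<xi>. c * f \<xi>)" using scale by auto
  have "coefficient_span W (dirder v g)"
    by (rule coefficient_span.scale[of _ "dirder v f" _ c])
      (use scale in \<open>auto simp: g dirder_bounded_linear[OF bounded_linear_mult_right]\<close>)
  then show ?case using scale by (auto simp: g)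
next
  case (add f g h)
  have h: "h = (\<lambda>\<xi>. f \<xi> + g \<xi>)" using add by auto
  have "coefficient_span W (dirder v h)"
    by (rule coefficient_span.add[of _ "dirder v f" "dirder v g"]) (use add in \<open>auto simp: h dirder_add\<close>)
  then show ?case using add by (auto simp: h intro!: differentiable_add)
qed

lemma coefficient_span_bounded:
  assumes "coefficient_span W g"
  shows "\<exists>C. \<forall>\<xi>. norm (g \<xi>) \<le> C"
  using assms
proof induction
  case (coefficient \<phi> \<psi> g)
  have "norm (g \<xi>) \<le> norm \<phi> * norm \<psi>" for \<xi>
    using norm_cinner_le[of \<phi> "W \<xi> \<psi>"] by (simp add: coefficient unitary_norm[OF omega_representationD(1)[OF W]])
  then show ?case by blast
next
  case (scale f g c)
  then obtain C where C: "\<And>\<xi>. norm (f \<xi>) \<le> C" by blast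
  have "norm (g \<xi>) \<le> norm c * C" for \<xi> by (simp add: scale norm_mult mult_left_mono C)
  then show ?case by blast
next
  case (add f g h)
  then obtain C D where C: "\<And>\<xi>. norm (f \<xi>) \<le> C" and D: "\<And>\<xi>. norm (g \<xi>) \<le> D" by blast
  have "norm (h \<xi>) \<le> C + D" for \<xi> unfolding add.hyps by (rule norm_triangle_mono[OF C D])
  then show ?case by blast
qed

lemma coefficient_schwartz:
  assumes R: "bij (plus_adjoint \<sigma> T)" and "\<phi> \<in> smooth_vectors W" "\<psi> \<in> smooth_vectors W"
  shows "(\<lambda>\<xi>. cinner \<phi> (W \<xi> \<psi>)) \<in> schwartz"
proof (rule schwartz_coinduct)
  show "(\<lambda>\<xi>. cinner \<phi> (W \<xi> \<psi>)) \<in> Collect (coefficient_span W)"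
    unfolding mem_Collect_eq by (rule coefficient_span.coefficient[OF assms(2,3) refl])
qed (use coefficient_span_dirder[OF R] coefficient_span_inner[OF R] coefficient_span_bounded in auto)

end

section \<open>Comparison of the two calculi\<close>

lemma inv_det_inv:
  fixes S :: "'w::euclidean_space \<Rightarrow> 'w"
  assumes S: "linear S" "bij S"
  shows "inv_det (inv S) * inv_det S = 1"
proof -
  have S': "linear (inv S)" "bij (inv S)"
    using inj_linear_imp_inv_linear[OF S(1) bij_is_inj[OF S(2)]] bij_imp_bij_inv[OF S(2)] .
  let ?g = "indicat_real (cbox 0 One :: 'w set)"
  have [measurable]: "S \<in> borel_measurable borel"
    by (rule borel_measurable_continuous_onI[OF linear_continuous_on[OF linear_conv_bounded_linear[THEN iffD1, OF S(1)]]])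
  have g: "?g \<in> borel_measurable borel" "(\<lambda>x. ?g (S x)) \<in> borel_measurable borel" by measurable
  have "(LINT x|lborel. ?g x) = (LINT x|lborel. ?g (S (inv S x)))"
    using S(2) by (simp add: bij_is_surj surj_f_inv_f)
  also have "\<dots> = inv_det (inv S) * (inv_det S * (LINT x|lborel. ?g x))"
    by (simp only: lborel_integral_linear[OF S' g(2)] lborel_integral_linear[OF S g(1)] real_scaleR_def)
  finally show ?thesis by simp
qed

lemma fourier_multiplier_apply:
  assumes \<rho>: "symplectic_form \<rho>" and \<phi>: "\<phi> \<in> schwartz"
    and l: "\<And>f. f \<in> schwartz \<Longrightarrow> (\<lambda>\<xi>. cnj (l \<xi>) * f \<xi>) \<in> schwartz"
  shows "fourier_multiplier \<rho> l u \<phi> = u (fourier \<rho> (\<lambda>\<xi>. cnj (l \<xi>) * fourier \<rho> \<phi> \<xi>))"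
  using schwartz_opD[OF schwartz_op_fourier[OF \<rho>] \<phi>] \<phi> l
  by (simp add: fourier_multiplier_def fourier_dist_def mult_dist_def)

context
  fixes \<sigma> :: "'w::euclidean_space \<Rightarrow> 'w \<Rightarrow> real" and T :: "'w \<Rightarrow> 'w"
  assumes \<sigma>: "symplectic_form \<sigma>" and T: "linear T" and R: "bij (plus_adjoint \<sigma> T)"
begin

interpretation bounded_bilinear \<sigma> by (rule symplectic_bounded_bilinear[OF \<sigma>])

lemmas R_selfadjoint = plus_adjoint_selfadjoint[OF \<sigma> T]
  and R_linear = linear_plus_adjoint[OF \<sigma> T]
  and twisted_symplectic = symplectic_twisted_form[OF \<sigma> T R]

lemma R_inv: "plus_adjoint \<sigma> T (inv (plus_adjoint \<sigma> T) x) = x" "inv (plus_adjoint \<sigma> T) (plus_adjoint \<sigma> T x) = x"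
  using R by (simp_all add: bij_is_surj surj_f_inv_f bij_is_inj)

lemma R_inv_linear: "linear (inv (plus_adjoint \<sigma> T))" "bij (inv (plus_adjoint \<sigma> T))"
  using inj_linear_imp_inv_linear[OF R_linear bij_is_inj[OF R]] bij_imp_bij_inv[OF R] .

section \<open>Fourier transforms and constants of the two forms\<close>

lemma lfourier_twisted: "lfourier (twisted_form \<sigma> T) f \<xi> = lfourier \<sigma> f (plus_adjoint \<sigma> T \<xi>)"
  by (simp add: fourier_wrt_def twisted_form_def R_selfadjoint)

lemma lfourier_comp_plus_adjoint:
  assumes "f \<in> schwartz"
  shows "lfourier \<sigma> (f \<circ> plus_adjoint \<sigma> T) (plus_adjoint \<sigma> T \<xi>) = inv_det (plus_adjoint \<sigma> T) * lfourier \<sigma> f \<xi>"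
  by (rule lfourier_linear[OF \<sigma> assms R_linear R]) (simp add: R_selfadjoint R_inv)

lemma lfourier_comp_inv_plus_adjoint:
  assumes "f \<in> schwartz"
  shows "lfourier \<sigma> (f \<circ> inv (plus_adjoint \<sigma> T)) \<xi> =
    inv_det (inv (plus_adjoint \<sigma> T)) * lfourier \<sigma> f (plus_adjoint \<sigma> T \<xi>)"
  by (rule lfourier_linear[OF \<sigma> assms R_inv_linear]) (simp add: R_selfadjoint inv_inv_eq[OF R])

text \<open>Both inversion formulas are read at the origin for the Gaussian. The inner transform of
  the twisted form is the one for \<sigma> composed with R, and transforming that composition
  releases the determinant. \<open>X\<close> is the inversion constant of \<sigma>.\<close>

lemma form_density_twisted:
  "(form_density (twisted_form \<sigma> T))\<^sup>2 * inv_det (plus_adjoint \<sigma> T) = (form_density \<sigma>)\<^sup>2"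
proof -
  let ?R = "plus_adjoint \<sigma> T"
  define X :: complex where "X = lfourier \<sigma> (lfourier \<sigma> gaussian) 0"
  note F = schwartz_opD[OF schwartz_op_lfourier[OF \<sigma>] gaussian_schwartz]
  have "lfourier (twisted_form \<sigma> T) gaussian = lfourier \<sigma> gaussian \<circ> ?R"
    by (simp add: fun_eq_iff lfourier_twisted)
  then have "lfourier (twisted_form \<sigma> T) (lfourier (twisted_form \<sigma> T) gaussian) 0 = inv_det ?R * X"
    using lfourier_comp_plus_adjoint[OF F, of 0] by (simp add: lfourier_twisted X_def)
  then have 1: "of_real ((form_density (twisted_form \<sigma> T))\<^sup>2 * inv_det ?R) * X = 1"
    using form_density_inversion[OF twisted_symplectic gaussian_schwartz, of 0] by (simp add: gaussian_def mult.assoc)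
  have 2: "of_real ((form_density \<sigma>)\<^sup>2) * X = 1"
    using form_density_inversion[OF \<sigma> gaussian_schwartz, of 0] by (simp add: gaussian_def X_def)
  then have "X \<noteq> 0" by auto
  then have "complex_of_real ((form_density (twisted_form \<sigma> T))\<^sup>2 * inv_det ?R) = of_real ((form_density \<sigma>)\<^sup>2)"
    using 1 2 by (metis mult_right_cancel)
  then show ?thesis by (simp only: of_real_eq_iff)
qed

lemma bilinear_quad_phase: "bilinear (\<lambda>x y. c * \<sigma> x (T y))"
  unfolding bilinear_def
  by (auto intro!: linearI simp: linear_add[OF T] linear_cmul[OF T] add_left add_right scaleR_left scaleR_right distrib_left)

lemma lambda_symbol_cis: "lambda_symbol \<sigma> T x = cis ((- 1 / 2) * \<sigma> x (T x))"
  by (simp add: lambda_symbol_def quad_phase_def cis_conv_exp)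

lemma lambda_symbol_schwartz:
  assumes "f \<in> schwartz"
  shows "(\<lambda>\<xi>. lambda_symbol \<sigma> T \<xi> * f \<xi>) \<in> schwartz" "(\<lambda>\<xi>. cnj (lambda_symbol \<sigma> T \<xi>) * f \<xi>) \<in> schwartz"
  using schwartz_opD[OF schwartz_op_cis_quadratic[OF bilinear_quad_phase[of "- 1 / 2"]] assms]
    schwartz_opD[OF schwartz_op_cis_quadratic[OF bilinear_quad_phase[of "1 / 2"]] assms]
  by (simp_all add: lambda_symbol_cis cis_cnj)

lemma comp_schwartz:
  assumes "f \<in> schwartz"
  shows "f \<circ> plus_adjoint \<sigma> T \<in> schwartz" "f \<circ> inv (plus_adjoint \<sigma> T) \<in> schwartz"
  using schwartz_opD[OF schwartz_op_compose_linear[OF R_linear R] assms]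
    schwartz_opD[OF schwartz_op_compose_linear[OF R_inv_linear] assms] .

lemma lambda_symbol_inv_schwartz:
  assumes "f \<in> schwartz"
  shows "(\<lambda>\<xi>. cnj ((lambda_symbol \<sigma> T \<circ> inv (plus_adjoint \<sigma> T)) \<xi>) * f \<xi>) \<in> schwartz"
proof -
  have "(\<lambda>\<xi>. cnj ((lambda_symbol \<sigma> T \<circ> inv (plus_adjoint \<sigma> T)) \<xi>) * f \<xi>) =
      (\<lambda>\<xi>. cnj (lambda_symbol \<sigma> T \<xi>) * (f \<circ> plus_adjoint \<sigma> T) \<xi>) \<circ> inv (plus_adjoint \<sigma> T)"
    by (simp add: fun_eq_iff R_inv)
  then show ?thesis using comp_schwartz(2)[OF lambda_symbol_schwartz(2)[OF comp_schwartz(1)[OF assms]]] by simp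
qed

text \<open>All three expressions for the symbol reduce to the test function
  \<open>\<F>\<^sub>\<sigma>(cnj \<lambda> \<cdot> \<F>\<^sub>\<sigma>\<phi> \<circ> (T + T\<^sup>\<sigma>))\<close> up to a constant.\<close>

lemma
  assumes \<phi>: "\<phi> \<in> schwartz"
  defines "h \<equiv> \<lambda>\<xi>. cnj (lambda_symbol \<sigma> T \<xi>) * lfourier \<sigma> \<phi> (plus_adjoint \<sigma> T \<xi>)"
    and "k \<equiv> complex_of_real ((form_density \<sigma>)\<^sup>2 * inv_det (inv (plus_adjoint \<sigma> T)))"
  shows fourier_lambda_1: "fourier \<sigma> (\<lambda>\<xi>. cnj (lambda_symbol \<sigma> T \<xi>) * fourier \<sigma> (\<phi> \<circ> inv (plus_adjoint \<sigma> T)) \<xi>) =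
        (\<lambda>x. k * lfourier \<sigma> h x)"
    and fourier_lambda_2: "fourier \<sigma> (\<lambda>\<xi>. cnj ((lambda_symbol \<sigma> T \<circ> inv (plus_adjoint \<sigma> T)) \<xi>) * fourier \<sigma> \<phi> \<xi>) \<circ>
          inv (plus_adjoint \<sigma> T) = (\<lambda>x. k * lfourier \<sigma> h x)"
    and fourier_lambda_3: "fourier (twisted_form \<sigma> T) (\<lambda>\<xi>. cnj (lambda_symbol \<sigma> T \<xi>) * fourier (twisted_form \<sigma> T) \<phi> \<xi>) \<circ>
          inv (plus_adjoint \<sigma> T) = (\<lambda>x. k * lfourier \<sigma> h x)"
proof -
  let ?R = "plus_adjoint \<sigma> T" and ?\<tau> = "twisted_form \<sigma> T" and ?l = "lambda_symbol \<sigma> T"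
  note F\<phi> = schwartz_opD[OF schwartz_op_lfourier[OF \<sigma>] \<phi>]
  have h: "h \<in> schwartz"
    using lambda_symbol_schwartz(2)[OF comp_schwartz(1)[OF F\<phi>]] by (simp add: h_def)
  have lF: "(\<lambda>\<xi>. cnj (?l \<xi>) * fourier \<sigma> (\<phi> \<circ> inv ?R) \<xi>) =
      (\<lambda>\<xi>. complex_of_real (form_density \<sigma> * inv_det (inv ?R)) * h \<xi>)"
    by (simp add: fourier_eq[OF \<sigma> comp_schwartz(2)[OF \<phi>]] lfourier_comp_inv_plus_adjoint[OF \<phi>] h_def mult_ac)
  show "fourier \<sigma> (\<lambda>\<xi>. cnj (?l \<xi>) * fourier \<sigma> (\<phi> \<circ> inv ?R) \<xi>) = (\<lambda>x. k * lfourier \<sigma> h x)"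
    unfolding lF fourier_eq[OF \<sigma> schwartz_mult_const(1)[OF h]] lfourier_cmult[OF \<sigma> h]
    by (simp add: k_def power2_eq_square mult_ac)
  define g where "g = (\<lambda>\<xi>. cnj ((?l \<circ> inv ?R) \<xi>) * lfourier \<sigma> \<phi> \<xi>)"
  have g: "g \<in> schwartz" unfolding g_def by (rule lambda_symbol_inv_schwartz[OF F\<phi>])
  have "g \<circ> ?R = h" by (simp add: fun_eq_iff g_def h_def R_inv)
  then have "lfourier \<sigma> h x = inv_det ?R * lfourier \<sigma> g (inv ?R x)" for x
    using lfourier_comp_plus_adjoint[OF g, of "inv ?R x"] by (simp add: R_inv)
  then have gh: "lfourier \<sigma> g (inv ?R x) = inv_det (inv ?R) * lfourier \<sigma> h x" for x
    using inv_det_inv[OF R_linear R] by (simp add: mult.assoc[symmetric] flip: of_real_mult)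
  have gF: "(\<lambda>\<xi>. cnj ((?l \<circ> inv ?R) \<xi>) * fourier \<sigma> \<phi> \<xi>) = (\<lambda>\<xi>. form_density \<sigma> * g \<xi>)"
    by (simp add: fourier_eq[OF \<sigma> \<phi>] g_def mult_ac)
  show "fourier \<sigma> (\<lambda>\<xi>. cnj ((?l \<circ> inv ?R) \<xi>) * fourier \<sigma> \<phi> \<xi>) \<circ> inv ?R = (\<lambda>x. k * lfourier \<sigma> h x)"
    unfolding gF fourier_eq[OF \<sigma> schwartz_mult_const(1)[OF g]] lfourier_cmult[OF \<sigma> g]
    by (simp add: fun_eq_iff gh k_def power2_eq_square)
  \<comment> \<open>Both transforms in the third expression carry
    \<open>form_density ?\<tau>\<close>, with no Jacobian; this identity makes their product the
    constant \<open>k\<close> of the other two.\<close>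
  have "(form_density ?\<tau>)\<^sup>2 = (form_density \<sigma>)\<^sup>2 * inv_det (inv ?R)"
    unfolding form_density_twisted[symmetric] mult.assoc mult.commute[of "inv_det ?R"]
    by (simp only: inv_det_inv[OF R_linear R] mult_1_right)
  then have k: "k = of_real ((form_density ?\<tau>)\<^sup>2)" by (simp add: k_def)
  have tF: "(\<lambda>\<xi>. cnj (?l \<xi>) * fourier ?\<tau> \<phi> \<xi>) = (\<lambda>\<xi>. form_density ?\<tau> * h \<xi>)"
    by (simp add: fourier_eq[OF twisted_symplectic \<phi>] lfourier_twisted h_def mult_ac)
  show "fourier ?\<tau> (\<lambda>\<xi>. cnj (?l \<xi>) * fourier ?\<tau> \<phi> \<xi>) \<circ> inv ?R = (\<lambda>x. k * lfourier \<sigma> h x)"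
    unfolding tF fourier_eq[OF twisted_symplectic schwartz_mult_const(1)[OF h]] lfourier_cmult[OF twisted_symplectic h]
    by (simp add: fun_eq_iff lfourier_twisted R_inv k power2_eq_square)
qed

lemma pullback_fourier_multiplier:
  "pullback_dist (plus_adjoint \<sigma> T) (fourier_multiplier \<sigma> (lambda_symbol \<sigma> T) a) =
    fourier_multiplier \<sigma> (lambda_symbol \<sigma> T \<circ> inv (plus_adjoint \<sigma> T)) (pullback_dist (plus_adjoint \<sigma> T) a)"
  "pullback_dist (plus_adjoint \<sigma> T) (fourier_multiplier \<sigma> (lambda_symbol \<sigma> T) a) =
    fourier_multiplier (twisted_form \<sigma> T) (lambda_symbol \<sigma> T) (pullback_dist (plus_adjoint \<sigma> T) a)"
proof -
  let ?R = "plus_adjoint \<sigma> T" and ?\<tau> = "twisted_form \<sigma> T" and ?l = "lambda_symbol \<sigma> T"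
  have ext: "u = v" if "u \<in> extensional schwartz" "v \<in> extensional schwartz"
    "\<And>\<phi>. \<phi> \<in> schwartz \<Longrightarrow> u \<phi> = v \<phi>" for u v :: "('w \<Rightarrow> complex) \<Rightarrow> complex"
    using that by (intro extensionalityI)
  have F: "fourier \<rho> \<psi> \<in> schwartz" if "symplectic_form \<rho>" "\<psi> \<in> schwartz" for \<rho> and \<psi> :: "'w \<Rightarrow> complex"
    by (rule schwartz_opD[OF schwartz_op_fourier[OF that(1)] that(2)])
  have mem: "pullback_dist ?R u \<in> extensional schwartz" "fourier_multiplier \<rho> l u \<in> extensional schwartz" for u \<rho> l
    by (simp_all add: pullback_dist_def fourier_multiplier_def fourier_dist_def)
  have 1: "pullback_dist ?R (fourier_multiplier \<sigma> ?l a) \<phi> = inv_det ?R *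
      a (fourier \<sigma> (\<lambda>\<xi>. cnj (?l \<xi>) * fourier \<sigma> (\<phi> \<circ> inv ?R) \<xi>))" if "\<phi> \<in> schwartz" for \<phi>
    using that fourier_multiplier_apply[OF \<sigma> comp_schwartz(2)[OF that] lambda_symbol_schwartz(2)]
    by (simp add: pullback_dist_def inv_det_def)
  show "pullback_dist ?R (fourier_multiplier \<sigma> ?l a) = fourier_multiplier \<sigma> (?l \<circ> inv ?R) (pullback_dist ?R a)"
  proof (rule ext[OF mem])
    fix \<phi> :: "'w \<Rightarrow> complex" assume \<phi>: "\<phi> \<in> schwartz"
    have "fourier_multiplier \<sigma> (?l \<circ> inv ?R) (pullback_dist ?R a) \<phi> =
        pullback_dist ?R a (fourier \<sigma> (\<lambda>\<xi>. cnj ((?l \<circ> inv ?R) \<xi>) * fourier \<sigma> \<phi> \<xi>))"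
      by (rule fourier_multiplier_apply[OF \<sigma> \<phi> lambda_symbol_inv_schwartz])
    also have "\<dots> = inv_det ?R * a (fourier \<sigma> (\<lambda>\<xi>. cnj ((?l \<circ> inv ?R) \<xi>) * fourier \<sigma> \<phi> \<xi>) \<circ> inv ?R)"
      unfolding pullback_dist_def inv_det_def
      by (rule restrict_apply'[OF F[OF \<sigma> lambda_symbol_inv_schwartz[OF F[OF \<sigma> \<phi>]]]])
    finally show "pullback_dist ?R (fourier_multiplier \<sigma> ?l a) \<phi> =
        fourier_multiplier \<sigma> (?l \<circ> inv ?R) (pullback_dist ?R a) \<phi>"
      unfolding 1[OF \<phi>] fourier_lambda_1[OF \<phi>] fourier_lambda_2[OF \<phi>] ..
  qed
  show "pullback_dist ?R (fourier_multiplier \<sigma> ?l a) = fourier_multiplier ?\<tau> ?l (pullback_dist ?R a)"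
  proof (rule ext[OF mem])
    fix \<phi> :: "'w \<Rightarrow> complex" assume \<phi>: "\<phi> \<in> schwartz"
    have "fourier_multiplier ?\<tau> ?l (pullback_dist ?R a) \<phi> =
        pullback_dist ?R a (fourier ?\<tau> (\<lambda>\<xi>. cnj (?l \<xi>) * fourier ?\<tau> \<phi> \<xi>))"
      by (rule fourier_multiplier_apply[OF twisted_symplectic \<phi> lambda_symbol_schwartz(2)])
    also have "\<dots> = inv_det ?R * a (fourier ?\<tau> (\<lambda>\<xi>. cnj (?l \<xi>) * fourier ?\<tau> \<phi> \<xi>) \<circ> inv ?R)"
      unfolding pullback_dist_def inv_det_def
      by (rule restrict_apply'[OF F[OF twisted_symplectic lambda_symbol_schwartz(2)[OF F[OF twisted_symplectic \<phi>]]]])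
    finally show "pullback_dist ?R (fourier_multiplier \<sigma> ?l a) \<phi> = fourier_multiplier ?\<tau> ?l (pullback_dist ?R a) \<phi>"
      unfolding 1[OF \<phi>] fourier_lambda_1[OF \<phi>] fourier_lambda_3[OF \<phi>] ..
  qed
qed

section \<open>Equality of the two calculi\<close>

lemma symbol_tempered:
  assumes "a \<in> tempered_distributions"
  shows "pullback_dist (plus_adjoint \<sigma> T) (fourier_multiplier \<sigma> (lambda_symbol \<sigma> T) a) \<in> tempered_distributions"
  unfolding fourier_multiplier_def
  by (intro pullback_dist_tempered R_linear R fourier_dist_tempered \<sigma>
      mult_dist_tempered[OF bilinear_quad_phase lambda_symbol_cis] assms)

text \<open>The transform in the calculus cancels the one that the multiplier applies first to the
  test function, and the conjugate of \<lambda> cancels \<lambda>. What remains is the twisted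
  transform of \<open>f\<close>, composed with the inverse of R by the pullback: a multiple of the
  \<sigma>-transform.\<close>

lemma symbol_pairing:
  assumes a: "a \<in> tempered_distributions" and f: "f \<in> schwartz"
  shows "form_pairing (twisted_form \<sigma> T) (\<lambda>\<xi>. lambda_symbol \<sigma> T \<xi> * f \<xi>)
      (fourier_dist (twisted_form \<sigma> T) (fourier_multiplier (twisted_form \<sigma> T) (lambda_symbol \<sigma> T)
        (pullback_dist (plus_adjoint \<sigma> T) a))) =
    form_pairing \<sigma> f (fourier_dist \<sigma> a)"
proof -
  let ?R = "plus_adjoint \<sigma> T" and ?\<tau> = "twisted_form \<sigma> T" and ?l = "lambda_symbol \<sigma> T"
  let ?f = "\<lambda>\<xi>. ?l \<xi> * f \<xi>"
  note lf = lambda_symbol_schwartz(1)[OF f]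
  have F: "fourier \<rho> \<psi> \<in> schwartz" if "symplectic_form \<rho>" "\<psi> \<in> schwartz" for \<rho> and \<psi> :: "'w \<Rightarrow> complex"
    by (rule schwartz_opD[OF schwartz_op_fourier[OF that(1)] that(2)])
  have "(\<lambda>\<xi>. cnj (?l \<xi>) * fourier ?\<tau> (fourier ?\<tau> ?f) \<xi>) = f"
    unfolding fourier_fourier[OF twisted_symplectic lf]
    by (simp add: fun_eq_iff lambda_symbol_cis cis_cnj cis_mult flip: mult.assoc)
  then have "fourier_dist ?\<tau> (fourier_multiplier ?\<tau> ?l (pullback_dist ?R a)) ?f = pullback_dist ?R a (fourier ?\<tau> f)"
    using fourier_multiplier_apply[OF twisted_symplectic F[OF twisted_symplectic lf] lambda_symbol_schwartz(2)] lf
    by (simp add: fourier_dist_def)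
  also have "\<dots> = inv_det ?R * a (fourier ?\<tau> f \<circ> inv ?R)"
    using F[OF twisted_symplectic f] by (simp add: pullback_dist_def inv_det_def)
  also have "fourier ?\<tau> f \<circ> inv ?R = (\<lambda>x. of_real (form_density ?\<tau> / form_density \<sigma>) * fourier \<sigma> f x)"
    using form_density_pos[OF \<sigma>]
    by (simp add: fun_eq_iff fourier_eq[OF twisted_symplectic f] fourier_eq[OF \<sigma> f] lfourier_twisted R_inv)
  also have "a \<dots> = of_real (form_density ?\<tau> / form_density \<sigma>) * a (fourier \<sigma> f)"
  proof -
    have "\<forall>c. \<forall>f\<in>schwartz. a (\<lambda>x. c * f x) = cnj c * a f"
      using a by (simp add: tempered_distributions_def)
    from bspec[OF spec[OF this] F[OF \<sigma> f]] show ?thesis by (simp only: complex_cnj_complex_of_real)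
  qed
  \<comment> \<open>One \<open>form_density ?\<tau>\<close> comes from the pairing, the quotient of
    densities from the transform, the determinant from the pullback;
    \<open>form_density_twisted\<close> reduces the product to
    \<open>form_density \<sigma>\<close>.\<close>
  finally have "form_pairing ?\<tau> ?f (fourier_dist ?\<tau> (fourier_multiplier ?\<tau> ?l (pullback_dist ?R a))) =
      of_real ((form_density ?\<tau>)\<^sup>2 * inv_det ?R / form_density \<sigma>) * a (fourier \<sigma> f)"
    by (simp add: form_pairing_def form_density_def[symmetric] power2_eq_square)
  also have "\<dots> = form_pairing \<sigma> f (fourier_dist \<sigma> a)"
    unfolding form_density_twisted using form_density_pos[OF \<sigma>] f
    by (simp add: form_pairing_def form_density_def[symmetric] fourier_dist_def power2_eq_square)
  finally show ?thesis .
qed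

text \<open>Each system is a chirp times the other, with opposite phases. Both calculi thus have the
  same domain, without which their restricted functionals could not agree.\<close>

lemma smooth_vectors_associated_weyl_system:
  "smooth_vectors (associated_weyl_system \<sigma> T W) = smooth_vectors (W :: 'w \<Rightarrow> 'h::complex_hilbert \<Rightarrow> 'h)"
proof -
  have *: "smooth (\<lambda>\<xi>. scaleC (cis (c * \<sigma> \<xi> (T \<xi>))) (f \<xi>))" if "smooth f" for c and f :: "'w \<Rightarrow> 'h"
    by (rule smooth_cis_quadratic[OF bilinear_quad_phase bounded_bilinear_scaleC _ that])
      (simp add: scaleC_scaleC)
  have eq: "associated_weyl_system \<sigma> T W \<xi> \<phi> = scaleC (cis ((1 / 2) * \<sigma> \<xi> (T \<xi>))) (W \<xi> \<phi>)" for \<xi> \<phi>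
    by (simp add: associated_weyl_system_def cis_conv_exp)
  have "W \<xi> \<phi> = scaleC (cis ((- 1 / 2) * \<sigma> \<xi> (T \<xi>))) (associated_weyl_system \<sigma> T W \<xi> \<phi>)" for \<xi> \<phi>
    by (simp add: eq scaleC_scaleC cis_mult scaleC_one)
  then have "smooth (\<lambda>\<xi>. W \<xi> \<phi>)" if "smooth (\<lambda>\<xi>. associated_weyl_system \<sigma> T W \<xi> \<phi>)" for \<phi>
    using *[OF that, of "- 1 / 2"] by simp
  moreover have "smooth (\<lambda>\<xi>. associated_weyl_system \<sigma> T W \<xi> \<phi>)" if "smooth (\<lambda>\<xi>. W \<xi> \<phi>)" for \<phi>
    using *[OF that, of "1 / 2"] by (simp add: eq)
  ultimately show ?thesis by (auto simp: smooth_vectors_def)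
qed

lemma weyl_op_associated:
  assumes W: "omega_representation \<sigma> T W" and a: "a \<in> tempered_distributions"
  shows "weyl_op (twisted_form \<sigma> T) (associated_weyl_system \<sigma> T W)
      (fourier_multiplier (twisted_form \<sigma> T) (lambda_symbol \<sigma> T) (pullback_dist (plus_adjoint \<sigma> T) a)) =
    weyl_op \<sigma> W a"
  unfolding weyl_op_def smooth_vectors_associated_weyl_system
proof (intro restrict_ext)
  fix \<psi> \<phi> assume "\<psi> \<in> smooth_vectors W" "\<phi> \<in> smooth_vectors W"
  then have f: "(\<lambda>\<xi>. cnj (cinner \<phi> (W \<xi> \<psi>))) \<in> schwartz"
    by (intro schwartz_cnj coefficient_schwartz[OF \<sigma> T W R])
  \<comment> \<open>The conjugation in the weak definition turns the phase of the associated system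
    into \<lambda>.\<close>
  have "(\<lambda>\<xi>. cnj (cinner \<phi> (associated_weyl_system \<sigma> T W \<xi> \<psi>))) =
      (\<lambda>\<xi>. lambda_symbol \<sigma> T \<xi> * cnj (cinner \<phi> (W \<xi> \<psi>)))"
    by (simp add: fun_eq_iff associated_weyl_system_def cinner_scaleC_right lambda_symbol_def quad_phase_def exp_cnj)
  then show "form_pairing (twisted_form \<sigma> T) (\<lambda>\<xi>. cnj (cinner \<phi> (associated_weyl_system \<sigma> T W \<xi> \<psi>)))
      (fourier_dist (twisted_form \<sigma> T) (fourier_multiplier (twisted_form \<sigma> T) (lambda_symbol \<sigma> T)
        (pullback_dist (plus_adjoint \<sigma> T) a))) =
    form_pairing \<sigma> (\<lambda>\<xi>. cnj (cinner \<phi> (W \<xi> \<psi>))) (fourier_dist \<sigma> a)"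
    using symbol_pairing[OF a f] by simp
qed

end

theorem theorem4p4:
  fixes \<sigma> :: "'w::euclidean_space \<Rightarrow> 'w \<Rightarrow> real"
    and T :: "'w \<Rightarrow> 'w"
    and W :: "'w \<Rightarrow> 'h::complex_hilbert \<Rightarrow> 'h"
    and a :: "('w \<Rightarrow> complex) \<Rightarrow> complex"
  assumes "symplectic_form \<sigma>"
    and "linear T"
    and "bij (plus_adjoint \<sigma> T)"
    and "omega_representation \<sigma> T W"
    and "a \<in> tempered_distributions"
  shows "\<exists>aw \<in> tempered_distributions.
      aw = pullback_dist (plus_adjoint \<sigma> T) (fourier_multiplier \<sigma> (lambda_symbol \<sigma> T) a) \<and>
      aw = fourier_multiplier \<sigma> (lambda_symbol \<sigma> T \<circ> inv (plus_adjoint \<sigma> T))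
             (pullback_dist (plus_adjoint \<sigma> T) a) \<and>
      aw = fourier_multiplier (twisted_form \<sigma> T) (lambda_symbol \<sigma> T)
             (pullback_dist (plus_adjoint \<sigma> T) a) \<and>
      weyl_op \<sigma> W a = weyl_op (twisted_form \<sigma> T) (associated_weyl_system \<sigma> T W) aw"
proof (rule bexI[OF _ symbol_tempered[OF assms(1-3,5)]], intro conjI)
  let ?aw = "pullback_dist (plus_adjoint \<sigma> T) (fourier_multiplier \<sigma> (lambda_symbol \<sigma> T) a)"
  note eqs = pullback_fourier_multiplier[OF assms(1-3), of a]
  show "?aw = fourier_multiplier \<sigma> (lambda_symbol \<sigma> T \<circ> inv (plus_adjoint \<sigma> T)) (pullback_dist (plus_adjoint \<sigma> T) a)"
    by (rule eqs(1))
  show "?aw = fourier_multiplier (twisted_form \<sigma> T) (lambda_symbol \<sigma> T) (pullback_dist (plus_adjoint \<sigma> T) a)"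
    by (rule eqs(2))
  \<comment> \<open>The calculi are compared through the third expression, whose multiplier uses the
    same twisted transform as the standard calculus.\<close>
  then show "weyl_op \<sigma> W a = weyl_op (twisted_form \<sigma> T) (associated_weyl_system \<sigma> T W) ?aw"
    using weyl_op_associated[OF assms(1-5)] by simp
qed (rule refl)


end
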